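(* (I) Let $X$ be a standard Borel space equipped with a bounded (complete separable) metric $d$, let $\mathsf{M}=(m_x)_{x\in X}$ be a transition probability kernel on $X$ and $\omega$ a modulus of continuity. Suppose $\mathsf{M}$ has a coupling $\mathsf{P}$ and let $f\in C^\omega(X,\mathbb{R})$ be a potential that is flat with respect to $\mathsf{P}$ and normalized with respect to $\mathscr{L}\equiv\mathscr{L}_{\mathsf{M},f}$. Suppose $\mathsf{P}_f$ has $\omega$-decay rate $F$ for some decay function $F$. Then there exists a constant $C>0$ such that for all Borel probability measures $\mu,\nu$ on $X$ and all $n\in\mathbb{N}$, $$W_\omega(\mathscr{L}^{*n}\mu,\mathscr{L}^{*n}\nu)\leqslant C\,W_\omega(\mu,\nu).$$ In particular, when $F$ is polynomial, $\mathscr{L}^*$ decays polynomially in the Wasserstein metric $W_\omega$ with the same degree. (II) Let $X=E^{\mathbb{N}}$ where $E$ is a standard Borel space, with the bounded metric $d(x,y)=\sum_{n\geqslant1}2^{-n}\min\{d_E(x_n,y_n),1\}$, let $\mu$ be a Borel probability measure on $E$, $\mathsf{M}=(\mu\times\delta_x)_{x\in X}$, $\varepsilon>0$, and let $f\in C^{\varepsilon\log}(X,\mathbb{R})$ be flat with respect to the modulus of continuity $\omega_\varepsilon(r)=\log(r_0/r)^{-\varepsilon}$ and the natural coupling. Then $\mathscr{L}_{\mathsf{M},f}$ has a strictly positive eigenfunction $h_f\in C^{\varepsilon\log}(X,\mathbb{R})$ for some eigenvalue $\lambda_f>0$, its dual $\mathscr{L}_{\mathsf{M},f}^*$ has a conformal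 measure $\nu_f$ for the eigenvalue $\lambda_f$, and $\mu_f=h_f\,d\nu_f$ (with $\int h_f\,d\nu_f=1$) is a stationary measure. If $\bar f=f+\log h_f-\log h_f\circ\sigma-\log\lambda_f$ is the normalized potential, then there is $C>0$ such that for every $\varphi\in C^{\varepsilon\log}(X,\mathbb{R})$ with $\int\varphi\,d\mu_f=0$ and every $n\geqslant 1$, $$\|\mathscr{L}_{\mathsf{M},\bar f}^n\varphi\|_\infty\leqslant C\,\frac{\|\varphi\|_{\omega_\varepsilon}}{n^\varepsilon}.$$ In particular the one-sided shift $\sigma$ has polynomial decay of correlations with respect to $\mu_f$.
   Context: A modulus of continuity is a continuous, increasing, concave $\omega:[0,\infty)\to[0,\infty)$ with $\omega(0)=0$. $C^\omega(X,\mathbb{R})$ is the space of bounded $g:X\to\mathbb{R}$ with $\mathrm{Hol}_\omega(g)=\sup_{x\ne y}|g(x)-g(y)|/\omega(d(x,y))<\infty$, with norm $\|g\|_\omega=\|g\|_\infty+\mathrm{Hol}_\omega(g)$; $C^{\varepsilon\log}$ is the case $\omega=\omega_\varepsilon$ on $[0,1]$ (with $\omega_\varepsilon(0)=0$ and $r_0$ sufficiently large). A transition probability kernel is a measurable family $(m_x)_{x\in X}$ of Borel probability measures. $\mathscr{L}_{\mathsf{M},f}\varphi(x)=\int_Xe^{f(y)}\varphi(y)\,dm_x(y)$; $f$ is normalized if $\mathscr{L}_{\mathsf{M},f}\mathbf{1}=\mathbf{1}$. The dual acts on finite measures by $\int\varphi\,d\mathscr{L}^*\mu=\int\mathscr{L}\varphi\,d\mu$;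 a conformal measure for $\lambda$ is a Borel probability measure $\nu$ with $\mathscr{L}_{\mathsf{M},f}^*\nu=\lambda\nu$; $\mu_f$ stationary means $\mathscr{L}_{\mathsf{M},\bar f}^*\mu_f=\mu_f$. $m_x^n$ is the law on $X^n$ of $(\Phi_1,\dots,\Phi_n)$, where $(\Phi_k)$ is the Markov chain with kernel $\mathsf{M}$ and $\Phi_0=x$. For $\bar x=(x_1,\dots,x_n)\in X^n$, $f^n(\bar x)=f(x_1)+\dots+f(x_n)$. $W_\omega(\mu,\nu)=\inf_{\Pi}\int\omega(d(x,y))\,d\Pi(x,y)$, the infimum over probability measures $\Pi$ on $X\times X$ with marginals $\mu,\nu$. A coupling of $\mathsf{M}$ is a family $\mathsf{P}=(\Pi^n_{x,y})_{n\in\mathbb{N},x,y\in X}$ of probability measures on $X^n\times X^n$ with marginals $m_x^n$ and $m_y^n$, such that for each $n$ the map $(x,y)\mapsto\Pi^n_{x,y}$ is Borel measurable. $f$ is flat with respect to $\mathsf{P}$ (and $\omega$) if there is $C>0$ such that for all $n,x,y$ and $\Pi^n_{x,y}$-almost all $(\bar x,\bar y)$, $|f^n(\bar x)-f^n(\bar y)|\leqslant C\,\omega(d(x,y))$. A decay function is $F:\mathbb{N}\times(0,R)\to(0,\infty)$ such that: $F$ is non-increasing in $n$, and non-decreasing and concave in $r$; $\lim_{n\to\infty}F(n,r)=\lim_{r\to0}F(n,r)=0$; there is $C>0$ with $F(n,r)\leqslant Cr$ for all $n,r$; and $F(k+n,r)\leqslant F(k,F(n,r))$ for all $k,n,r$.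 $\mathsf{P}_f=(e^{f^n(\bar x)}\Pi^n_{x,y})_{n,x,y}$ has $\omega$-decay rate $F$ if for some constant $C$ and all $n,x,y$, $\int\omega(d(x_n,y_n))e^{f^n(\bar x)}\,d\Pi^n_{x,y}(\bar x,\bar y)\leqslant C\,F(n,\omega(d(x,y)))$. An operator $\mathscr{T}$ on probability measures has $\omega$-decay rate $F$ if $W_\omega(\mathscr{T}^n\mu,\mathscr{T}^n\nu)\leqslant F(n,W_\omega(\mu,\nu))$ for all $n,\mu,\nu$. $F$ is polynomial, of degree $1/\alpha$, if $F(n,r)=Br/(nr^\alpha+b)^{1/\alpha}$ for some $\alpha>0$, $B\geqslant1$, $b\in(0,1)$; $\mathscr{T}$ decays polynomially of degree $1/\alpha$ if it has $\omega$-decay rate such an $F$ (for some $B,b$). In (II): $d_E$ is a complete separable metric for $E$, $\sigma$ is the left shift on $X$, $\mu\times\delta_x$ is the law of $ax=(a,x_1,x_2,\dots)$ with $a\sim\mu$, so $\mathscr{L}_{\mathsf{M},f}\varphi(x)=\int_Ee^{f(ax)}\varphi(ax)\,d\mu(a)$. The natural coupling is $\Pi^n_{x,y}=\int_{E^n}\delta_{(\bar x^w_n,\bar y^w_n)}\,d\mu^n(w)$, where for $w=(r_1,\dots,r_n)\in E^n$ the $j$-th components ($1\leqslant j\leqslant n$) of $\bar x^w_n,\bar y^w_n\in X^n$ are $(r_j,\dots,r_1,x_1,x_2,\dots)$ and $(r_j,\dots,r_1,y_1,y_2,\dots)$. Polynomial decay of correlations means: for every $\varphi\in C^{\varepsilon\log}(X,\mathbb{R})$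 and $\psi\in L^1(\mu_f)$ there is $K>0$ with $\left|\int\varphi\cdot\psi\circ\sigma^n\,d\mu_f-\int\varphi\,d\mu_f\int\psi\,d\mu_f\right|\leqslant K n^{-\varepsilon}$ for all $n\geqslant 1$. *)

theory Defs
  imports "HOL-Probability.Probability"
begin

section \<open>Moduli of continuity and the spaces of omega-continuous functions\<close>

definition modulus_of_continuity_on :: "real set \<Rightarrow> (real \<Rightarrow> real) \<Rightarrow> bool" where
  "modulus_of_continuity_on S \<omega> \<longleftrightarrow>
     continuous_on S \<omega> \<and> strict_mono_on S \<omega> \<and> concave_on S \<omega> \<and>
     (\<forall>r\<in>S. 0 \<le> \<omega> r) \<and> \<omega> 0 = 0"

definition omega_log :: "real \<Rightarrow> real \<Rightarrow> real \<Rightarrow> real" where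
  "omega_log \<epsilon> r0 r = (if r = 0 then 0 else ln (r0 / r) powr (- \<epsilon>))"

text \<open>The metric is an explicit argument \<open>d\<close>, because the metric used below on sequence spaces
  is not the \<^const>\<open>dist\<close> of the type class instance for functions.  Suprema are taken in
  \<^typ>\<open>ennreal\<close>, so that they are meaningful for every function; in particular the Hoelder
  constant on a one-point space is \<open>0\<close>.\<close>

definition hol :: "(real \<Rightarrow> real) \<Rightarrow> ('a \<Rightarrow> 'a \<Rightarrow> real) \<Rightarrow> ('a \<Rightarrow> real) \<Rightarrow> ennreal" where
  "hol \<omega> d g = (SUP (x, y) \<in> {(x, y). x \<noteq> y}. ennreal (\<bar>g x - g y\<bar> / \<omega> (d x y)))"

definition sup_norm :: "('a \<Rightarrow> real) \<Rightarrow> ennreal" where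
  "sup_norm g = (SUP x. ennreal \<bar>g x\<bar>)"

definition omega_norm :: "(real \<Rightarrow> real) \<Rightarrow> ('a \<Rightarrow> 'a \<Rightarrow> real) \<Rightarrow> ('a \<Rightarrow> real) \<Rightarrow> ennreal" where
  "omega_norm \<omega> d g = sup_norm g + hol \<omega> d g"

definition C_omega :: "(real \<Rightarrow> real) \<Rightarrow> ('a \<Rightarrow> 'a \<Rightarrow> real) \<Rightarrow> ('a \<Rightarrow> real) set" where
  "C_omega \<omega> d = {g. bounded (range g) \<and> hol \<omega> d g < \<infinity>}"


section \<open>Transfer operators\<close>

abbreviation borel_probs :: "'a::topological_space measure set" where
  "borel_probs \<equiv> space (prob_algebra borel)"

abbreviation transition_kernel :: "('a::topological_space \<Rightarrow> 'a measure) \<Rightarrow> bool" where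
  "transition_kernel m \<equiv> m \<in> borel \<rightarrow>\<^sub>M prob_algebra borel"

definition transfer_op ::
    "('a \<Rightarrow> 'a measure) \<Rightarrow> ('a \<Rightarrow> real) \<Rightarrow> ('a \<Rightarrow> real) \<Rightarrow> 'a \<Rightarrow> real" where
  "transfer_op m f \<phi> x = (\<integral>y. exp (f y) * \<phi> y \<partial>m x)"

definition normalized :: "('a \<Rightarrow> 'a measure) \<Rightarrow> ('a \<Rightarrow> real) \<Rightarrow> bool" where
  "normalized m f \<longleftrightarrow> transfer_op m f (\<lambda>_. 1) = (\<lambda>_. 1)"

text \<open>The measure \<open>\<integral> e\<^sup>f dm\<^sub>x d\<mu>(x)\<close>; that it satisfies the duality relation defining the dual
  operator is the lemma \<open>integral_dual_op\<close>.\<close>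

definition dual_op ::
    "('a \<Rightarrow> 'a measure) \<Rightarrow> ('a \<Rightarrow> real) \<Rightarrow> 'a measure \<Rightarrow> 'a measure" where
  "dual_op m f \<mu> = density (\<mu> \<bind> m) (\<lambda>y. ennreal (exp (f y)))"

lemma integral_dual_op:
  fixes m :: "'a::topological_space \<Rightarrow> 'a measure" and f \<phi> :: "'a \<Rightarrow> real"
  assumes m: "transition_kernel m" and \<mu>: "finite_measure \<mu>" "sets \<mu> = sets borel"
    and f: "f \<in> borel_measurable borel" "bounded (range f)"
    and \<phi>: "\<phi> \<in> borel_measurable borel" "bounded (range \<phi>)"
  shows "(\<integral>x. \<phi> x \<partial>dual_op m f \<mu>) = (\<integral>x. transfer_op m f \<phi> x \<partial>\<mu>)"
proof -
  have sp: "space \<mu> = UNIV"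
    using sets_eq_imp_space_eq[OF \<mu>(2)] by simp
  have m': "m \<in> \<mu> \<rightarrow>\<^sub>M subprob_algebra borel"
    using measurable_prob_algebraD[OF m] measurable_cong_sets[OF \<mu>(2) refl] by blast
  have sets_b: "sets (\<mu> \<bind> m) = sets borel"
    using sets_bind_measurable[OF m'] sp by simp
  obtain a where a: "\<And>x. \<bar>f x\<bar> \<le> a"
    using f(2) by (auto simp: bounded_iff)
  obtain b where b: "\<And>x. \<bar>\<phi> x\<bar> \<le> b"
    using \<phi>(2) by (auto simp: bounded_iff)
  have bd: "norm (exp (f y) * \<phi> y) \<le> exp a * b" for y
    using a[of y] b[of y] by (auto simp: abs_mult intro!: mult_mono)
  have ms: "(\<lambda>y. exp (f y) * \<phi> y) \<in> borel_measurable borel"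
    using f(1) \<phi>(1) by measurable
  have "(\<integral>x. \<phi> x \<partial>dual_op m f \<mu>) = (\<integral>y. exp (f y) *\<^sub>R \<phi> y \<partial>(\<mu> \<bind> m))"
    unfolding dual_op_def
    using f(1) \<phi>(1) by (intro integral_density) (simp_all add: measurable_cong_sets[OF sets_b refl])
  also have "\<dots> = (\<integral>y. exp (f y) * \<phi> y \<partial>(\<mu> \<bind> m))"
    by simp
  also have "\<dots> = (\<integral>x. \<integral>y. exp (f y) * \<phi> y \<partial>m x \<partial>\<mu>)"
  proof (rule integral_bind[where K = borel and B' = 1])
    show "AE x in \<mu>. emeasure (m x) (space (m x)) \<le> ennreal 1"
      using measurable_space[OF m'] by (auto simp: sp space_subprob_algebra subprob_space.emeasure_space_le_1)
  qed (use ms m' \<mu> bd sp in auto)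
  finally show ?thesis
    by (simp add: transfer_op_def)
qed

definition stationary ::
    "('a::topological_space \<Rightarrow> 'a measure) \<Rightarrow> ('a \<Rightarrow> real) \<Rightarrow> 'a measure \<Rightarrow> bool" where
  "stationary m f \<mu> \<longleftrightarrow> \<mu> \<in> borel_probs \<and> dual_op m f \<mu> = \<mu>"

definition conformal_measure ::
    "('a::topological_space \<Rightarrow> 'a measure) \<Rightarrow> ('a \<Rightarrow> real) \<Rightarrow> real \<Rightarrow> 'a measure \<Rightarrow> bool" where
  "conformal_measure m f lam \<nu> \<longleftrightarrow>
     \<nu> \<in> borel_probs \<and> dual_op m f \<nu> = scale_measure (ennreal lam) \<nu>"


section \<open>Path laws and couplings\<close>

text \<open>\<open>X\<^sup>n\<close> is the space of functions with domain \<open>{1..n}\<close>, extensional outside of it.\<close>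

definition path_space :: "nat \<Rightarrow> (nat \<Rightarrow> 'a::topological_space) measure" where
  "path_space n = Pi\<^sub>M {1..n} (\<lambda>_. borel)"

text \<open>The law of the first \<open>n\<close> steps of the Markov chain started at \<open>x\<close>: given
  the path \<open>p\<close> up to time \<open>n\<close>, the next position has law \<open>m\<close> at the last one.\<close>

primrec path_law ::
    "('a::topological_space \<Rightarrow> 'a measure) \<Rightarrow> 'a \<Rightarrow> nat \<Rightarrow> (nat \<Rightarrow> 'a) measure" where
  "path_law m x 0 = return (path_space 0) (\<lambda>_. undefined)"
| "path_law m x (Suc n) =
     path_law m x n \<bind>
       (\<lambda>p. distr (m (if n = 0 then x else p n)) (path_space (Suc n)) (\<lambda>y. p(Suc n := y)))"

definition birkhoff_sum :: "('a \<Rightarrow> real) \<Rightarrow> nat \<Rightarrow> (nat \<Rightarrow> 'a) \<Rightarrow> real" where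
  "birkhoff_sum f n p = (\<Sum>j = 1..n. f (p j))"

text \<open>Couplings of the kernel are families indexed by path lengths \<open>n \<ge> 1\<close>; the value of the
  family at \<open>n = 0\<close> is irrelevant.\<close>

type_synonym 'a path_coupling = "nat \<Rightarrow> 'a \<Rightarrow> 'a \<Rightarrow> ((nat \<Rightarrow> 'a) \<times> (nat \<Rightarrow> 'a)) measure"

definition kernel_coupling ::
    "('a::topological_space \<Rightarrow> 'a measure) \<Rightarrow> 'a path_coupling \<Rightarrow> bool" where
  "kernel_coupling m P \<longleftrightarrow>
     (\<forall>n\<ge>1. (\<lambda>(x, y). P n x y)
               \<in> borel \<Otimes>\<^sub>M borel \<rightarrow>\<^sub>M prob_algebra (path_space n \<Otimes>\<^sub>M path_space n) \<and>
             (\<forall>x y. distr (P n x y) (path_space n) fst = path_law m x n \<and>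
                    distr (P n x y) (path_space n) snd = path_law m y n))"

definition flat_potential ::
    "(real \<Rightarrow> real) \<Rightarrow> ('a \<Rightarrow> 'a \<Rightarrow> real) \<Rightarrow> 'a path_coupling \<Rightarrow> ('a \<Rightarrow> real) \<Rightarrow> bool" where
  "flat_potential \<omega> d P f \<longleftrightarrow>
     (\<exists>C>0. \<forall>n\<ge>1. \<forall>x y. AE (p, q) in P n x y.
        \<bar>birkhoff_sum f n p - birkhoff_sum f n q\<bar> \<le> C * \<omega> (d x y))"


section \<open>Wasserstein distance and decay rates\<close>

text \<open>Only used for a bounded \<open>\<omega> \<circ> d\<close>, for which all the integrals exist.\<close>

definition wasserstein ::
    "(real \<Rightarrow> real) \<Rightarrow> ('a::topological_space \<Rightarrow> 'a \<Rightarrow> real) \<Rightarrow> 'a measure \<Rightarrow> 'a measure \<Rightarrow> real" where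
  "wasserstein \<omega> d \<mu> \<nu> =
     Inf {(\<integral>(x, y). \<omega> (d x y) \<partial>\<pi>) | \<pi>.
            \<pi> \<in> space (prob_algebra (borel \<Otimes>\<^sub>M borel)) \<and>
            distr \<pi> borel fst = \<mu> \<and> distr \<pi> borel snd = \<nu>}"

text \<open>A decay function is defined on \<open>\<nat> \<times> (0, R)\<close> with \<open>0 < R \<le> \<infinity>\<close>; the submultiplicativity
  inequality is required whenever its right-hand side is defined.\<close>

definition decay_function :: "ereal \<Rightarrow> (nat \<Rightarrow> real \<Rightarrow> real) \<Rightarrow> bool" where
  "decay_function R F \<longleftrightarrow> 0 < R \<and> (let I = {r. 0 < r \<and> ereal r < R} in
     (\<forall>n. \<forall>r\<in>I. 0 < F n r) \<and>
     (\<forall>r\<in>I. antimono (\<lambda>n. F n r)) \<and>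
     (\<forall>n. mono_on I (F n) \<and> concave_on I (F n)) \<and>
     (\<forall>r\<in>I. (\<lambda>n. F n r) \<longlonglongrightarrow> 0) \<and>
     (\<forall>n. (F n \<longlongrightarrow> 0) (at_right 0)) \<and>
     (\<exists>C>0. \<forall>n. \<forall>r\<in>I. F n r \<le> C * r) \<and>
     (\<forall>k n. \<forall>r\<in>I. F n r \<in> I \<longrightarrow> F (k + n) r \<le> F k (F n r)))"

text \<open>Since \<open>F\<close> is a function on \<open>\<nat> \<times> (0, R)\<close>, all the distances have to be less than \<open>R\<close>, and the
  estimate is a condition on pairs of distinct points.\<close>

definition coupling_decay_rate ::
    "(real \<Rightarrow> real) \<Rightarrow> ('a \<Rightarrow> 'a \<Rightarrow> real) \<Rightarrow> 'a path_coupling \<Rightarrow> ('a \<Rightarrow> real) \<Rightarrow>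
     ereal \<Rightarrow> (nat \<Rightarrow> real \<Rightarrow> real) \<Rightarrow> bool" where
  "coupling_decay_rate \<omega> d P f R F \<longleftrightarrow>
     (\<forall>x y. ereal (\<omega> (d x y)) < R) \<and>
     (\<exists>C. \<forall>n\<ge>1. \<forall>x y. x \<noteq> y \<longrightarrow>
        (\<integral>(p, q). \<omega> (d (p n) (q n)) * exp (birkhoff_sum f n p) \<partial>P n x y) \<le> C * F n (\<omega> (d x y)))"

definition operator_decay_rate ::
    "(real \<Rightarrow> real) \<Rightarrow> ('a::topological_space \<Rightarrow> 'a \<Rightarrow> real) \<Rightarrow> ('a measure \<Rightarrow> 'a measure) \<Rightarrow>
     (nat \<Rightarrow> real \<Rightarrow> real) \<Rightarrow> bool" where
  "operator_decay_rate \<omega> d T F \<longleftrightarrow>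
     (\<forall>n. \<forall>\<mu>\<in>borel_probs. \<forall>\<nu>\<in>borel_probs.
        wasserstein \<omega> d ((T ^^ n) \<mu>) ((T ^^ n) \<nu>) \<le> F n (wasserstein \<omega> d \<mu> \<nu>))"

text \<open>The degree is \<open>1 / \<alpha>\<close>.  The formula extends to \<open>r = 0\<close> with value \<open>0\<close>.\<close>

definition poly_rate :: "real \<Rightarrow> real \<Rightarrow> real \<Rightarrow> nat \<Rightarrow> real \<Rightarrow> real" where
  "poly_rate \<alpha> B b n r = B * r / (real n * r powr \<alpha> + b) powr (1 / \<alpha>)"

definition polynomial_decay_function :: "real \<Rightarrow> ereal \<Rightarrow> (nat \<Rightarrow> real \<Rightarrow> real) \<Rightarrow> bool" where
  "polynomial_decay_function \<alpha> R F \<longleftrightarrow>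
     (\<exists>B\<ge>1. \<exists>b\<in>{0<..<1}. \<forall>n r. 0 < r \<and> ereal r < R \<longrightarrow> F n r = poly_rate \<alpha> B b n r)"

definition decays_polynomially ::
    "(real \<Rightarrow> real) \<Rightarrow> ('a::topological_space \<Rightarrow> 'a \<Rightarrow> real) \<Rightarrow> ('a measure \<Rightarrow> 'a measure) \<Rightarrow>
     real \<Rightarrow> bool" where
  "decays_polynomially \<omega> d T \<alpha> \<longleftrightarrow>
     (\<exists>B\<ge>1. \<exists>b\<in>{0<..<1}. operator_decay_rate \<omega> d T (poly_rate \<alpha> B b))"


section \<open>The one-sided shift\<close>

text \<open>\<open>E\<^sup>\<nat>\<close> is the type \<open>nat \<Rightarrow> 'e\<close>, whose Borel sets are those of the product topology; the \<open>n\<close>-th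
  coordinate of the mathematical sequence is the value at \<open>n - 1\<close>.\<close>

definition seq_dist :: "(nat \<Rightarrow> 'e::metric_space) \<Rightarrow> (nat \<Rightarrow> 'e) \<Rightarrow> real" where
  "seq_dist x y = (\<Sum>i. (1/2) ^ Suc i * min (dist (x i) (y i)) 1)"

definition seq_shift :: "(nat \<Rightarrow> 'e) \<Rightarrow> nat \<Rightarrow> 'e" where
  "seq_shift x = (\<lambda>i. x (Suc i))"

text \<open>\<open>case_nat a x\<close> is the sequence \<open>ax\<close>.\<close>

definition shift_kernel ::
    "'e::topological_space measure \<Rightarrow> (nat \<Rightarrow> 'e) \<Rightarrow> (nat \<Rightarrow> 'e) measure" where
  "shift_kernel \<mu> x = distr \<mu> borel (\<lambda>a. case_nat a x)"

text \<open>The path whose \<open>j\<close>-th component is the sequence \<open>(w\<^sub>j, \<dots>, w\<^sub>1, x\<^sub>1, x\<^sub>2, \<dots>)\<close>.\<close>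

definition word_path :: "nat \<Rightarrow> (nat \<Rightarrow> 'e) \<Rightarrow> (nat \<Rightarrow> 'e) \<Rightarrow> nat \<Rightarrow> nat \<Rightarrow> 'e" where
  "word_path n w x = (\<lambda>j\<in>{1..n}. \<lambda>i. if i < j then w (j - i) else x (i - j))"

definition natural_coupling ::
    "'e::topological_space measure \<Rightarrow> (nat \<Rightarrow> 'e) path_coupling" where
  "natural_coupling \<mu> n x y =
     distr (Pi\<^sub>M {1..n} (\<lambda>_. \<mu>)) (path_space n \<Otimes>\<^sub>M path_space n)
       (\<lambda>w. (word_path n w x, word_path n w y))"

definition polynomial_decay_of_correlations ::
    "(real \<Rightarrow> real) \<Rightarrow> ('a \<Rightarrow> 'a \<Rightarrow> real) \<Rightarrow> ('a \<Rightarrow> 'a) \<Rightarrow> 'a measure \<Rightarrow> real \<Rightarrow> bool" where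
  "polynomial_decay_of_correlations \<omega> d T \<mu> \<epsilon> \<longleftrightarrow>
     (\<forall>\<phi>\<in>C_omega \<omega> d. \<forall>\<psi>::'a \<Rightarrow> real. integrable \<mu> \<psi> \<longrightarrow>
        (\<exists>K>0. \<forall>n\<ge>1.
           \<bar>(\<integral>x. \<phi> x * \<psi> ((T ^^ n) x) \<partial>\<mu>) - (\<integral>x. \<phi> x \<partial>\<mu>) * (\<integral>x. \<psi> x \<partial>\<mu>)\<bar>
             \<le> K * real n powr (- \<epsilon>)))"

end

theory Submission
  imports Defs
begin

text \<open>
  (I) Given a coupling \<open>\<pi>\<close> of \<open>\<mu>\<close> and \<open>\<nu>\<close>, run the kernel coupling for \<open>n\<close> steps and keep the part
  weighted by the smaller of the two densities \<open>exp (f\<^sup>n x)\<close> and \<open>exp (f\<^sup>n y)\<close>.  It is a coupling of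
  parts of the two images whose cost is controlled by the decay rate, and by flatness the mass left
  over is at most \<open>C\<close> times the cost of \<open>\<pi>\<close>, and at most \<open>1 - p\<close> for a fixed \<open>p > 0\<close>.  Coupling the
  leftovers arbitrarily gives the Lipschitz bound.  If \<open>F\<close> is polynomial, the largest distance \<open>a n\<close>
  after \<open>n\<close> steps satisfies \<open>a (n + N) \<le> K N\<^sup>-\<^sup>1\<^sup>/\<^sup>\<alpha> + (1 - p) a n\<close>, which forces \<open>a n = O (n\<^sup>-\<^sup>1\<^sup>/\<^sup>\<alpha>)\<close>;
  this and the Lipschitz bound together are equivalent to polynomial decay.

  (II) Flatness makes the quotients \<open>L\<^sup>n \<phi> / L\<^sup>n 1\<close> averages of \<open>\<phi>\<close> whose weights have uniformly
  log-Hoelder dependence on the base point, so their oscillations satisfy the same recursive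
  inequality and the quotients converge uniformly to a constant at rate \<open>n\<^sup>-\<^sup>\<epsilon>\<close>.  The limit functional
  is also defined on bounded functions of finitely many coordinates, where it is countably additive;
  as \<open>E\<^sup>\<nat>\<close> need not be compact, the conformal measure is obtained from it by Kolmogorov's extension
  theorem.  The functions \<open>L\<^sup>n 1 / \<lambda>\<^sup>n\<close> are uniformly Cauchy, and their limit is the eigenfunction.
\<close>

section \<open>A recursive inequality\<close>

text \<open>Both parts rest on one inequality: if one density is at most e^c times another, it
  exceeds it by at most the fraction 1 - e^-c of itself. Flatness supplies such a c that does not
  depend on the number of steps, so a fixed proportion of the mass is matched after any number of
  steps; the matched part contracts only polynomially. The number of steps used for matching must
  therefore grow with the total time, and no geometric rate results. In (II) a normalized potential
  presupposes the eigenfunction, so the functions L^n 1 take its place: the weights of the averages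
  vary with n, but flatness controls their ratios. The contraction comes from the shift itself: each
  prepended letter halves the distance, and the modulus turns 2^-n into n^-\<epsilon>. The limits of
  the averages of indicators of cylinders are additive at once. Countable additivity, where
  compactness would usually enter, follows from a Harnack-type inequality: the limit is at most a
  constant times the average at a fixed time, and that average is an integral.\<close>

text \<open>Split \<open>m = n + N\<close> with \<open>N\<close> a small fixed proportion \<open>\<theta>\<close> of \<open>m\<close>: the factor
  \<open>(1 - \<theta>) powr - \<beta>\<close> lost in replacing \<open>n\<close> by \<open>m\<close> is absorbed by the contraction factor \<open>1 - p\<close>.\<close>
lemma power_decay_recursion:
  fixes \<beta> p :: real
  assumes \<beta>: "0 < \<beta>" and p: "0 < p" "p \<le> 1"
  shows "\<exists>K>0. \<forall>a M. 0 \<le> M \<and> (\<forall>n. a n \<le> M) \<and>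
       (\<forall>n. \<forall>N\<ge>1. a (n + N) \<le> M * real N powr - \<beta> + (1 - p) * a n) \<longrightarrow>
       (\<forall>n\<ge>1. a n \<le> K * M * real n powr - \<beta>)"
proof -
  \<comment> \<open>By construction \<open>q * (1 - p / 2) = 1 - p\<close>: half of the gap
    \<open>p\<close> pays for the change from n to m, the other half for the term that does not
    contain \<open>a\<close>.\<close>
  define q where "q = (1 - p) / (1 - p / 2)"
  have q: "0 \<le> q" "q < 1" using p by (auto simp: q_def field_simps)
  define \<theta> where "\<theta> = min (1/2) (1 - q powr (1/\<beta>))"
  have "q powr (1/\<beta>) < 1" using q \<beta> powr_less_mono2[of "1/\<beta>" q 1] by simp
  then have \<theta>: "0 < \<theta>" "\<theta> \<le> 1/2" unfolding \<theta>_def by linarith+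
  have "q powr (1/\<beta>) \<le> 1 - \<theta>" by (auto simp: \<theta>_def)
  then have "(q powr (1/\<beta>)) powr \<beta> \<le> (1 - \<theta>) powr \<beta>" using \<beta> by (intro powr_mono2) auto
  then have q\<theta>: "q \<le> (1 - \<theta>) powr \<beta>" using \<beta> q by (simp add: powr_powr)
  \<comment> \<open>Makes \<open>(\<theta>/2) powr - \<beta>\<close> equal to
    \<open>p / 2 * K\<close>, so that the two shares in the induction step add up to
    \<open>K\<close>.\<close>
  define K where "K = 2 / p * (\<theta>/2) powr - \<beta>"
  have K: "0 < K" using p \<theta> by (simp add: K_def)
  have K1: "\<theta> powr - \<beta> \<le> K"
  proof -
    have "\<theta> powr - \<beta> \<le> (\<theta>/2) powr - \<beta>" using \<theta> \<beta> by (intro powr_mono2') auto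
    also have "\<dots> = 1 * (\<theta>/2) powr - \<beta>" by simp
    also have "\<dots> \<le> K" unfolding K_def using p by (intro mult_right_mono) (auto simp: field_simps)
    finally show ?thesis .
  qed
  have "a m \<le> K * M * real m powr - \<beta>"
    if M: "0 \<le> M" and aM: "\<And>n. a n \<le> M"
      and rec: "\<And>n N. 1 \<le> N \<Longrightarrow> a (n + N) \<le> M * real N powr - \<beta> + (1 - p) * a n"
      and "1 \<le> m" for a M m
    using \<open>1 \<le> m\<close>
  proof (induction m rule: less_induct)
    case (less m)
    show ?case
    proof (cases "\<theta> * m < 1")
      \<comment> \<open>For such small times the claimed bound is at least \<open>M\<close>, and the
        a priori bound is enough.\<close>
      case True
      have "1 \<le> (\<theta> * m) powr - \<beta>"
        using True \<theta> less.prems \<beta> powr_mono2'[of "-\<beta>" "\<theta> * m" 1] by simp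
      also have "\<dots> = \<theta> powr - \<beta> * real m powr - \<beta>" using \<theta> by (simp add: powr_mult)
      also have "\<dots> \<le> K * real m powr - \<beta>" using K1 by (intro mult_right_mono) auto
      finally have "M * 1 \<le> M * (K * real m powr - \<beta>)" using M by (intro mult_left_mono) auto
      then show ?thesis using aM[of m] by (simp add: algebra_simps)
    next
      case False
      define N where "N = nat \<lfloor>\<theta> * m\<rfloor>"
      have N1: "1 \<le> N" using False by (simp add: N_def le_nat_iff)
      have Nle: "real N \<le> \<theta> * m" using False by (simp add: N_def)
      \<comment> \<open>Rounding down a number that is at least 1 loses at most half of it.\<close>
      have Nge: "\<theta> / 2 * m \<le> real N"
        using False N1 unfolding N_def by linarith
      have "\<theta> * m \<le> 1/2 * m" using \<theta> by (intro mult_right_mono) auto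
      then have Nm: "N < m" using Nle less.prems by linarith
      have n: "1 \<le> m - N" "(1 - \<theta>) * m \<le> real (m - N)"
        using Nm Nle by (auto simp: algebra_simps of_nat_diff)
      have "a m \<le> M * real N powr - \<beta> + (1 - p) * a (m - N)"
        using rec[OF N1, of "m - N"] Nm by simp
      also have "\<dots> \<le> M * ((\<theta>/2) powr - \<beta> * m powr - \<beta>) + (1 - p) * (K * M * ((1 - \<theta>) powr - \<beta> * m powr - \<beta>))"
      proof (intro add_mono mult_left_mono M)
        have "real N powr - \<beta> \<le> (\<theta> / 2 * m) powr - \<beta>"
          using Nge \<theta> less.prems \<beta> by (intro powr_mono2') auto
        then show "real N powr - \<beta> \<le> (\<theta> / 2) powr - \<beta> * m powr - \<beta>" using \<theta> by (simp add: powr_mult powr_divide)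
        have "a (m - N) \<le> K * M * real (m - N) powr - \<beta>"
          using less.IH[of "m - N"] n N1 Nm by simp
        also have "\<dots> \<le> K * M * ((1 - \<theta>) * m) powr - \<beta>"
          using n \<theta> less.prems \<beta> M K by (intro mult_left_mono powr_mono2') auto
        finally show "a (m - N) \<le> K * M * ((1 - \<theta>) powr - \<beta> * m powr - \<beta>)"
          using \<theta> by (simp add: powr_mult)
      qed (use p in auto)
      also have "\<dots> = M * m powr - \<beta> * ((\<theta>/2) powr - \<beta> + K * ((1 - p) * (1 - \<theta>) powr - \<beta>))"
        by (simp add: algebra_simps)
      also have "\<dots> \<le> M * m powr - \<beta> * (p / 2 * K + K * (1 - p / 2))"
      proof (intro mult_left_mono add_mono)
        show "(\<theta>/2) powr - \<beta> \<le> p / 2 * K" using p by (simp add: K_def)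
        have "1 - p \<le> (1 - \<theta>) powr \<beta> * (1 - p/2)"
          using q\<theta> p by (simp add: q_def divide_le_eq)
        then show "(1 - p) * (1 - \<theta>) powr - \<beta> \<le> 1 - p / 2"
          using \<theta> by (simp add: powr_minus field_simps)
      qed (use M K in auto)
      also have "\<dots> = K * M * real m powr - \<beta>" by (simp add: algebra_simps)
      finally show ?thesis .
    qed
  qed
  with K show ?thesis by (intro exI[of _ K]) blast
qed

section \<open>Mixtures and couplings\<close>

text \<open>The convex combination with weights \<open>s\<close> and \<open>1 - s\<close>, as a
  two-stage experiment in which a coin chooses the measure. In this form the general properties of
  kernels make it a probability measure, and integrals split by the rule for
  \<open>bind\<close>.\<close>

definition mix :: "real \<Rightarrow> 'a measure \<Rightarrow> 'a measure \<Rightarrow> 'a measure" where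
  "mix s M N = measure_pmf (bernoulli_pmf s) \<bind> (\<lambda>b. if b then M else N)"

lemma mix_kernel:
  assumes "M \<in> space (prob_algebra B)" "N \<in> space (prob_algebra B)"
  shows "(\<lambda>b. if b then M else N) \<in> measure_pmf p \<rightarrow>\<^sub>M prob_algebra B"
  using assms by (auto simp: measurable_pmf_measure1)

lemma mix_in_prob_algebra:
  assumes "M \<in> space (prob_algebra B)" "N \<in> space (prob_algebra B)"
  shows "mix s M N \<in> space (prob_algebra B)"
proof -
  have "measure_pmf (bernoulli_pmf s) \<in> space (prob_algebra (measure_pmf (bernoulli_pmf s)))"
    by (simp add: space_prob_algebra measure_pmf.prob_space_axioms)
  from prob_space_bind'[OF this mix_kernel[OF assms]] sets_bind'[OF this mix_kernel[OF assms]]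
  show ?thesis by (simp add: mix_def space_prob_algebra)
qed

lemma nn_integral_mix:
  assumes "M \<in> space (prob_algebra B)" "N \<in> space (prob_algebra B)" "f \<in> borel_measurable B"
    and "0 \<le> s" "s \<le> 1"
  shows "(\<integral>\<^sup>+x. f x \<partial>mix s M N) = ennreal s * (\<integral>\<^sup>+x. f x \<partial>M) + ennreal (1 - s) * (\<integral>\<^sup>+x. f x \<partial>N)"
  unfolding mix_def
  by (subst nn_integral_bind[OF assms(3) measurable_prob_algebraD[OF mix_kernel[OF assms(1,2)]]])
     (use assms in \<open>simp add: mult.commute\<close>)

lemma prob_algebra_eqI:
  assumes "M \<in> space (prob_algebra B)" "N \<in> space (prob_algebra B)"
    and "\<And>A. A \<in> sets B \<Longrightarrow> (\<integral>\<^sup>+x. indicator A x \<partial>M) = (\<integral>\<^sup>+x. indicator A x \<partial>N)"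
  shows "M = N"
  using assms by (intro measure_eqI) (auto simp: space_prob_algebra)

lemma distr_mix:
  assumes M: "M \<in> space (prob_algebra B)" "N \<in> space (prob_algebra B)"
    and g[measurable]: "g \<in> B \<rightarrow>\<^sub>M C" and s: "0 \<le> s" "s \<le> 1"
  shows "distr (mix s M N) C g = mix s (distr M C g) (distr N C g)"
proof (rule prob_algebra_eqI)
  have D: "distr K C g \<in> space (prob_algebra C)" if "K \<in> space (prob_algebra B)" for K
    using measurable_space[OF measurable_distr_prob_space[OF g] that] by simp
  show "distr (mix s M N) C g \<in> space (prob_algebra C)"
    by (intro D mix_in_prob_algebra M)
  show "mix s (distr M C g) (distr N C g) \<in> space (prob_algebra C)"
    by (intro D mix_in_prob_algebra M)
  have *: "(\<integral>\<^sup>+x. indicator A x \<partial>distr K C g) = (\<integral>\<^sup>+x. indicator A (g x) \<partial>K)"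
    if [measurable]: "A \<in> sets C" and "K \<in> space (prob_algebra B)" for K A
  proof -
    have [measurable_cong]: "sets K = sets B" using that by (simp add: space_prob_algebra)
    show ?thesis by (rule nn_integral_distr) auto
  qed
  fix A assume [measurable]: "A \<in> sets C"
  show "(\<integral>\<^sup>+x. indicator A x \<partial>distr (mix s M N) C g) =
      (\<integral>\<^sup>+x. indicator A x \<partial>mix s (distr M C g) (distr N C g))"
    by (simp add: * mix_in_prob_algebra M nn_integral_mix[OF D[OF M(1)] D[OF M(2)]]
        nn_integral_mix[OF M] s del: nn_integral_indicator)
qed

definition couplings :: "'a::topological_space measure \<Rightarrow> 'a measure \<Rightarrow> ('a \<times> 'a) measure set" where
  "couplings \<mu> \<nu> = {\<pi> \<in> space (prob_algebra (borel \<Otimes>\<^sub>M borel)).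
     distr \<pi> borel fst = \<mu> \<and> distr \<pi> borel snd = \<nu>}"

lemma wasserstein_eq:
  "wasserstein \<omega> d \<mu> \<nu> = (INF \<pi>\<in>couplings \<mu> \<nu>. \<integral>(x, y). \<omega> (d x y) \<partial>\<pi>)"
  by (auto simp: wasserstein_def couplings_def intro!: arg_cong[where f = Inf])

text \<open>Makes the infimum in \<open>wasserstein\<close> one over a nonempty set, so that lower
  bounds valid for every coupling pass to it.\<close>

lemma pair_measure_in_couplings:
  assumes "\<mu> \<in> borel_probs" "\<nu> \<in> borel_probs"
  shows "\<mu> \<Otimes>\<^sub>M \<nu> \<in> couplings \<mu> \<nu>"
proof -
  interpret M: prob_space \<mu> using assms by (simp add: space_prob_algebra)
  interpret N: prob_space \<nu> using assms by (simp add: space_prob_algebra)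
  interpret pair_prob_space \<mu> \<nu> ..
  have s[measurable_cong]: "sets \<mu> = sets borel" "sets \<nu> = sets borel"
    using assms by (auto simp: space_prob_algebra)
  have sp: "space \<mu> = UNIV" "space \<nu> = UNIV"
    using s[THEN sets_eq_imp_space_eq] by auto
  have "distr (\<mu> \<Otimes>\<^sub>M \<nu>) borel fst = distr (\<mu> \<Otimes>\<^sub>M \<nu>) \<mu> fst"
    using s by (intro distr_cong) auto
  also have "\<dots> = \<mu>" by (rule N.distr_pair_fst)
  finally have 1: "distr (\<mu> \<Otimes>\<^sub>M \<nu>) borel fst = \<mu>" .
  have "distr (\<mu> \<Otimes>\<^sub>M \<nu>) borel snd = \<nu>"
  proof (rule measure_eqI)
    fix A assume "A \<in> sets (distr (\<mu> \<Otimes>\<^sub>M \<nu>) borel snd)"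
    then have A[measurable]: "A \<in> sets borel" by simp
    have "emeasure (distr (\<mu> \<Otimes>\<^sub>M \<nu>) borel snd) A = emeasure (\<mu> \<Otimes>\<^sub>M \<nu>) (space \<mu> \<times> A)"
      using s A by (subst emeasure_distr)
        (auto simp: space_pair_measure sp intro!: arg_cong2[where f = emeasure])
    also have "\<dots> = emeasure \<nu> A"
      using s A by (subst N.emeasure_pair_measure_Times) (auto simp: M.emeasure_space_1)
    finally show "emeasure (distr (\<mu> \<Otimes>\<^sub>M \<nu>) borel snd) A = emeasure \<nu> A" .
  qed (use s in simp)
  then show ?thesis using 1 assms
    by (auto simp: couplings_def space_prob_algebra prob_space_pair intro!: sets_pair_measure_cong)
qed

lemma mix_in_couplings:
  assumes "\<pi> \<in> couplings \<mu> \<nu>" "\<pi>' \<in> couplings \<mu>' \<nu>'" "0 \<le> s" "s \<le> 1"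
  shows "mix s \<pi> \<pi>' \<in> couplings (mix s \<mu> \<mu>') (mix s \<nu> \<nu>')"
  using assms by (auto simp: couplings_def mix_in_prob_algebra distr_mix[where B = "borel \<Otimes>\<^sub>M borel"])

section \<open>Transport with a bounded cost\<close>

locale bounded_cost =
  fixes \<omega> :: "real \<Rightarrow> real" and d :: "'a::topological_space \<Rightarrow> 'a \<Rightarrow> real" and \<Omega> :: real
  assumes cost_measurable[measurable]: "(\<lambda>z. \<omega> (d (fst z) (snd z))) \<in> borel_measurable (borel \<Otimes>\<^sub>M borel)"
    and cost_nonneg: "0 \<le> \<omega> (d x y)"
    and cost_le: "\<omega> (d x y) \<le> \<Omega>"
begin

definition cost :: "('a \<times> 'a) measure \<Rightarrow> real" where
  "cost \<pi> = (\<integral>z. \<omega> (d (fst z) (snd z)) \<partial>\<pi>)"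

lemma Omega_nonneg: "0 \<le> \<Omega>"
  using cost_nonneg cost_le order_trans by blast

lemma cost_nonneg': "0 \<le> cost \<pi>"
  unfolding cost_def by (simp add: cost_nonneg)

lemma integrable_cost:
  assumes "\<pi> \<in> space (prob_algebra (borel \<Otimes>\<^sub>M borel))"
  shows "integrable \<pi> (\<lambda>z. \<omega> (d (fst z) (snd z)))"
proof -
  interpret prob_space \<pi> using assms by (simp add: space_prob_algebra)
  have [measurable_cong]: "sets \<pi> = sets (borel \<Otimes>\<^sub>M borel)" using assms by (simp add: space_prob_algebra)
  show ?thesis by (rule integrable_const_bound[where B = \<Omega>]) (auto simp: cost_nonneg cost_le)
qed

lemma nn_integral_cost:
  assumes "\<pi> \<in> space (prob_algebra (borel \<Otimes>\<^sub>M borel))"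
  shows "(\<integral>\<^sup>+z. ennreal (\<omega> (d (fst z) (snd z))) \<partial>\<pi>) = ennreal (cost \<pi>)"
  unfolding cost_def by (rule nn_integral_eq_integral[OF integrable_cost[OF assms]]) (simp add: cost_nonneg)

lemma cost_le_Omega:
  assumes "\<pi> \<in> space (prob_algebra (borel \<Otimes>\<^sub>M borel))"
  shows "cost \<pi> \<le> \<Omega>"
proof -
  interpret prob_space \<pi> using assms by (simp add: space_prob_algebra)
  have "cost \<pi> \<le> (\<integral>z. \<Omega> \<partial>\<pi>)"
    unfolding cost_def by (intro integral_mono integrable_cost assms) (auto simp: cost_le)
  then show ?thesis by (simp add: prob_space)
qed

lemma cost_mix:
  assumes "\<pi> \<in> space (prob_algebra (borel \<Otimes>\<^sub>M borel))" "\<pi>' \<in> space (prob_algebra (borel \<Otimes>\<^sub>M borel))"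
    "0 \<le> s" "s \<le> 1"
  shows "cost (mix s \<pi> \<pi>') = s * cost \<pi> + (1 - s) * cost \<pi>'"
proof -
  have "ennreal (cost (mix s \<pi> \<pi>')) = ennreal (s * cost \<pi> + (1 - s) * cost \<pi>')"
    using assms by (simp add: nn_integral_cost[symmetric] mix_in_prob_algebra
      nn_integral_mix[where B = "borel \<Otimes>\<^sub>M borel"] ennreal_mult' cost_nonneg')
  then show ?thesis using assms by (subst (asm) ennreal_inj) (auto simp: cost_nonneg')
qed

abbreviation W :: "'a measure \<Rightarrow> 'a measure \<Rightarrow> real" where
  "W \<equiv> wasserstein \<omega> d"

lemma W_eq: "W \<mu> \<nu> = (INF \<pi>\<in>couplings \<mu> \<nu>. cost \<pi>)"
  by (simp add: wasserstein_eq cost_def split_beta')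

lemma W_le: "\<pi> \<in> couplings \<mu> \<nu> \<Longrightarrow> W \<mu> \<nu> \<le> cost \<pi>"
  unfolding W_eq by (rule cINF_lower) (auto intro!: bdd_belowI[of _ 0] simp: cost_nonneg')

lemma W_greatest:
  assumes "\<mu> \<in> borel_probs" "\<nu> \<in> borel_probs" "\<And>\<pi>. \<pi> \<in> couplings \<mu> \<nu> \<Longrightarrow> c \<le> cost \<pi>"
  shows "c \<le> W \<mu> \<nu>"
  unfolding W_eq using pair_measure_in_couplings[OF assms(1,2)] assms(3) by (intro cINF_greatest) auto

lemma W_nonneg: "\<mu> \<in> borel_probs \<Longrightarrow> \<nu> \<in> borel_probs \<Longrightarrow> 0 \<le> W \<mu> \<nu>"
  by (rule W_greatest) (auto simp: cost_nonneg')

lemma W_le_Omega: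
  assumes "\<mu> \<in> borel_probs" "\<nu> \<in> borel_probs"
  shows "W \<mu> \<nu> \<le> \<Omega>"
proof -
  have "\<mu> \<Otimes>\<^sub>M \<nu> \<in> couplings \<mu> \<nu>" by (rule pair_measure_in_couplings[OF assms])
  then show ?thesis using W_le cost_le_Omega by (fastforce simp: couplings_def intro: order_trans)
qed

lemma W_approx:
  assumes "\<mu> \<in> borel_probs" "\<nu> \<in> borel_probs" "0 < e"
  obtains \<pi> where "\<pi> \<in> couplings \<mu> \<nu>" "cost \<pi> \<le> W \<mu> \<nu> + e"
proof -
  have "\<exists>\<pi>\<in>couplings \<mu> \<nu>. \<not> W \<mu> \<nu> + e \<le> cost \<pi>"
    using W_greatest[OF assms(1,2), of "W \<mu> \<nu> + e"] assms(3) by force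
  then show ?thesis using that by force
qed

text \<open>Joint convexity of the transport distance: near-optimal couplings of the two pairs,
  mixed with the same coin, couple the mixtures.\<close>

lemma W_mix:
  assumes b: "\<mu> \<in> borel_probs" "\<nu> \<in> borel_probs" "\<mu>' \<in> borel_probs" "\<nu>' \<in> borel_probs"
    and s: "0 \<le> s" "s \<le> 1"
  shows "W (mix s \<mu> \<mu>') (mix s \<nu> \<nu>') \<le> s * W \<mu> \<nu> + (1 - s) * W \<mu>' \<nu>'"
proof (rule field_le_epsilon)
  fix e :: real assume "0 < e"
  obtain \<pi> where \<pi>: "\<pi> \<in> couplings \<mu> \<nu>" "cost \<pi> \<le> W \<mu> \<nu> + e"
    using W_approx[OF b(1,2) \<open>0 < e\<close>] .
  obtain \<pi>' where \<pi>': "\<pi>' \<in> couplings \<mu>' \<nu>'" "cost \<pi>' \<le> W \<mu>' \<nu>' + e"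
    using W_approx[OF b(3,4) \<open>0 < e\<close>] .
  have "W (mix s \<mu> \<mu>') (mix s \<nu> \<nu>') \<le> cost (mix s \<pi> \<pi>')"
    by (intro W_le mix_in_couplings \<pi> \<pi>' s)
  also have "\<dots> = s * cost \<pi> + (1 - s) * cost \<pi>'"
    using \<pi> \<pi>' s by (intro cost_mix) (auto simp: couplings_def)
  also have "\<dots> \<le> s * (W \<mu> \<nu> + e) + (1 - s) * (W \<mu>' \<nu>' + e)"
    using \<pi> \<pi>' s by (intro add_mono mult_left_mono) auto
  finally show "W (mix s \<mu> \<mu>') (mix s \<nu> \<nu>') \<le> s * W \<mu> \<nu> + (1 - s) * W \<mu>' \<nu>' + e"
    by (simp add: algebra_simps)
qed

end

section \<open>The dual operator\<close>

lemma nn_integral_dual_op: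
  fixes m :: "'a::topological_space \<Rightarrow> 'a measure"
  assumes m: "transition_kernel m" and k[measurable]: "k \<in> borel_measurable borel"
    and s[measurable_cong]: "sets \<mu> = sets borel" and g[measurable]: "g \<in> borel_measurable borel"
  shows "(\<integral>\<^sup>+y. g y \<partial>dual_op m k \<mu>) = (\<integral>\<^sup>+x. \<integral>\<^sup>+y. ennreal (exp (k y)) * g y \<partial>m x \<partial>\<mu>)"
proof -
  have sp: "space \<mu> = UNIV" using sets_eq_imp_space_eq[OF s] by simp
  have m'[measurable]: "m \<in> \<mu> \<rightarrow>\<^sub>M subprob_algebra borel"
    using measurable_prob_algebraD[OF m] by (simp add: measurable_cong_sets[OF s refl])
  have [measurable_cong]: "sets (\<mu> \<bind> m) = sets borel"
    by (subst sets_bind_measurable[OF m']) (auto simp: sp)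
  show ?thesis
    unfolding dual_op_def by (subst nn_integral_density) (auto simp: nn_integral_bind[OF _ m'])
qed

lemma sets_dual_op:
  fixes m :: "'a::topological_space \<Rightarrow> 'a measure"
  assumes m: "transition_kernel m" and s: "sets \<mu> = sets borel"
  shows "sets (dual_op m k \<mu>) = sets borel"
proof -
  have sp: "space \<mu> = UNIV" using sets_eq_imp_space_eq[OF s] by simp
  have "m \<in> \<mu> \<rightarrow>\<^sub>M subprob_algebra borel"
    using measurable_prob_algebraD[OF m] by (simp add: measurable_cong_sets[OF s refl])
  then show ?thesis unfolding dual_op_def by (simp add: sets_bind_measurable sp)
qed

section \<open>Normalized potentials with a coupling\<close>

text \<open>A piece with density \<open>D\<close> is cut out of \<open>M\<close>, transported by
  \<open>\<phi>\<close> and rescaled to mass 1. For \<open>s = 0\<close> rescaling is impossible,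
  but then \<open>D\<close> vanishes almost everywhere and any \<open>\<rho>0\<close> satisfies the
  identity.\<close>

lemma normalize_density:
  assumes D[measurable]: "D \<in> borel_measurable M" and \<phi>[measurable]: "\<phi> \<in> M \<rightarrow>\<^sub>M N"
    and s: "(\<integral>\<^sup>+z. D z \<partial>M) = ennreal s" "0 \<le> s" and \<rho>0: "\<rho>0 \<in> space (prob_algebra N)"
  obtains \<rho> where "\<rho> \<in> space (prob_algebra N)"
    "\<And>g. g \<in> borel_measurable N \<Longrightarrow> ennreal s * (\<integral>\<^sup>+x. g x \<partial>\<rho>) = (\<integral>\<^sup>+z. D z * g (\<phi> z) \<partial>M)"
proof (cases "s = 0")
  case True
  then have "AE z in M. D z = 0" using s by (simp add: nn_integral_0_iff_AE)
  then have "(\<integral>\<^sup>+z. D z * g (\<phi> z) \<partial>M) = (\<integral>\<^sup>+z. 0 \<partial>M)" for g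
    by (intro nn_integral_cong_AE) auto
  then show ?thesis using True that[OF \<rho>0] by simp
next
  case False
  then have s0: "0 < s" using s by simp
  define \<rho> where "\<rho> = scale_measure (ennreal (1/s)) (distr (density M D) N \<phi>)"
  have I: "(\<integral>\<^sup>+x. g x \<partial>\<rho>) = ennreal (1/s) * (\<integral>\<^sup>+z. D z * g (\<phi> z) \<partial>M)"
    if [measurable]: "g \<in> borel_measurable N" for g
    unfolding \<rho>_def by (simp add: nn_integral_scale_measure nn_integral_distr nn_integral_density)
  have "emeasure \<rho> (space \<rho>) = (\<integral>\<^sup>+x. 1 \<partial>\<rho>)" by simp
  also have "\<dots> = ennreal (1/s) * ennreal s" by (subst I) (auto simp: s)
  also have "\<dots> = 1" using s0 by (simp flip: ennreal_mult)
  finally have "\<rho> \<in> space (prob_algebra N)"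
    by (auto simp: space_prob_algebra \<rho>_def intro: prob_spaceI)
  moreover have "ennreal s * (\<integral>\<^sup>+x. g x \<partial>\<rho>) = (\<integral>\<^sup>+z. D z * g (\<phi> z) \<partial>M)"
    if "g \<in> borel_measurable N" for g
    using s0 by (simp add: I[OF that] flip: mult.assoc ennreal_mult)
  ultimately show ?thesis by (rule that)
qed

locale coupled_kernel = bounded_cost \<omega> "dist :: 'x::polish_space \<Rightarrow> 'x \<Rightarrow> real" \<Omega>
  for \<omega> :: "real \<Rightarrow> real" and \<Omega> :: real +
  fixes m :: "'x::polish_space \<Rightarrow> 'x measure" and f :: "'x \<Rightarrow> real" and P :: "'x path_coupling"
    and C F0 :: real
  assumes kernel: "transition_kernel m"
    and coupling: "kernel_coupling m P"
    and f_measurable[measurable]: "f \<in> borel_measurable borel"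
    and f_bound: "\<bar>f x\<bar> \<le> F0"
    and normal: "normalized m f"
    and omega_0: "\<omega> 0 = 0"
    and C_pos: "0 < C"
    and flat: "1 \<le> n \<Longrightarrow> AE z in P n x y.
        \<bar>birkhoff_sum f n (fst z) - birkhoff_sum f n (snd z)\<bar> \<le> C * \<omega> (dist x y)"
begin

abbreviation T :: "'x measure \<Rightarrow> 'x measure" where
  "T \<equiv> dual_op m f"

lemma kernel_sub[measurable]: "m \<in> borel \<rightarrow>\<^sub>M subprob_algebra borel"
  by (rule measurable_prob_algebraD[OF kernel])

lemma kernel_in: "m x \<in> borel_probs"
  using measurable_space[OF kernel] by simp

lemma sets_kernel_borel[measurable_cong, simp]: "sets (m x) = sets borel"
  using kernel_in by (simp add: space_prob_algebra)

lemma kernel_normal: "(\<integral>\<^sup>+y. ennreal (exp (f y)) \<partial>m x) = 1"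
proof -
  interpret prob_space "m x" using kernel_in by (simp add: space_prob_algebra)
  have "integrable (m x) (\<lambda>y. exp (f y))"
    using f_bound by (intro integrable_const_bound[where B = "exp F0"]) (auto intro: order_trans[OF abs_ge_self])
  then have "(\<integral>\<^sup>+y. ennreal (exp (f y)) \<partial>m x) = ennreal (\<integral>y. exp (f y) \<partial>m x)"
    by (rule nn_integral_eq_integral) simp
  also have "(\<integral>y. exp (f y) \<partial>m x) = 1"
    using normal by (auto simp: normalized_def transfer_op_def dest: fun_cong[of _ _ x])
  finally show ?thesis by simp
qed

lemma nn_integral_T:
  assumes \<mu>: "\<mu> \<in> borel_probs" and g: "g \<in> borel_measurable borel"
  shows "(\<integral>\<^sup>+y. g y \<partial>T \<mu>) = (\<integral>\<^sup>+x. \<integral>\<^sup>+y. ennreal (exp (f y)) * g y \<partial>m x \<partial>\<mu>)"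
  using \<mu> by (intro nn_integral_dual_op[OF kernel f_measurable _ g]) (simp add: space_prob_algebra)

lemma T_in: "\<mu> \<in> borel_probs \<Longrightarrow> T \<mu> \<in> borel_probs"
proof -
  assume \<mu>: "\<mu> \<in> borel_probs"
  then have s: "sets \<mu> = sets borel" by (simp add: space_prob_algebra)
  interpret prob_space \<mu> using \<mu> by (simp add: space_prob_algebra)
  have "emeasure (T \<mu>) (space (T \<mu>)) = (\<integral>\<^sup>+y. 1 \<partial>T \<mu>)" by simp
  also have "\<dots> = 1" by (subst nn_integral_T[OF \<mu>]) (simp_all add: kernel_normal emeasure_space_1)
  finally show ?thesis using sets_dual_op[OF kernel s] by (auto simp: space_prob_algebra intro: prob_spaceI)
qed

lemma Tn_in: "\<mu> \<in> borel_probs \<Longrightarrow> (T ^^ n) \<mu> \<in> borel_probs"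
  by (induction n) (auto simp: T_in)

lemma T_mix:
  assumes "\<mu> \<in> borel_probs" "\<nu> \<in> borel_probs" "0 \<le> s" "s \<le> 1"
  shows "T (mix s \<mu> \<nu>) = mix s (T \<mu>) (T \<nu>)"
  by (rule prob_algebra_eqI[where B = borel])
    (auto simp: assms T_in mix_in_prob_algebra nn_integral_T nn_integral_mix[where B = borel]
      simp del: nn_integral_indicator)

lemma Tn_mix:
  assumes "\<mu> \<in> borel_probs" "\<nu> \<in> borel_probs" "0 \<le> s" "s \<le> 1"
  shows "(T ^^ n) (mix s \<mu> \<nu>) = mix s ((T ^^ n) \<mu>) ((T ^^ n) \<nu>)"
  by (induction n) (auto simp: assms T_mix Tn_in)

section \<open>Path laws and the iterates of the dual operator\<close>

text \<open>The only path of length 0 carries no position; the starting point stands in for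
  it.\<close>

definition path_end :: "'x \<Rightarrow> nat \<Rightarrow> (nat \<Rightarrow> 'x) \<Rightarrow> 'x" where
  "path_end x n p = (if n = 0 then x else p n)"

lemma measurable_path_component[measurable (raw)]:
  "1 \<le> j \<Longrightarrow> j \<le> n \<Longrightarrow> (\<lambda>p. p j) \<in> path_space n \<rightarrow>\<^sub>M borel"
  unfolding path_space_def by (rule measurable_component_singleton) auto

lemma measurable_birkhoff_sum[measurable]:
  "birkhoff_sum f n \<in> borel_measurable (path_space n)"
  unfolding birkhoff_sum_def by (intro borel_measurable_sum measurable_compose[OF _ f_measurable]) auto

lemma measurable_path_end[measurable]:
  "(\<lambda>z. path_end (fst z) n (snd z)) \<in> borel \<Otimes>\<^sub>M path_space n \<rightarrow>\<^sub>M borel"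
  unfolding path_end_def by (cases "n = 0") (auto intro!: measurable_compose[OF measurable_snd measurable_path_component])

lemma measurable_path_end'[measurable]: "path_end x n \<in> path_space n \<rightarrow>\<^sub>M borel"
  unfolding path_end_def by (cases "n = 0") (auto intro!: measurable_path_component)

lemma measurable_path_extend[measurable]:
  "(\<lambda>z. (fst z)(Suc n := snd z)) \<in> path_space n \<Otimes>\<^sub>M borel \<rightarrow>\<^sub>M path_space (Suc n)"
  unfolding path_space_def by (rule measurable_fun_upd[where J = "{1..n}"]) auto

lemma path_step_kernel[measurable]:
  "(\<lambda>z. distr (m (path_end (fst z) n (snd z))) (path_space (Suc n)) (\<lambda>y. (snd z)(Suc n := y)))
     \<in> borel \<Otimes>\<^sub>M path_space n \<rightarrow>\<^sub>M prob_algebra (path_space (Suc n))"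
proof (rule measurable_distr_prob_space2)
  show "(\<lambda>z. m (path_end (fst z) n (snd z))) \<in> borel \<Otimes>\<^sub>M path_space n \<rightarrow>\<^sub>M prob_algebra borel"
    by (rule measurable_compose[OF _ kernel]) measurable
  show "(\<lambda>(z, y). (snd z)(Suc n := y)) \<in> (borel \<Otimes>\<^sub>M path_space n) \<Otimes>\<^sub>M borel \<rightarrow>\<^sub>M path_space (Suc n)"
    using measurable_compose[OF _ measurable_path_extend, of "\<lambda>(z, y). (snd z, y)" "(borel \<Otimes>\<^sub>M path_space n) \<Otimes>\<^sub>M borel" n]
    by (simp add: split_beta')
qed

lemma path_law_Suc:
  "path_law m x (Suc n) = path_law m x n \<bind>
     (\<lambda>p. distr (m (path_end x n p)) (path_space (Suc n)) (\<lambda>y. p(Suc n := y)))"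
  by (simp add: path_end_def)

lemma path_law_kernel[measurable]:
  "(\<lambda>x. path_law m x n) \<in> borel \<rightarrow>\<^sub>M prob_algebra (path_space n)"
proof (induction n)
  case 0
  have "(\<lambda>_. undefined) \<in> space (path_space 0 :: (nat \<Rightarrow> 'x) measure)"
    by (simp add: path_space_def space_PiM)
  then show ?case by (simp add: space_prob_algebra prob_space_return)
next
  case (Suc n)
  show ?case
    unfolding path_law_Suc
    using measurable_bind_prob_space2[OF Suc, of "\<lambda>x p. distr (m (path_end x n p)) (path_space (Suc n)) (\<lambda>y. p(Suc n := y))"]
      path_step_kernel[of n] by (simp add: split_beta')
qed

lemma path_law_in: "path_law m x n \<in> space (prob_algebra (path_space n))"
  using measurable_space[OF path_law_kernel] by simp

lemma sets_path_law[measurable_cong, simp]: "sets (path_law m x n) = sets (path_space n)"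
  using path_law_in by (simp add: space_prob_algebra)

lemma path_step_kernel'[measurable]:
  "(\<lambda>p. distr (m (path_end x n p)) (path_space (Suc n)) (\<lambda>y. p(Suc n := y)))
     \<in> path_space n \<rightarrow>\<^sub>M prob_algebra (path_space (Suc n))"
  using measurable_compose[OF _ path_step_kernel, of "\<lambda>p. (x, p)" "path_space n" n] by simp

lemma nn_integral_path_law_Suc:
  assumes g[measurable]: "g \<in> borel_measurable (path_space (Suc n))"
  shows "(\<integral>\<^sup>+p. g p \<partial>path_law m x (Suc n)) =
    (\<integral>\<^sup>+p. \<integral>\<^sup>+y. g (p(Suc n := y)) \<partial>m (path_end x n p) \<partial>path_law m x n)"
proof -
  have [measurable]: "(\<lambda>y. p(Suc n := y)) \<in> borel \<rightarrow>\<^sub>M path_space (Suc n)" if "p \<in> space (path_space n)" for p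
    using measurable_compose[OF _ measurable_path_extend, of "\<lambda>y. (p, y)" borel n] that by simp
  have sp: "space (path_law m x n) = space (path_space n)"
    by (rule sets_eq_imp_space_eq) simp
  show ?thesis
    unfolding path_law_Suc
    apply (subst nn_integral_bind[where B = "path_space (Suc n)"])
      apply simp
     apply (rule measurable_prob_algebraD)
     apply (simp add: measurable_cong_sets[OF sets_path_law refl])
    apply (intro nn_integral_cong)
    apply (subst nn_integral_distr)
    apply (auto simp: sp)
    done
qed

lemma birkhoff_sum_upd: "birkhoff_sum f (Suc n) (p(Suc n := y)) = birkhoff_sum f n p + f y"
  by (auto simp: birkhoff_sum_def intro!: sum.cong)

text \<open>Iterating the dual operator weights the law of the chain by the exponential of the
  Birkhoff sum. The last step of the chain is absorbed into the test function, which is why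
  \<open>g\<close> varies in the induction.\<close>

lemma nn_integral_Tn:
  assumes \<mu>: "\<mu> \<in> borel_probs" and g[measurable]: "g \<in> borel_measurable borel"
  shows "(\<integral>\<^sup>+y. g y \<partial>(T ^^ n) \<mu>) =
    (\<integral>\<^sup>+x. \<integral>\<^sup>+p. ennreal (exp (birkhoff_sum f n p)) * g (path_end x n p) \<partial>path_law m x n \<partial>\<mu>)"
  using g
proof (induction n arbitrary: g)
  case 0
  have "(\<lambda>_. undefined) \<in> space (path_space 0 :: (nat \<Rightarrow> 'x) measure)"
    by (simp add: path_space_def space_PiM)
  then show ?case using 0
    by (simp add: nn_integral_return birkhoff_sum_def path_end_def)
next
  case (Suc n)
  note [measurable] = Suc.prems
  have *: "(\<integral>\<^sup>+p. ennreal (exp (birkhoff_sum f (Suc n) p)) * g (path_end x (Suc n) p) \<partial>path_law m x (Suc n))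
    = (\<integral>\<^sup>+p. ennreal (exp (birkhoff_sum f n p)) *
        (\<integral>\<^sup>+y. ennreal (exp (f y)) * g y \<partial>m (path_end x n p)) \<partial>path_law m x n)" for x
    by (subst nn_integral_path_law_Suc)
      (auto simp: birkhoff_sum_upd exp_add ennreal_mult' mult.assoc path_end_def nn_integral_cmult)
  have "(\<integral>\<^sup>+y. g y \<partial>(T ^^ Suc n) \<mu>) = (\<integral>\<^sup>+x. (\<integral>\<^sup>+y. ennreal (exp (f y)) * g y \<partial>m x) \<partial>(T ^^ n) \<mu>)"
    by (simp add: nn_integral_T Tn_in \<mu>)
  also have "\<dots> = (\<integral>\<^sup>+x. \<integral>\<^sup>+p. ennreal (exp (birkhoff_sum f n p)) *
        (\<integral>\<^sup>+y. ennreal (exp (f y)) * g y \<partial>m (path_end x n p)) \<partial>path_law m x n \<partial>\<mu>)"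
    by (rule Suc.IH) measurable
  finally show ?case unfolding * .
qed

abbreviation path_pair_space :: "nat \<Rightarrow> ((nat \<Rightarrow> 'x) \<times> (nat \<Rightarrow> 'x)) measure" where
  "path_pair_space n \<equiv> path_space n \<Otimes>\<^sub>M path_space n"

text \<open>The decay rate only controls \<open>P n x y\<close> for \<open>x \<noteq> y\<close>.\<close>
definition Q :: "nat \<Rightarrow> 'x \<Rightarrow> 'x \<Rightarrow> ((nat \<Rightarrow> 'x) \<times> (nat \<Rightarrow> 'x)) measure" where
  "Q n x y = (if x = y then distr (path_law m x n) (path_pair_space n) (\<lambda>p. (p, p)) else P n x y)"

text \<open>The diagonal is the zero set of the distance, which is measurable for the product of the
  Borel algebras because the space is second countable.\<close>

lemma measurable_diagonal[measurable]: "Measurable.pred (borel \<Otimes>\<^sub>M borel) (\<lambda>z. fst z = (snd z :: 'x))"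
proof -
  have "Measurable.pred (borel \<Otimes>\<^sub>M borel) (\<lambda>z. dist (fst z) (snd z :: 'x) = 0)" by measurable
  then show ?thesis by simp
qed

lemma Q_kernel[measurable]:
  assumes "1 \<le> n"
  shows "(\<lambda>z. Q n (fst z) (snd z)) \<in> borel \<Otimes>\<^sub>M borel \<rightarrow>\<^sub>M prob_algebra (path_pair_space n)"
  unfolding Q_def
proof (rule measurable_If)
  have "(\<lambda>x. distr (path_law m x n) (path_pair_space n) (\<lambda>p. (p, p))) \<in> borel \<rightarrow>\<^sub>M prob_algebra (path_pair_space n)"
    by (rule measurable_compose[OF path_law_kernel measurable_distr_prob_space]) measurable
  from measurable_compose[OF measurable_fst this]
  show "(\<lambda>z. distr (path_law m (fst z) n) (path_pair_space n) (\<lambda>p. (p, p))) \<in> borel \<Otimes>\<^sub>M borel \<rightarrow>\<^sub>M prob_algebra (path_pair_space n)" .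
  show "(\<lambda>z. P n (fst z) (snd z)) \<in> borel \<Otimes>\<^sub>M borel \<rightarrow>\<^sub>M prob_algebra (path_pair_space n)"
    using coupling assms by (simp add: kernel_coupling_def split_beta')
  show "{z \<in> space (borel \<Otimes>\<^sub>M borel). fst z = (snd z :: 'x)} \<in> sets (borel \<Otimes>\<^sub>M borel)"
    using measurable_diagonal by (simp add: pred_def)
qed

lemma Q_in: "1 \<le> n \<Longrightarrow> Q n x y \<in> space (prob_algebra (path_pair_space n))"
  using measurable_space[OF Q_kernel, of n "(x, y)"] by (simp add: space_pair_measure)

lemma sets_Q: "1 \<le> n \<Longrightarrow> sets (Q n x y) = sets (path_pair_space n)"
  using Q_in by (simp add: space_prob_algebra)

lemma distr_Q:
  assumes "1 \<le> n"
  shows "distr (Q n x y) (path_space n) fst = path_law m x n"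
    "distr (Q n x y) (path_space n) snd = path_law m y n"
proof -
  have "distr (distr (path_law m x n) (path_pair_space n) (\<lambda>p. (p, p))) (path_space n) fst = path_law m x n"
    "distr (distr (path_law m x n) (path_pair_space n) (\<lambda>p. (p, p))) (path_space n) snd = path_law m x n"
    by (simp_all add: distr_distr comp_def distr_id2)
  moreover have "distr (P n x y) (path_space n) fst = path_law m x n"
    "distr (P n x y) (path_space n) snd = path_law m y n"
    using coupling assms by (auto simp: kernel_coupling_def)
  ultimately show "distr (Q n x y) (path_space n) fst = path_law m x n"
    "distr (Q n x y) (path_space n) snd = path_law m y n"
    by (auto simp: Q_def)
qed

lemma flat_Q:
  assumes n: "1 \<le> n"
  shows "AE z in Q n x y. \<bar>birkhoff_sum f n (fst z) - birkhoff_sum f n (snd z)\<bar> \<le> C * \<omega> (dist x y)"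
proof (cases "x = y")
  case True
  have "AE z in distr (path_law m x n) (path_pair_space n) (\<lambda>p. (p, p)).
      \<bar>birkhoff_sum f n (fst z) - birkhoff_sum f n (snd z)\<bar> \<le> 0"
    by (subst AE_distr_iff) auto
  then show ?thesis unfolding Q_def True using omega_0 by (simp only: dist_self refl if_True mult_zero_right)
next
  case False
  then have "Q n x y = P n x y" by (simp add: Q_def)
  then show ?thesis using flat[OF n, of x y] by metis
qed

lemma measurable_end_pair[measurable]:
  assumes "1 \<le> n"
  shows "(\<lambda>z. fst z n) \<in> path_pair_space n \<rightarrow>\<^sub>M (borel :: 'x measure)"
    "(\<lambda>z. snd z n) \<in> path_pair_space n \<rightarrow>\<^sub>M (borel :: 'x measure)"
  using assms by (auto intro!: measurable_compose[OF measurable_fst measurable_path_component]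
      measurable_compose[OF measurable_snd measurable_path_component])

text \<open>The integral bounded by \<open>coupling_decay_rate\<close>, for \<open>Q\<close> in
  place of \<open>P\<close> and with values in \<open>ennreal\<close>, so that estimates need no
  integrability.\<close>

definition link_cost :: "nat \<Rightarrow> 'x \<Rightarrow> 'x \<Rightarrow> ennreal" where
  "link_cost n x y = (\<integral>\<^sup>+z. ennreal (\<omega> (dist (fst z n) (snd z n)) * exp (birkhoff_sum f n (fst z))) \<partial>Q n x y)"

text \<open>The integral is the total mass of the iterated dual operator applied to the point mass
  at \<open>x\<close>.\<close>

lemma path_law_normal: "(\<integral>\<^sup>+p. ennreal (exp (birkhoff_sum f n p)) \<partial>path_law m x n) = 1"
proof -
  have r: "return borel x \<in> borel_probs" by (simp add: space_prob_algebra prob_space_return)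
  interpret prob_space "(T ^^ n) (return borel x)" using Tn_in[OF r] by (simp add: space_prob_algebra)
  have "1 = (\<integral>\<^sup>+y. 1 \<partial>(T ^^ n) (return borel x))" by (simp add: emeasure_space_1)
  also have "\<dots> = (\<integral>\<^sup>+x. \<integral>\<^sup>+p. ennreal (exp (birkhoff_sum f n p)) \<partial>path_law m x n \<partial>return borel x)"
    by (subst nn_integral_Tn[OF r]) auto
  also have "\<dots> = (\<integral>\<^sup>+p. ennreal (exp (birkhoff_sum f n p)) \<partial>path_law m x n)"
    by (subst nn_integral_return)
      (auto intro!: measurable_compose[OF measurable_prob_algebraD[OF path_law_kernel] nn_integral_measurable_subprob_algebra])
  finally show ?thesis by simp
qed

text \<open>The coupling keeps the part of \<open>Q\<close> weighted by the smaller of the two weights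
  \<open>u\<close> and \<open>v\<close>; by flatness the mass \<open>s\<close> left over on either side is small.\<close>
lemma coupling_step:
  assumes n: "1 \<le> n" and b: "\<mu> \<in> borel_probs" "\<nu> \<in> borel_probs" and \<pi>: "\<pi> \<in> couplings \<mu> \<nu>"
  obtains s \<rho> \<rho>' \<pi>' where "0 \<le> s" "s \<le> 1" "\<rho> \<in> borel_probs" "\<rho>' \<in> borel_probs"
    "\<pi>' \<in> space (prob_algebra (borel \<Otimes>\<^sub>M borel))"
    "(T ^^ n) \<mu> = mix s \<rho> (distr \<pi>' borel fst)" "(T ^^ n) \<nu> = mix s \<rho>' (distr \<pi>' borel snd)"
    "ennreal ((1 - s) * cost \<pi>') \<le> (\<integral>\<^sup>+z. link_cost n (fst z) (snd z) \<partial>\<pi>)"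
    "s \<le> (\<integral>z. 1 - exp (- C * \<omega> (dist (fst z) (snd z))) \<partial>\<pi>)"
proof -
  have \<pi>_in: "\<pi> \<in> space (prob_algebra (borel \<Otimes>\<^sub>M borel))" and
    marg: "distr \<pi> borel fst = \<mu>" "distr \<pi> borel snd = \<nu>"
    using \<pi> by (auto simp: couplings_def)
  have s\<pi>[measurable_cong]: "sets \<pi> = sets (borel \<Otimes>\<^sub>M borel)" using \<pi>_in by (simp add: space_prob_algebra)
  interpret pi: prob_space \<pi> using \<pi>_in by (simp add: space_prob_algebra)
  let ?PP = "path_pair_space n"
  note [measurable] = Q_kernel[OF n] measurable_end_pair[OF n]
  have sQ[measurable_cong]: "sets (Q n x y) = sets ?PP" for x y using sets_Q[OF n] .
  have Qs[measurable]: "(\<lambda>z. Q n (fst z) (snd z)) \<in> \<pi> \<rightarrow>\<^sub>M subprob_algebra ?PP"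
    using measurable_prob_algebraD[OF Q_kernel[OF n]] by (simp add: measurable_cong_sets[OF s\<pi> refl])
  \<comment> \<open>\<open>\<Theta>\<close> is the joint law of the two paths when their starting
    points are drawn from \<open>\<pi>\<close>.\<close>
  define \<Theta> where "\<Theta> = \<pi> \<bind> (\<lambda>z. Q n (fst z) (snd z))"
  have \<Theta>_sets[measurable_cong]: "sets \<Theta> = sets ?PP"
    unfolding \<Theta>_def by (rule sets_bind'[OF \<pi>_in Q_kernel[OF n]])
  have int: "(\<integral>\<^sup>+z. g z \<partial>\<Theta>) = (\<integral>\<^sup>+z. \<integral>\<^sup>+q. g q \<partial>Q n (fst z) (snd z) \<partial>\<pi>)"
    if "g \<in> borel_measurable ?PP" for g
    unfolding \<Theta>_def by (rule nn_integral_bind[OF that Qs])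
  define u where "u = (\<lambda>z. exp (birkhoff_sum f n (fst (z :: (nat \<Rightarrow> 'x) \<times> (nat \<Rightarrow> 'x)))))"
  define v where "v = (\<lambda>z. exp (birkhoff_sum f n (snd (z :: (nat \<Rightarrow> 'x) \<times> (nat \<Rightarrow> 'x)))))"
  define w where "w = (\<lambda>z. min (u z) (v z))"
  have uv[measurable]: "u \<in> borel_measurable ?PP" "v \<in> borel_measurable ?PP"
    unfolding u_def v_def by measurable
  have w[measurable]: "w \<in> borel_measurable ?PP" unfolding w_def by measurable
  have pos: "0 < u z" "0 < v z" "0 < w z" "w z \<le> u z" "w z \<le> v z" for z
    by (auto simp: u_def v_def w_def)
  have push: "(\<integral>\<^sup>+z. k (q z) \<partial>Q n x y) = (\<integral>\<^sup>+p. k p \<partial>path_law m x' n)"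
    if "k \<in> borel_measurable (path_space n)" "q \<in> ?PP \<rightarrow>\<^sub>M path_space n"
      "distr (Q n x y) (path_space n) q = path_law m x' n" for k q x y x'
  proof -
    have "q \<in> Q n x y \<rightarrow>\<^sub>M path_space n" using that(2) by (simp add: measurable_cong_sets[OF sQ refl])
    then show ?thesis unfolding that(3)[symmetric] using that(1) by (subst nn_integral_distr) auto
  qed
  \<comment> \<open>Stated for a coordinate \<open>e\<close> of the starting points and the matching
    coordinate \<open>q\<close> of the paths, so that one argument serves both marginals.\<close>
  have image: "(\<integral>\<^sup>+z. ennreal (exp (birkhoff_sum f n (q z))) * k (q z n) \<partial>\<Theta>) = (\<integral>\<^sup>+y. k y \<partial>(T ^^ n) \<eta>)"
    if k[measurable]: "k \<in> borel_measurable borel" and \<eta>: "\<eta> \<in> borel_probs" "distr \<pi> borel e = \<eta>"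
      and e[measurable]: "e \<in> borel \<Otimes>\<^sub>M borel \<rightarrow>\<^sub>M borel" and q[measurable]: "q \<in> ?PP \<rightarrow>\<^sub>M path_space n"
      and Qq: "\<And>z. distr (Q n (fst z) (snd z)) (path_space n) q = path_law m (e z) n" for k \<eta> e q
  proof -
    have pe: "path_end x n p = p n" for x p using n by (simp add: path_end_def)
    have [measurable]: "(\<lambda>p. k (p n)) \<in> borel_measurable (path_space n)"
      using n by (intro measurable_compose[OF measurable_path_component k]) auto
    have m1: "(\<lambda>x. \<integral>\<^sup>+p. ennreal (exp (birkhoff_sum f n p)) * k (p n) \<partial>path_law m x n) \<in> borel_measurable borel"
      by (rule measurable_compose[OF measurable_prob_algebraD[OF path_law_kernel] nn_integral_measurable_subprob_algebra]) measurable
    have "(\<integral>\<^sup>+y. k y \<partial>(T ^^ n) \<eta>) = (\<integral>\<^sup>+x. \<integral>\<^sup>+p. ennreal (exp (birkhoff_sum f n p)) * k (p n) \<partial>path_law m x n \<partial>\<eta>)"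
      by (simp add: nn_integral_Tn[OF \<eta>(1)] pe)
    also have "\<dots> = (\<integral>\<^sup>+z. \<integral>\<^sup>+p. ennreal (exp (birkhoff_sum f n p)) * k (p n) \<partial>path_law m (e z) n \<partial>\<pi>)"
      unfolding \<eta>(2)[symmetric] by (subst nn_integral_distr) (auto simp: m1)
    also have "\<dots> = (\<integral>\<^sup>+z. \<integral>\<^sup>+y. ennreal (exp (birkhoff_sum f n (q y))) * k (q y n) \<partial>Q n (fst z) (snd z) \<partial>\<pi>)"
      by (intro nn_integral_cong push[OF _ q Qq, symmetric]) measurable
    also have "\<dots> = (\<integral>\<^sup>+z. ennreal (exp (birkhoff_sum f n (q z))) * k (q z n) \<partial>\<Theta>)"
    proof (rule int[symmetric])
      show "(\<lambda>z. ennreal (exp (birkhoff_sum f n (q z))) * k (q z n)) \<in> borel_measurable ?PP"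
        by (rule measurable_compose[OF q]) measurable
    qed
    finally show ?thesis ..
  qed
  have U: "(\<integral>\<^sup>+z. ennreal (u z) * k (fst z n) \<partial>\<Theta>) = (\<integral>\<^sup>+y. k y \<partial>(T ^^ n) \<mu>)"
    if "k \<in> borel_measurable borel" for k
    unfolding u_def by (rule image[OF that b(1) marg(1) measurable_fst measurable_fst distr_Q(1)[OF n]])
  have V: "(\<integral>\<^sup>+z. ennreal (v z) * k (snd z n) \<partial>\<Theta>) = (\<integral>\<^sup>+y. k y \<partial>(T ^^ n) \<nu>)"
    if "k \<in> borel_measurable borel" for k
    unfolding v_def by (rule image[OF that b(2) marg(2) measurable_snd measurable_snd distr_Q(2)[OF n]])
  interpret T1: prob_space "(T ^^ n) \<mu>" using Tn_in[OF b(1)] by (simp add: space_prob_algebra)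
  interpret T2: prob_space "(T ^^ n) \<nu>" using Tn_in[OF b(2)] by (simp add: space_prob_algebra)
  have U1: "(\<integral>\<^sup>+z. ennreal (u z) \<partial>\<Theta>) = 1" using U[of "\<lambda>_. 1"] by (simp add: T1.emeasure_space_1)
  have V1: "(\<integral>\<^sup>+z. ennreal (v z) \<partial>\<Theta>) = 1" using V[of "\<lambda>_. 1"] by (simp add: T2.emeasure_space_1)
  have split_u: "ennreal (u z) = ennreal (u z - w z) + ennreal (w z)"
    and split_v: "ennreal (v z) = ennreal (v z - w z) + ennreal (w z)" for z
    using pos[of z] by (auto simp flip: ennreal_plus)
  have su: "(\<integral>\<^sup>+z. ennreal (u z - w z) \<partial>\<Theta>) + (\<integral>\<^sup>+z. ennreal (w z) \<partial>\<Theta>) = 1"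
    unfolding U1[symmetric] split_u by (rule nn_integral_add[symmetric]) measurable
  have sv: "(\<integral>\<^sup>+z. ennreal (v z - w z) \<partial>\<Theta>) + (\<integral>\<^sup>+z. ennreal (w z) \<partial>\<Theta>) = 1"
    unfolding V1[symmetric] split_v by (rule nn_integral_add[symmetric]) measurable
  have wfin: "(\<integral>\<^sup>+z. ennreal (w z) \<partial>\<Theta>) \<le> 1" using su by (metis add.commute le_iff_add)
  \<comment> \<open>\<open>u\<close> and \<open>v\<close> both have integral 1, so removing the
    common part \<open>w\<close> leaves the same mass \<open>s\<close> on either side.\<close>
  define s where "s = 1 - enn2real (\<integral>\<^sup>+z. ennreal (w z) \<partial>\<Theta>)"
  have s01: "0 \<le> s" "s \<le> 1"
    using wfin by (auto simp: s_def enn2real_leI)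
  have wfin': "(\<integral>\<^sup>+z. ennreal (w z) \<partial>\<Theta>) < top" using wfin le_less_trans by fastforce
  have Iw: "(\<integral>\<^sup>+z. ennreal (w z) \<partial>\<Theta>) = ennreal (1 - s)"
    using wfin' by (simp add: s_def ennreal_enn2real)
  have cancel: "I = ennreal s" if "I + ennreal (1 - s) = 1" for I
  proof -
    have "I + ennreal (1 - s) = ennreal s + ennreal (1 - s)"
      using that s01 by (simp flip: ennreal_plus)
    then show ?thesis by (simp add: ennreal_add_left_cancel add.commute[of _ "ennreal (1 - s)"])
  qed
  have Iu: "(\<integral>\<^sup>+z. ennreal (u z - w z) \<partial>\<Theta>) = ennreal s" using su Iw cancel by simp
  have Iv: "(\<integral>\<^sup>+z. ennreal (v z - w z) \<partial>\<Theta>) = ennreal s" using sv Iw cancel by simp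
  have e1: "(\<lambda>z. fst z n) \<in> \<Theta> \<rightarrow>\<^sub>M (borel :: 'x measure)" and e2: "(\<lambda>z. snd z n) \<in> \<Theta> \<rightarrow>\<^sub>M (borel :: 'x measure)"
    using measurable_end_pair[OF n] by (simp_all add: measurable_cong_sets[OF \<Theta>_sets refl])
  have e3: "(\<lambda>z. (fst z n, snd z n)) \<in> \<Theta> \<rightarrow>\<^sub>M (borel \<Otimes>\<^sub>M borel :: ('x \<times> 'x) measure)"
    by (rule measurable_Pair[OF e1 e2])
  have w1: "(\<lambda>z. ennreal (u z - w z)) \<in> borel_measurable \<Theta>" "(\<lambda>z. ennreal (v z - w z)) \<in> borel_measurable \<Theta>"
    "(\<lambda>z. ennreal (w z)) \<in> borel_measurable \<Theta>"
    by measurable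
  \<comment> \<open>\<open>\<rho>\<close> and \<open>\<rho>'\<close> are the normalized leftovers
    and \<open>\<pi>'\<close> the normalized matched part. The measures \<open>\<mu>\<close> and
    \<open>\<pi>\<close>, passed last through \<open>b(1)\<close> and \<open>\<pi>_in\<close>, are
    default values for mass 0.\<close>
  obtain \<rho> where \<rho>: "\<rho> \<in> borel_probs"
    "\<And>g. g \<in> borel_measurable borel \<Longrightarrow> ennreal s * (\<integral>\<^sup>+x. g x \<partial>\<rho>) = (\<integral>\<^sup>+z. ennreal (u z - w z) * g (fst z n) \<partial>\<Theta>)"
    by (rule normalize_density[OF w1(1) e1 Iu s01(1) b(1)]) (rule that)
  obtain \<rho>' where \<rho>': "\<rho>' \<in> borel_probs"
    "\<And>g. g \<in> borel_measurable borel \<Longrightarrow> ennreal s * (\<integral>\<^sup>+x. g x \<partial>\<rho>') = (\<integral>\<^sup>+z. ennreal (v z - w z) * g (snd z n) \<partial>\<Theta>)"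
    by (rule normalize_density[OF w1(2) e2 Iv s01(1) b(1)]) (rule that)
  have s1: "0 \<le> 1 - s" using s01 by simp
  obtain \<pi>' where \<pi>': "\<pi>' \<in> space (prob_algebra (borel \<Otimes>\<^sub>M borel))"
    "\<And>g. g \<in> borel_measurable (borel \<Otimes>\<^sub>M borel) \<Longrightarrow>
      ennreal (1 - s) * (\<integral>\<^sup>+x. g x \<partial>\<pi>') = (\<integral>\<^sup>+z. ennreal (w z) * g (fst z n, snd z n) \<partial>\<Theta>)"
    by (rule normalize_density[OF w1(3) e3 Iw s1 \<pi>_in]) (rule that)
  have s\<pi>'[measurable_cong]: "sets \<pi>' = sets (borel \<Otimes>\<^sub>M borel)" using \<pi>' by (simp add: space_prob_algebra)
  have d1: "distr \<pi>' borel fst \<in> borel_probs" "distr \<pi>' borel snd \<in> borel_probs"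
    using \<pi>'(1) measurable_space[OF measurable_distr_prob_space[of fst "borel \<Otimes>\<^sub>M borel" "borel :: 'x measure"]]
      measurable_space[OF measurable_distr_prob_space[of snd "borel \<Otimes>\<^sub>M borel" "borel :: 'x measure"]] by auto
  have split: "(T ^^ n) \<eta> = mix s \<rho> (distr \<pi>' borel e)"
    if \<eta>: "\<eta> \<in> borel_probs" and \<rho>: "\<rho> \<in> borel_probs" and e[measurable]: "e \<in> borel \<Otimes>\<^sub>M borel \<rightarrow>\<^sub>M borel"
      and d: "distr \<pi>' borel e \<in> borel_probs" and [measurable]: "k \<in> borel_measurable \<Theta>" "q \<in> \<Theta> \<rightarrow>\<^sub>M borel"
      and k: "\<And>z. w z \<le> k z" and q: "\<And>z. q z = e (fst z n, snd z n)"
      and K: "\<And>g. g \<in> borel_measurable borel \<Longrightarrow> (\<integral>\<^sup>+z. ennreal (k z) * g (q z) \<partial>\<Theta>) = (\<integral>\<^sup>+y. g y \<partial>(T ^^ n) \<eta>)"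
      and R: "\<And>g. g \<in> borel_measurable borel \<Longrightarrow> ennreal s * (\<integral>\<^sup>+x. g x \<partial>\<rho>) = (\<integral>\<^sup>+z. ennreal (k z - w z) * g (q z) \<partial>\<Theta>)"
    for \<eta> \<rho> e k q
  proof (rule prob_algebra_eqI[where B = borel])
    fix A :: "'x set" assume [measurable]: "A \<in> sets borel"
    have "(\<integral>\<^sup>+x. indicator A x \<partial>mix s \<rho> (distr \<pi>' borel e))
      = ennreal s * (\<integral>\<^sup>+x. indicator A x \<partial>\<rho>) + ennreal (1 - s) * (\<integral>\<^sup>+x. indicator A x \<partial>distr \<pi>' borel e)"
      by (rule nn_integral_mix[OF \<rho> d _ s01]) measurable
    also have "(\<integral>\<^sup>+x. indicator A x \<partial>distr \<pi>' borel e) = (\<integral>\<^sup>+x. indicator A (e x) \<partial>\<pi>')"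
      by (rule nn_integral_distr) measurable
    also have "ennreal s * (\<integral>\<^sup>+x. indicator A x \<partial>\<rho>) + ennreal (1 - s) * (\<integral>\<^sup>+x. indicator A (e x) \<partial>\<pi>')
      = (\<integral>\<^sup>+z. ennreal (k z - w z) * indicator A (q z) \<partial>\<Theta>) + (\<integral>\<^sup>+z. ennreal (w z) * indicator A (q z) \<partial>\<Theta>)"
      by (subst R) (auto simp: \<pi>'(2) q)
    also have "\<dots> = (\<integral>\<^sup>+z. ennreal (k z - w z) * indicator A (q z) + ennreal (w z) * indicator A (q z) \<partial>\<Theta>)"
      by (rule nn_integral_add[symmetric]) measurable
    also have "\<dots> = (\<integral>\<^sup>+z. ennreal (k z) * indicator A (q z) \<partial>\<Theta>)"
      using k pos by (simp add: less_imp_le flip: distrib_right ennreal_plus)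
    also have "\<dots> = (\<integral>\<^sup>+x. indicator A x \<partial>(T ^^ n) \<eta>)" by (rule K) measurable
    finally show "(\<integral>\<^sup>+x. indicator A x \<partial>(T ^^ n) \<eta>) = (\<integral>\<^sup>+x. indicator A x \<partial>mix s \<rho> (distr \<pi>' borel e))" ..
  qed (auto intro!: Tn_in mix_in_prob_algebra \<eta> d \<rho>)
  have uv': "u \<in> borel_measurable \<Theta>" "v \<in> borel_measurable \<Theta>"
    using uv by (simp_all add: measurable_cong_sets[OF \<Theta>_sets refl])
  have mix1: "(T ^^ n) \<mu> = mix s \<rho> (distr \<pi>' borel fst)"
    by (rule split[OF b(1) \<rho>(1) measurable_fst d1(1) uv'(1) e1 pos(4) _ U \<rho>(2)]) simp
  have mix2: "(T ^^ n) \<nu> = mix s \<rho>' (distr \<pi>' borel snd)"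
    by (rule split[OF b(2) \<rho>'(1) measurable_snd d1(2) uv'(2) e2 pos(5) _ V \<rho>'(2)]) simp
  have cost': "ennreal ((1 - s) * cost \<pi>') \<le> (\<integral>\<^sup>+z. link_cost n (fst z) (snd z) \<partial>\<pi>)"
  proof -
    have [measurable]: "(\<lambda>z. \<omega> (dist (fst z n) (snd z n))) \<in> borel_measurable (path_pair_space n)"
      using measurable_compose[OF _ cost_measurable, of "\<lambda>z. (fst z n, snd z n)" "path_pair_space n"] by simp
    have "ennreal ((1 - s) * cost \<pi>') = ennreal (1 - s) * (\<integral>\<^sup>+z. ennreal (\<omega> (dist (fst z) (snd z))) \<partial>\<pi>')"
      using s1 \<pi>'(1) by (simp add: nn_integral_cost ennreal_mult')
    also have "\<dots> = (\<integral>\<^sup>+z. ennreal (w z) * ennreal (\<omega> (dist (fst z n) (snd z n))) \<partial>\<Theta>)"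
      by (subst \<pi>'(2)) auto
    \<comment> \<open>The decay rate concerns the weight of the first path, and
      \<open>w \<le> u\<close>.\<close>
    also have "\<dots> \<le> (\<integral>\<^sup>+z. ennreal (\<omega> (dist (fst z n) (snd z n)) * u z) \<partial>\<Theta>)"
      using pos by (intro nn_integral_mono)
        (auto simp: cost_nonneg mult.commute less_imp_le ennreal_mult[symmetric] intro!: ennreal_leI mult_left_mono mult_right_mono)
    also have "\<dots> = (\<integral>\<^sup>+z. link_cost n (fst z) (snd z) \<partial>\<pi>)"
      unfolding link_cost_def u_def[symmetric] u_def[symmetric, THEN fun_cong]
      by (rule int) measurable
    finally show ?thesis .
  qed
  have sle: "s \<le> (\<integral>z. 1 - exp (- C * \<omega> (dist (fst z) (snd z))) \<partial>\<pi>)"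
  proof -
    define \<kappa> where "\<kappa> = (\<lambda>z. 1 - exp (- C * \<omega> (dist (fst z) (snd (z :: 'x \<times> 'x)))))"
    have \<kappa>: "0 \<le> \<kappa> z" "\<kappa> z \<le> 1" for z using C_pos cost_nonneg by (auto simp: \<kappa>_def)
    have [measurable]: "\<kappa> \<in> borel_measurable (borel \<Otimes>\<^sub>M borel)" unfolding \<kappa>_def by measurable
    have "(\<integral>\<^sup>+q. ennreal (u q - w q) \<partial>Q n (fst z) (snd z)) \<le> ennreal (\<kappa> z)" for z
    proof -
      \<comment> \<open>Where flatness holds, \<open>v\<close> is at least
        \<open>u * (1 - \<kappa> z)\<close>, hence so is the minimum \<open>w\<close>. The leftover
        is at most the fraction \<open>\<kappa> z\<close> of \<open>u\<close>, and \<open>u\<close>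
        has integral 1 under \<open>Q\<close>.\<close>
      have "AE q in Q n (fst z) (snd z). ennreal (u q - w q) \<le> ennreal (\<kappa> z) * ennreal (u q)"
        using flat_Q[OF n, of "fst z" "snd z"]
      proof eventually_elim
        case (elim q)
        then have "birkhoff_sum f n (fst q) + (- C * \<omega> (dist (fst z) (snd z))) \<le> birkhoff_sum f n (snd q)" by linarith
        then have "u q * exp (- C * \<omega> (dist (fst z) (snd z))) \<le> v q"
          unfolding u_def v_def exp_add[symmetric] exp_le_cancel_iff .
        moreover have "u q * exp (- C * \<omega> (dist (fst z) (snd z))) \<le> u q * 1"
          using \<kappa>[of z] pos[of q] by (intro mult_left_mono) (auto simp: \<kappa>_def)
        ultimately have "u q * (1 - \<kappa> z) \<le> w q" by (simp add: \<kappa>_def w_def)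
        then have "u q - w q \<le> \<kappa> z * u q" by (simp add: algebra_simps)
        then show ?case using \<kappa>[of z] pos[of q] by (simp add: ennreal_mult'[symmetric] ennreal_leI)
      qed
      then have "(\<integral>\<^sup>+q. ennreal (u q - w q) \<partial>Q n (fst z) (snd z)) \<le>
          (\<integral>\<^sup>+q. ennreal (\<kappa> z) * ennreal (u q) \<partial>Q n (fst z) (snd z))"
        by (rule nn_integral_mono_AE)
      also have "\<dots> = ennreal (\<kappa> z) * (\<integral>\<^sup>+q. ennreal (u q) \<partial>Q n (fst z) (snd z))"
        by (rule nn_integral_cmult) measurable
      also have "(\<integral>\<^sup>+q. ennreal (u q) \<partial>Q n (fst z) (snd z)) = 1"
        unfolding u_def by (subst push[OF _ measurable_fst distr_Q(1)[OF n]]) (auto simp: path_law_normal)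
      finally show ?thesis by simp
    qed
    then have "ennreal s \<le> (\<integral>\<^sup>+z. ennreal (\<kappa> z) \<partial>\<pi>)"
      unfolding Iu[symmetric] by (subst int) (auto intro!: nn_integral_mono)
    also have "\<dots> = ennreal (\<integral>z. \<kappa> z \<partial>\<pi>)"
      by (rule nn_integral_eq_integral) (auto intro!: pi.integrable_const_bound[where B = 1] simp: \<kappa>)
    finally have "s \<le> (\<integral>z. \<kappa> z \<partial>\<pi>)"
      by (subst (asm) ennreal_le_iff) (auto intro!: integral_nonneg_AE simp: \<kappa>)
    then show ?thesis by (simp add: \<kappa>_def)
  qed
  show ?thesis
    by (rule that[OF s01 \<rho>(1) \<rho>'(1) \<pi>'(1) mix1 mix2 cost' sle])
qed

lemma integrable_cost_fun:
  assumes "\<pi> \<in> space (prob_algebra (borel \<Otimes>\<^sub>M borel))"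
  shows "integrable \<pi> (\<lambda>z. 1 - exp (- C * \<omega> (dist (fst z) (snd z :: 'x))))"
proof -
  interpret prob_space \<pi> using assms by (simp add: space_prob_algebra)
  have [measurable_cong]: "sets \<pi> = sets (borel \<Otimes>\<^sub>M borel)" using assms by (simp add: space_prob_algebra)
  show ?thesis
    using C_pos cost_nonneg by (intro integrable_const_bound[where B = 1]) (auto simp: mult_nonneg_nonneg)
qed

section \<open>Lipschitz bound and power decay\<close>

text \<open>The bound on the leftover mass is read in two ways: 1 - e^-t \<le> t makes it linear in
  the cost, for the Lipschitz bound, and monotonicity keeps it below a constant less than 1, for the
  contraction.\<close>

lemma coupling_step_bounds:
  assumes n: "1 \<le> n" and b: "\<mu> \<in> borel_probs" "\<nu> \<in> borel_probs" and \<pi>: "\<pi> \<in> couplings \<mu> \<nu>"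
  obtains s \<rho> \<rho>' \<sigma> \<sigma>' \<pi>' where "0 \<le> s" "s \<le> 1" "\<rho> \<in> borel_probs" "\<rho>' \<in> borel_probs"
    "\<sigma> \<in> borel_probs" "\<sigma>' \<in> borel_probs" "\<pi>' \<in> couplings \<sigma> \<sigma>'"
    "(T ^^ n) \<mu> = mix s \<rho> \<sigma>" "(T ^^ n) \<nu> = mix s \<rho>' \<sigma>'"
    "ennreal ((1 - s) * cost \<pi>') \<le> (\<integral>\<^sup>+z. link_cost n (fst z) (snd z) \<partial>\<pi>)"
    "s \<le> C * cost \<pi>" "s \<le> 1 - exp (- C * \<Omega>)"
proof -
  have \<pi>_in: "\<pi> \<in> space (prob_algebra (borel \<Otimes>\<^sub>M borel))" using \<pi> by (simp add: couplings_def)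
  interpret pi: prob_space \<pi> using \<pi>_in by (simp add: space_prob_algebra)
  obtain s \<rho> \<rho>' \<pi>' where *: "0 \<le> s" "s \<le> 1" "\<rho> \<in> borel_probs" "\<rho>' \<in> borel_probs"
    "\<pi>' \<in> space (prob_algebra (borel \<Otimes>\<^sub>M borel))"
    "(T ^^ n) \<mu> = mix s \<rho> (distr \<pi>' borel fst)" "(T ^^ n) \<nu> = mix s \<rho>' (distr \<pi>' borel snd)"
    "ennreal ((1 - s) * cost \<pi>') \<le> (\<integral>\<^sup>+z. link_cost n (fst z) (snd z) \<partial>\<pi>)"
    and s: "s \<le> (\<integral>z. 1 - exp (- C * \<omega> (dist (fst z) (snd z))) \<partial>\<pi>)"
    by (rule coupling_step[OF n b \<pi>]) (rule that)
  have 1: "distr \<pi>' borel fst \<in> borel_probs" "distr \<pi>' borel snd \<in> borel_probs"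
    using *(5) measurable_space[OF measurable_distr_prob_space[of fst "borel \<Otimes>\<^sub>M borel" "borel :: 'x measure"]]
      measurable_space[OF measurable_distr_prob_space[of snd "borel \<Otimes>\<^sub>M borel" "borel :: 'x measure"]] by auto
  have "(\<integral>z. 1 - exp (- C * \<omega> (dist (fst z) (snd z))) \<partial>\<pi>) \<le> (\<integral>z. C * \<omega> (dist (fst z) (snd z)) \<partial>\<pi>)"
    using exp_ge_add_one_self[of "- C * \<omega> (dist (fst z) (snd z))" for z]
    by (intro integral_mono integrable_cost_fun \<pi>_in integrable_mult_right integrable_cost)
       (auto simp: algebra_simps)
  also have "\<dots> = C * cost \<pi>" by (simp add: cost_def)
  finally have 2: "s \<le> C * cost \<pi>" using s by simp
  have "(\<integral>z. 1 - exp (- C * \<omega> (dist (fst z) (snd z))) \<partial>\<pi>) \<le> (\<integral>z. 1 - exp (- C * \<Omega>) \<partial>\<pi>)"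
    using cost_le C_pos by (intro integral_mono integrable_cost_fun \<pi>_in) auto
  then have 3: "s \<le> 1 - exp (- C * \<Omega>)" using s pi.prob_space by simp
  show ?thesis
    by (rule that[OF *(1-4) 1 _ *(6-8) 2 3]) (use *(5) in \<open>simp add: couplings_def\<close>)
qed

text \<open>The leftovers travel at most \<open>\<Omega>\<close> each and have mass at most
  \<open>C * cost \<pi>\<close>; the matched part costs at most
  \<open>K * cost \<pi>\<close>.\<close>

lemma W_lipschitz:
  assumes K: "0 \<le> K"
    "\<And>n x y. 1 \<le> n \<Longrightarrow> link_cost n x y \<le> ennreal (K * \<omega> (dist x y))"
    and b: "\<mu> \<in> borel_probs" "\<nu> \<in> borel_probs"
  shows "W ((T ^^ n) \<mu>) ((T ^^ n) \<nu>) \<le> (1 + \<Omega> * C + K) * W \<mu> \<nu>"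
proof (cases "n = 0")
  case True
  \<comment> \<open>The summand 1 in the constant covers the case of no step.\<close>
  have "1 * W \<mu> \<nu> \<le> (1 + \<Omega> * C + K) * W \<mu> \<nu>"
    using W_nonneg[OF b] K C_pos Omega_nonneg by (intro mult_right_mono) auto
  then show ?thesis using True by simp
next
  case False
  then have n: "1 \<le> n" by simp
  let ?L = "1 + \<Omega> * C + K"
  have L: "0 < ?L" using K C_pos Omega_nonneg by (simp add: add_pos_nonneg)
  \<comment> \<open>Division by \<open>?L\<close> turns the claim into a lower bound for the cost of
    every coupling, to which \<open>W_greatest\<close> applies.\<close>
  have "W ((T ^^ n) \<mu>) ((T ^^ n) \<nu>) / ?L \<le> W \<mu> \<nu>"
  proof (rule W_greatest[OF b])
    fix \<pi> assume \<pi>: "\<pi> \<in> couplings \<mu> \<nu>"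
    then have \<pi>_in: "\<pi> \<in> space (prob_algebra (borel \<Otimes>\<^sub>M borel))" by (simp add: couplings_def)
    then have [measurable_cong]: "sets \<pi> = sets (borel \<Otimes>\<^sub>M borel)" by (simp add: space_prob_algebra)
    obtain s \<rho> \<rho>' \<sigma> \<sigma>' \<pi>' where *: "0 \<le> s" "s \<le> 1" "\<rho> \<in> borel_probs" "\<rho>' \<in> borel_probs"
      "\<sigma> \<in> borel_probs" "\<sigma>' \<in> borel_probs" "\<pi>' \<in> couplings \<sigma> \<sigma>'"
      "(T ^^ n) \<mu> = mix s \<rho> \<sigma>" "(T ^^ n) \<nu> = mix s \<rho>' \<sigma>'"
      "ennreal ((1 - s) * cost \<pi>') \<le> (\<integral>\<^sup>+z. link_cost n (fst z) (snd z) \<partial>\<pi>)"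
      "s \<le> C * cost \<pi>" "s \<le> 1 - exp (- C * \<Omega>)"
      by (rule coupling_step_bounds[OF n b \<pi>]) (rule that)
    have "ennreal ((1 - s) * cost \<pi>') \<le> (\<integral>\<^sup>+z. ennreal (K * \<omega> (dist (fst z) (snd z))) \<partial>\<pi>)"
      using *(10) by (rule order_trans) (intro nn_integral_mono K n)
    also have "\<dots> = ennreal K * (\<integral>\<^sup>+z. ennreal (\<omega> (dist (fst z) (snd z))) \<partial>\<pi>)"
      using K by (subst nn_integral_cmult[symmetric]) (auto simp: ennreal_mult')
    also have "\<dots> = ennreal (K * cost \<pi>)"
      using K by (simp add: nn_integral_cost[OF \<pi>_in] ennreal_mult')
    finally have c: "(1 - s) * cost \<pi>' \<le> K * cost \<pi>"
      using K cost_nonneg' by (subst (asm) ennreal_le_iff) auto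
    have "W ((T ^^ n) \<mu>) ((T ^^ n) \<nu>) \<le> s * W \<rho> \<rho>' + (1 - s) * W \<sigma> \<sigma>'"
      unfolding *(8,9) by (rule W_mix[OF *(3,4,5,6,1,2)])
    also have "\<dots> \<le> s * \<Omega> + (1 - s) * cost \<pi>'"
      using * by (intro add_mono mult_left_mono W_le W_le_Omega) auto
    also have "\<dots> \<le> C * cost \<pi> * \<Omega> + K * cost \<pi>"
      using * c Omega_nonneg by (intro add_mono mult_right_mono) auto
    also have "\<dots> \<le> ?L * cost \<pi>" using cost_nonneg'[of \<pi>] by (simp add: algebra_simps)
    finally show "W ((T ^^ n) \<mu>) ((T ^^ n) \<nu>) / ?L \<le> cost \<pi>"
      using L by (simp add: pos_divide_le_eq mult.commute)
  qed
  then show ?thesis using L by (simp add: pos_divide_le_eq mult.commute)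
qed

text \<open>The supremum of the distance over all pairs of measures turns the decay into a statement
  on a sequence of numbers. Its recursion comes from performing the \<open>N\<close> matching steps
  first and the other \<open>n\<close> steps afterwards.\<close>

lemma W_power_decay:
  assumes K: "0 \<le> K"
    "\<And>n x y. 1 \<le> n \<Longrightarrow> link_cost n x y \<le> ennreal (K * \<omega> (dist x y))"
    and K': "0 \<le> K'" "0 < \<beta>"
    "\<And>n x y. 1 \<le> n \<Longrightarrow> link_cost n x y \<le> ennreal (K' * real n powr - \<beta>)"
  obtains A where "0 < A" "\<And>\<mu> \<nu> n. \<mu> \<in> borel_probs \<Longrightarrow> \<nu> \<in> borel_probs \<Longrightarrow> 1 \<le> n \<Longrightarrow>
    W ((T ^^ n) \<mu>) ((T ^^ n) \<nu>) \<le> A * real n powr - \<beta>"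
proof -
  define L where "L = 1 + \<Omega> * C + K"
  have L: "0 < L" using K C_pos Omega_nonneg by (simp add: L_def add_pos_nonneg)
  define p where "p = exp (- C * \<Omega>)"
  have p: "0 < p" "p \<le> 1" using C_pos Omega_nonneg by (auto simp: p_def)
  define B :: "('x measure \<times> 'x measure) set" where "B = borel_probs \<times> borel_probs"
  define a where "a n = (SUP (\<mu>, \<nu>)\<in>B. W ((T ^^ n) \<mu>) ((T ^^ n) \<nu>))" for n
  have "return borel undefined \<in> borel_probs" by (simp add: space_prob_algebra prob_space_return)
  then have ne: "B \<noteq> {}" by (auto simp: B_def)
  have a_upper: "W ((T ^^ n) \<mu>) ((T ^^ n) \<nu>) \<le> a n" if "\<mu> \<in> borel_probs" "\<nu> \<in> borel_probs" for n \<mu> \<nu>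
  proof -
    have "(case (\<mu>, \<nu>) of (\<mu>, \<nu>) \<Rightarrow> W ((T ^^ n) \<mu>) ((T ^^ n) \<nu>)) \<le> a n"
      unfolding a_def using that by (intro cSUP_upper) (auto intro!: bdd_aboveI[of _ \<Omega>] W_le_Omega Tn_in simp: B_def)
    then show ?thesis by simp
  qed
  have a_least: "a n \<le> c" if "\<And>\<mu> \<nu>. \<mu> \<in> borel_probs \<Longrightarrow> \<nu> \<in> borel_probs \<Longrightarrow> W ((T ^^ n) \<mu>) ((T ^^ n) \<nu>) \<le> c" for n c
    unfolding a_def using ne that by (intro cSUP_least) (auto simp: B_def)
  have a_nonneg: "0 \<le> a n" for n
  proof -
    obtain \<mu> \<nu> where "(\<mu>, \<nu>) \<in> B" using ne by auto
    then have "\<mu> \<in> borel_probs" "\<nu> \<in> borel_probs" by (auto simp: B_def)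
    then show ?thesis using order_trans[OF W_nonneg[OF Tn_in Tn_in] a_upper] by blast
  qed
  define M where "M = max \<Omega> (L * K')"
  have M: "0 \<le> M" using Omega_nonneg by (simp add: M_def)
  have aM: "a n \<le> M" for n by (rule a_least) (auto simp: M_def le_max_iff_disj intro!: W_le_Omega Tn_in)
  have rec: "a (n + N) \<le> M * real N powr - \<beta> + (1 - p) * a n" if N: "1 \<le> N" for n N
  proof (rule a_least)
    fix \<mu> \<nu> :: "'x measure" assume b: "\<mu> \<in> borel_probs" "\<nu> \<in> borel_probs"
    \<comment> \<open>Any coupling would do, because the bound with \<open>K'\<close> does not
      involve the distance of the starting points.\<close>
    let ?\<pi> = "\<mu> \<Otimes>\<^sub>M \<nu>"
    have \<pi>: "?\<pi> \<in> couplings \<mu> \<nu>" by (rule pair_measure_in_couplings[OF b])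
    then interpret pi: prob_space ?\<pi> by (simp add: couplings_def space_prob_algebra)
    obtain s \<rho> \<rho>' \<sigma> \<sigma>' \<pi>' where *: "0 \<le> s" "s \<le> 1" "\<rho> \<in> borel_probs" "\<rho>' \<in> borel_probs"
      "\<sigma> \<in> borel_probs" "\<sigma>' \<in> borel_probs" "\<pi>' \<in> couplings \<sigma> \<sigma>'"
      "(T ^^ N) \<mu> = mix s \<rho> \<sigma>" "(T ^^ N) \<nu> = mix s \<rho>' \<sigma>'"
      "ennreal ((1 - s) * cost \<pi>') \<le> (\<integral>\<^sup>+z. link_cost N (fst z) (snd z) \<partial>?\<pi>)"
      "s \<le> C * cost ?\<pi>" "s \<le> 1 - exp (- C * \<Omega>)"
      by (rule coupling_step_bounds[OF N b \<pi>]) (rule that)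
    then have sp: "s \<le> 1 - p" by (simp add: p_def)
    have "ennreal ((1 - s) * cost \<pi>') \<le> (\<integral>\<^sup>+z. ennreal (K' * real N powr - \<beta>) \<partial>?\<pi>)"
      using *(10) by (rule order_trans) (intro nn_integral_mono K' N)
    also have "\<dots> = ennreal (K' * real N powr - \<beta>)" by (simp add: pi.emeasure_space_1)
    finally have c: "(1 - s) * cost \<pi>' \<le> K' * real N powr - \<beta>"
      using K' by (subst (asm) ennreal_le_iff) auto
    have "W ((T ^^ (n + N)) \<mu>) ((T ^^ (n + N)) \<nu>) =
        W (mix s ((T ^^ n) \<rho>) ((T ^^ n) \<sigma>)) (mix s ((T ^^ n) \<rho>') ((T ^^ n) \<sigma>'))"
      using * by (simp add: funpow_add Tn_mix)
    also have "\<dots> \<le> s * W ((T ^^ n) \<rho>) ((T ^^ n) \<rho>') + (1 - s) * W ((T ^^ n) \<sigma>) ((T ^^ n) \<sigma>')"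
      using * by (intro W_mix Tn_in)
    \<comment> \<open>The leftovers can be any two measures, hence \<open>a n\<close>; the distance
      of the matched parts is expanded by the \<open>n\<close> further steps at most by the factor
      \<open>L\<close>.\<close>
    also have "\<dots> \<le> (1 - p) * a n + (1 - s) * (L * cost \<pi>')"
    proof (intro add_mono mult_mono mult_left_mono)
      have "W ((T ^^ n) \<sigma>) ((T ^^ n) \<sigma>') \<le> L * W \<sigma> \<sigma>'"
        unfolding L_def by (rule W_lipschitz[OF K *(5,6)])
      also have "\<dots> \<le> L * cost \<pi>'" using L *(7) by (intro mult_left_mono W_le) auto
      finally show "W ((T ^^ n) \<sigma>) ((T ^^ n) \<sigma>') \<le> L * cost \<pi>'" .
    qed (use * sp p a_upper W_nonneg[OF Tn_in[OF *(3)] Tn_in[OF *(4)]]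
        W_nonneg[OF Tn_in[OF *(5)] Tn_in[OF *(6)]] in auto)
    also have "(1 - s) * (L * cost \<pi>') = L * ((1 - s) * cost \<pi>')" by simp
    also have "\<dots> \<le> L * (K' * real N powr - \<beta>)" using c L by (intro mult_left_mono) auto
    also have "\<dots> \<le> M * real N powr - \<beta>"
      by (auto simp: M_def simp flip: mult.assoc intro!: mult_right_mono)
    finally show "W ((T ^^ (n + N)) \<mu>) ((T ^^ (n + N)) \<nu>) \<le> M * real N powr - \<beta> + (1 - p) * a n"
      by simp
  qed
  obtain A where A: "0 < A" "\<forall>a M. 0 \<le> M \<and> (\<forall>n. a n \<le> M) \<and>
       (\<forall>n. \<forall>N\<ge>1. a (n + N) \<le> M * real N powr - \<beta> + (1 - p) * a n) \<longrightarrow>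
       (\<forall>n\<ge>1. a n \<le> A * M * real n powr - \<beta>)"
    using power_decay_recursion[OF K'(2) p] by blast
  have A': "a n \<le> A * M * real n powr - \<beta>" if "1 \<le> n" for n
    using A(2)[rule_format, of M a n] M aM rec that by blast
  show ?thesis
  proof (rule that)
    show "0 < A * M + 1" using A(1) M by (simp add: add_nonneg_pos)
    fix \<mu> \<nu> :: "'x measure" and n :: nat
    assume "\<mu> \<in> borel_probs" "\<nu> \<in> borel_probs" "1 \<le> n"
    then have "W ((T ^^ n) \<mu>) ((T ^^ n) \<nu>) \<le> A * M * real n powr - \<beta>"
      using order_trans[OF a_upper A'] by blast
    also have "\<dots> \<le> (A * M + 1) * real n powr - \<beta>" by (intro mult_right_mono) auto
    finally show "W ((T ^^ n) \<mu>) ((T ^^ n) \<nu>) \<le> (A * M + 1) * real n powr - \<beta>" .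
  qed
qed

end

section \<open>Polynomial decay functions\<close>

text \<open>Two regimes. If \<open>n * r powr \<alpha>\<close> is at most 1, the base in the
  denominator is at most 2 and the linear bound suffices. Otherwise the base is at most
  \<open>2 * (n * r powr \<alpha>)\<close>, \<open>r\<close> cancels, and the power of
  \<open>n\<close> remains. Either way the loss is the factor 2^(1/\<alpha>) built into the
  constant.\<close>

lemma poly_rate_lower:
  assumes \<alpha>: "0 < \<alpha>" and r: "0 \<le> r" and G: "0 \<le> G" "w \<le> G * r" "1 \<le> n \<Longrightarrow> w \<le> G * real n powr - (1 / \<alpha>)"
  shows "w \<le> poly_rate \<alpha> (max 1 (G * 2 powr (1 / \<alpha>))) (1/2) n r"
proof -
  define B where "B = max 1 (G * 2 powr (1 / \<alpha>))"
  have B: "1 \<le> B" "G * 2 powr (1 / \<alpha>) \<le> B" by (auto simp: B_def)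
  then have GB: "G \<le> B / 2 powr (1 / \<alpha>)" by (simp add: field_simps)
  have pos: "0 < real n * r powr \<alpha> + 1/2" by (intro add_nonneg_pos mult_nonneg_nonneg) auto
  show ?thesis
  proof (cases "real n * r powr \<alpha> \<le> 1")
    case True
    have "w \<le> B / 2 powr (1 / \<alpha>) * r" using G(2) mult_right_mono[OF GB r] by linarith
    also have "\<dots> = B * r / 2 powr (1 / \<alpha>)" by simp
    also have "\<dots> \<le> B * r / (real n * r powr \<alpha> + 1/2) powr (1 / \<alpha>)"
      using B r True \<alpha> pos by (intro divide_left_mono powr_mono2 mult_nonneg_nonneg mult_pos_pos) auto
    finally show ?thesis by (simp add: poly_rate_def B_def)
  next
    case False
    then have n: "1 \<le> n" by (cases n) auto
    have r0: "0 < r" using r False by (cases "r = 0") auto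
    have "w \<le> B / 2 powr (1 / \<alpha>) * real n powr - (1 / \<alpha>)"
      using G(3)[OF n] mult_right_mono[OF GB powr_ge_zero, of "real n" "- (1 / \<alpha>)"] by linarith
    also have "\<dots> = B * r / (2 * (real n * r powr \<alpha>)) powr (1 / \<alpha>)"
      using r0 n \<alpha> by (simp add: powr_mult powr_powr powr_minus field_simps)
    also have "\<dots> \<le> B * r / (real n * r powr \<alpha> + 1/2) powr (1 / \<alpha>)"
      using B r0 n False \<alpha> pos by (intro divide_left_mono powr_mono2 mult_nonneg_nonneg mult_pos_pos) auto
    finally show ?thesis by (simp add: poly_rate_def B_def)
  qed
qed

text \<open>Dropping \<open>b\<close> from the denominator cancels \<open>r\<close>; a bound uniform
  in the distance remains.\<close>

lemma poly_rate_upper: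
  assumes \<alpha>: "0 < \<alpha>" and "0 < r" "1 \<le> n" "0 \<le> B" "0 < b"
  shows "poly_rate \<alpha> B b n r \<le> B * real n powr - (1 / \<alpha>)"
proof -
  have pos: "0 < real n * r powr \<alpha> + b" "0 < real n * r powr \<alpha>" using assms by (simp_all add: add_nonneg_pos)
  then have "real n * r powr \<alpha> + b \<noteq> 0" by linarith
  with pos have "poly_rate \<alpha> B b n r \<le> B * r / (real n * r powr \<alpha>) powr (1 / \<alpha>)"
    unfolding poly_rate_def using assms
    by (intro divide_left_mono powr_mono2 mult_nonneg_nonneg mult_pos_pos) (auto simp: add_nonneg_pos)
  also have "\<dots> = B * real n powr - (1 / \<alpha>)"
    using assms by (simp add: powr_mult powr_powr powr_minus field_simps)
  finally show ?thesis .
qed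

section \<open>Hoelder functions and their continuity\<close>

lemma C_omega_holder:
  fixes g :: "'a \<Rightarrow> real"
  assumes g: "g \<in> C_omega \<omega> d" and pos: "\<And>x y. x \<noteq> y \<Longrightarrow> 0 < \<omega> (d x y)" and zero: "\<And>x. \<omega> (d x x) = 0"
  shows "\<bar>g x - g y\<bar> \<le> enn2real (hol \<omega> d g) * \<omega> (d x y)"
proof (cases "x = y")
  case False
  have "ennreal (\<bar>g x - g y\<bar> / \<omega> (d x y)) \<le> hol \<omega> d g"
    unfolding hol_def using False by (intro SUP_upper2[of "(x, y)"]) auto
  also have "\<dots> = ennreal (enn2real (hol \<omega> d g))"
    using g by (simp add: C_omega_def ennreal_enn2real)
  finally have "\<bar>g x - g y\<bar> / \<omega> (d x y) \<le> enn2real (hol \<omega> d g)"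
    by (subst (asm) ennreal_le_iff) auto
  then show ?thesis using pos[OF False] by (simp add: pos_divide_le_eq)
qed (simp add: zero)

text \<open>Source of the Borel measurability of Hoelder functions. The function \<open>d\<close>
  only has to be continuous in its second argument for the given topology, so
  \<open>seq_dist\<close> is covered as well as \<open>dist\<close>.\<close>

lemma holder_continuous:
  fixes g :: "'a::topological_space \<Rightarrow> real"
  assumes g: "\<And>x y. \<bar>g x - g y\<bar> \<le> H * \<omega> (d x y)"
    and d: "\<And>x. continuous_on UNIV (\<lambda>y. d x y)" "\<And>x. d x x = 0" "\<And>x y. d x y \<in> S"
    and \<omega>: "continuous_on S \<omega>" "\<omega> 0 = 0"
  shows "continuous_on UNIV g"
  unfolding continuous_on
proof
  fix x
  have "continuous_on UNIV (\<lambda>y. H * \<omega> (d x y))"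
    using d by (intro continuous_intros continuous_on_compose2[OF \<omega>(1) d(1)]) auto
  then have "((\<lambda>y. H * \<omega> (d x y)) \<longlongrightarrow> H * \<omega> (d x x)) (at x)"
    by (simp add: continuous_on)
  then have "((\<lambda>y. H * \<omega> (d x y)) \<longlongrightarrow> 0) (at x)" by (simp add: d(2) \<omega>(2))
  then have "((\<lambda>y. g y - g x) \<longlongrightarrow> 0) (at x)"
    by (rule Lim_null_comparison[rotated]) (use g[of x] in \<open>simp add: abs_minus_commute\<close>)
  then show "(g \<longlongrightarrow> g x) (at x)" by (simp add: LIM_zero_iff)
qed

lemma wasserstein_decay:
  fixes m :: "'a::polish_space \<Rightarrow> 'a measure" and R :: ereal
  assumes bd: "bounded (UNIV :: 'a set)" and m: "transition_kernel m"
    and mod: "modulus_of_continuity_on {0..} \<omega>" and P: "kernel_coupling m P"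
    and f: "f \<in> C_omega \<omega> dist" and flat: "flat_potential \<omega> dist P f" and norm: "normalized m f"
    and F: "decay_function R F" and decay: "coupling_decay_rate \<omega> dist P f R F"
  shows "\<exists>C>0. \<forall>\<mu>\<in>borel_probs. \<forall>\<nu>\<in>borel_probs. \<forall>n.
         wasserstein \<omega> dist ((dual_op m f ^^ n) \<mu>) ((dual_op m f ^^ n) \<nu>)
           \<le> C * wasserstein \<omega> dist \<mu> \<nu>" (is ?lip)
    and "\<And>\<alpha>. 0 < \<alpha> \<Longrightarrow> polynomial_decay_function \<alpha> R F \<Longrightarrow> decays_polynomially \<omega> dist (dual_op m f) \<alpha>"
proof -
  have \<omega>_cont: "continuous_on {0..} \<omega>" and \<omega>_mono: "strict_mono_on {0..} \<omega>"
    and \<omega>_nonneg: "\<And>r. 0 \<le> r \<Longrightarrow> 0 \<le> \<omega> r" and \<omega>_0: "\<omega> 0 = 0"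
    using mod by (auto simp: modulus_of_continuity_on_def)
  have \<omega>_pos: "0 < \<omega> r" if "0 < r" for r
    using strict_mono_onD[OF \<omega>_mono, of 0 r] that \<omega>_0 by simp
  obtain D where D: "\<And>x y :: 'a. dist x y \<le> D"
    using bd by (metis UNIV_I bounded_two_points)
  obtain F0 where F0: "\<And>x. \<bar>f x\<bar> \<le> F0" using f by (auto simp: C_omega_def bounded_iff)
  obtain C where C: "0 < C" "\<And>n x y. 1 \<le> n \<Longrightarrow> AE z in P n x y.
        \<bar>birkhoff_sum f n (fst z) - birkhoff_sum f n (snd z)\<bar> \<le> C * \<omega> (dist x y)"
    using flat by (auto simp: flat_potential_def split_beta')
  have "continuous_on UNIV f"
    by (rule holder_continuous[OF C_omega_holder[OF f] _ _ _ \<omega>_cont \<omega>_0])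
      (auto simp: \<omega>_pos \<omega>_0 intro!: continuous_intros)
  then have fm: "f \<in> borel_measurable borel" by (rule borel_measurable_continuous_onI)
  have "continuous_on UNIV (\<lambda>z. \<omega> (dist (fst z) (snd z :: 'a)))"
    by (intro continuous_on_compose2[OF \<omega>_cont] continuous_intros) auto
  then have cm: "(\<lambda>z. \<omega> (dist (fst z) (snd z :: 'a))) \<in> borel_measurable (borel \<Otimes>\<^sub>M borel)"
    unfolding borel_prod by (rule borel_measurable_continuous_onI)
  \<comment> \<open>As \<open>\<omega>\<close> is increasing, the bound \<open>D\<close> for the
    diameter gives the bound \<open>\<omega> D\<close> for the cost.\<close>
  interpret coupled_kernel \<omega> "\<omega> D" m f P C F0
  proof (unfold_locales, goal_cases)
    case (3 x y)
    then show ?case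
      using D[of x y] strict_mono_on_leD[OF \<omega>_mono, of "dist x y" D] order_trans[OF zero_le_dist D[of x y]] by simp
  qed (use cm fm m P F0 norm \<omega>_0 C \<omega>_nonneg in auto)
  obtain Cd where Cd: "\<And>n x y. 1 \<le> n \<Longrightarrow> x \<noteq> y \<Longrightarrow>
        (\<integral>z. \<omega> (dist (fst z n) (snd z n)) * exp (birkhoff_sum f n (fst z)) \<partial>P n x y) \<le> Cd * F n (\<omega> (dist x y))"
    using decay unfolding coupling_decay_rate_def split_beta' by blast
  have R: "ereal (\<omega> (dist x y)) < R" for x y :: 'a
    using decay by (simp add: coupling_decay_rate_def)
  obtain CF where CF: "0 < CF" "\<And>n r. 0 < r \<Longrightarrow> ereal r < R \<Longrightarrow> F n r \<le> CF * r"
    and Fpos: "\<And>n r. 0 < r \<Longrightarrow> ereal r < R \<Longrightarrow> 0 < F n r"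
    using F by (auto simp: decay_function_def Let_def)
  \<comment> \<open>The bound on \<open>F\<close> is asked for off the diagonal only, where
    \<open>\<omega> (dist x y)\<close> lies in the domain of \<open>F\<close>; on the diagonal the
    link cost is 0.\<close>
  have link: "link_cost n x y \<le> ennreal (\<bar>Cd\<bar> * b)"
    if n: "1 \<le> n" and b: "x \<noteq> y \<Longrightarrow> F n (\<omega> (dist x y)) \<le> b" "0 \<le> b" for n x y b
  proof (cases "x = y")
    case True
    note [measurable] = measurable_end_pair[OF n]
    have [measurable]: "(\<lambda>z. \<omega> (dist (fst z n) (snd z n))) \<in> borel_measurable (path_pair_space n)"
      using measurable_compose[OF _ cost_measurable, of "\<lambda>z. (fst z n, snd z n)" "path_pair_space n"] by simp
    have "link_cost n x y = 0"
      unfolding link_cost_def Q_def True by (simp, subst nn_integral_distr) (auto simp: \<omega>_0)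
    then show ?thesis by simp
  next
    case False
    then have QP: "Q n x y = P n x y" by (simp add: Q_def)
    interpret PP: prob_space "P n x y" using Q_in[OF n, of x y] QP by (simp add: space_prob_algebra)
    have [measurable_cong]: "sets (P n x y) = sets (path_pair_space n)" using sets_Q[OF n, of x y] QP by simp
    note [measurable] = measurable_end_pair[OF n]
    have [measurable]: "(\<lambda>z. \<omega> (dist (fst z n) (snd z n))) \<in> borel_measurable (path_pair_space n)"
      using measurable_compose[OF _ cost_measurable, of "\<lambda>z. (fst z n, snd z n)" "path_pair_space n"] by simp
    have bs: "birkhoff_sum f n p \<le> real n * F0" for p
    proof -
      have "birkhoff_sum f n p \<le> (\<Sum>j=1..n. F0)"
        unfolding birkhoff_sum_def using F0 by (intro sum_mono) (metis abs_le_D1)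
      then show ?thesis by simp
    qed
    have "integrable (P n x y) (\<lambda>z. \<omega> (dist (fst z n) (snd z n)) * exp (birkhoff_sum f n (fst z)))"
      by (rule PP.integrable_const_bound[where B = "\<omega> D * exp (real n * F0)"])
        (auto intro!: AE_I2 mult_mono simp: abs_mult cost_nonneg cost_le Omega_nonneg bs)
    then have "link_cost n x y = ennreal (\<integral>z. \<omega> (dist (fst z n) (snd z n)) * exp (birkhoff_sum f n (fst z)) \<partial>P n x y)"
      unfolding link_cost_def QP by (rule nn_integral_eq_integral) (simp add: cost_nonneg)
    also have "\<dots> \<le> ennreal (\<bar>Cd\<bar> * b)"
    proof (rule ennreal_leI)
      have "(\<integral>z. \<omega> (dist (fst z n) (snd z n)) * exp (birkhoff_sum f n (fst z)) \<partial>P n x y) \<le> Cd * F n (\<omega> (dist x y))"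
        by (rule Cd[OF n False])
      \<comment> \<open>The sign of \<open>Cd\<close> is unknown; the absolute value may replace it
        because \<open>F\<close> is positive.\<close>
      also have "\<dots> \<le> \<bar>Cd\<bar> * F n (\<omega> (dist x y))"
        using Fpos[of "\<omega> (dist x y)" n] False R \<omega>_pos[of "dist x y"] by (intro mult_right_mono) auto
      also have "\<dots> \<le> \<bar>Cd\<bar> * b" using b(1)[OF False] by (rule mult_left_mono) simp
      finally show "(\<integral>z. \<omega> (dist (fst z n) (snd z n)) * exp (birkhoff_sum f n (fst z)) \<partial>P n x y) \<le> \<bar>Cd\<bar> * b" .
    qed
    finally show ?thesis .
  qed
  define K where "K = \<bar>Cd\<bar> * CF"
  have K: "0 \<le> K" using CF by (simp add: K_def)
  have linkK: "link_cost n x y \<le> ennreal (K * \<omega> (dist x y))" if "1 \<le> n" for n x y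
    using link[OF that, of x y "CF * \<omega> (dist x y)"] CF R \<omega>_pos cost_nonneg by (simp add: K_def mult.assoc)
  define L where "L = 1 + \<omega> D * C + K"
  have L: "0 < L" using K C_pos Omega_nonneg by (simp add: L_def add_pos_nonneg)
  have lip: "W ((T ^^ n) \<mu>) ((T ^^ n) \<nu>) \<le> L * W \<mu> \<nu>"
    if "\<mu> \<in> borel_probs" "\<nu> \<in> borel_probs" for \<mu> \<nu> n
    unfolding L_def by (rule W_lipschitz[OF K linkK that])
  show ?lip using L lip by blast
  fix \<alpha> :: real assume \<alpha>: "0 < \<alpha>" and pF: "polynomial_decay_function \<alpha> R F"
  obtain B b where B: "1 \<le> B" "0 < b" "\<And>n r. 0 < r \<Longrightarrow> ereal r < R \<Longrightarrow> F n r = poly_rate \<alpha> B b n r"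
    using pF by (auto simp: polynomial_decay_function_def)
  have linkN: "link_cost n x y \<le> ennreal (\<bar>Cd\<bar> * B * real n powr - (1 / \<alpha>))" if n: "1 \<le> n" for n x y
  proof -
    have "F n (\<omega> (dist x y)) \<le> B * real n powr - (1 / \<alpha>)" if "x \<noteq> y"
      using that R[of x y] \<omega>_pos[of "dist x y"] B \<alpha> n by (simp add: poly_rate_upper)
    from link[OF n this] B show ?thesis by (simp add: mult.assoc)
  qed
  have nn: "0 \<le> \<bar>Cd\<bar> * B" "0 < 1 / \<alpha>" using B \<alpha> by auto
  obtain A where A: "0 < A" "\<And>\<mu> \<nu> n. \<mu> \<in> borel_probs \<Longrightarrow> \<nu> \<in> borel_probs \<Longrightarrow> 1 \<le> n \<Longrightarrow>
      W ((T ^^ n) \<mu>) ((T ^^ n) \<nu>) \<le> A * real n powr - (1 / \<alpha>)"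
    by (rule W_power_decay[OF K linkK nn linkN]) (assumption+, rule that)
  \<comment> \<open>One constant for both the linear and the power bound, as
    \<open>poly_rate_lower\<close> expects.\<close>
  define G where "G = max L A"
  have G: "0 \<le> G" using L by (simp add: G_def)
  have "operator_decay_rate \<omega> dist T (poly_rate \<alpha> (max 1 (G * 2 powr (1 / \<alpha>))) (1/2))"
    unfolding operator_decay_rate_def
  proof (intro allI ballI)
    fix n and \<mu> \<nu> :: "'a measure" assume b: "\<mu> \<in> borel_probs" "\<nu> \<in> borel_probs"
    show "W ((T ^^ n) \<mu>) ((T ^^ n) \<nu>) \<le> poly_rate \<alpha> (max 1 (G * 2 powr (1 / \<alpha>))) (1/2) n (W \<mu> \<nu>)"
    proof (rule poly_rate_lower[OF \<alpha> W_nonneg[OF b] G])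
      show "W ((T ^^ n) \<mu>) ((T ^^ n) \<nu>) \<le> G * W \<mu> \<nu>"
        using lip[OF b, of n] mult_right_mono[of L G "W \<mu> \<nu>"] W_nonneg[OF b] by (simp add: G_def)
      show "W ((T ^^ n) \<mu>) ((T ^^ n) \<nu>) \<le> G * real n powr - (1 / \<alpha>)" if "1 \<le> n"
        using A(2)[OF b that] mult_right_mono[of A G "real n powr - (1 / \<alpha>)"] by (simp add: G_def)
    qed
  qed
  then show "decays_polynomially \<omega> dist T \<alpha>"
    unfolding decays_polynomially_def
    by (intro exI[of _ "max 1 (G * 2 powr (1 / \<alpha>))"] conjI bexI[of _ "1/2"]) auto
qed

section \<open>The metric on sequences\<close>

lemma seq_dist_summable: "summable (\<lambda>i. (1/2) ^ Suc i * min (dist (x i) (y i)) (1::real))"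
proof (rule summable_comparison_test')
  show "summable (\<lambda>i. (1/2::real) ^ Suc i)" using summable_mult[OF summable_geometric[of "1/2::real"], of "1/2"] by simp
  show "norm ((1/2) ^ Suc i * min (dist (x i) (y i)) (1::real)) \<le> (1/2) ^ Suc i" for i
    using mult_left_mono[of "min (dist (x i) (y i)) (1::real)" 1 "(1/2) ^ Suc i"] by (simp add: abs_mult)
qed

lemma seq_dist_nonneg: "0 \<le> seq_dist x y"
  unfolding seq_dist_def by (intro suminf_nonneg seq_dist_summable) auto

lemma seq_dist_refl[simp]: "seq_dist x x = 0"
  by (simp add: seq_dist_def)

lemma seq_dist_le_1: "seq_dist x y \<le> 1"
proof -
  have "seq_dist x y \<le> (\<Sum>i. (1/2) ^ Suc i)"
    unfolding seq_dist_def
    by (intro suminf_le seq_dist_summable sums_summable[OF power_half_series]) (auto simp: mult_le_cancel_left2)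
  also have "\<dots> = 1" by (rule sums_unique[OF power_half_series, symmetric])
  finally show ?thesis .
qed

lemma seq_dist_pos:
  assumes "x \<noteq> y"
  shows "0 < seq_dist x y"
proof -
  obtain i where "x i \<noteq> y i" using assms by auto
  then show ?thesis
    unfolding seq_dist_def by (intro suminf_pos2[OF seq_dist_summable, where i = i]) auto
qed

text \<open>The new first coordinates agree, and all other terms of the series move one place and
  pick up a factor 1/2. This is the contraction behind all estimates for the shift.\<close>

lemma seq_dist_case_nat: "seq_dist (case_nat a x) (case_nat a y) = seq_dist x y / 2"
  unfolding seq_dist_def
  using suminf_split_initial_segment[OF seq_dist_summable[of "case_nat a x" "case_nat a y"], of 1]
    suminf_mult[OF seq_dist_summable[of x y], of "1/2"]
  by (simp add: mult.assoc)

text \<open>Uniform limit of partial sums, each continuous in finitely many coordinates. This ties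
  the metric to the product topology and so to the Borel sets.\<close>

lemma continuous_on_seq_dist:
  fixes x :: "nat \<Rightarrow> 'e::metric_space"
  shows "continuous_on UNIV (seq_dist x)"
proof -
  have "uniform_limit UNIV (\<lambda>n y. \<Sum>i<n. (1/2) ^ Suc i * min (dist (x i) (y i)) (1::real)) (seq_dist x) sequentially"
    unfolding seq_dist_def[abs_def]
    by (rule Weierstrass_m_test[OF _ sums_summable[OF power_half_series]]) (auto simp: abs_mult mult_le_cancel_left2)
  then show ?thesis
    by (rule uniform_limit_theorem[rotated])
      (auto intro!: always_eventually continuous_intros continuous_on_product_coordinates)
qed

section \<open>Words and sequences\<close>

text \<open>Letters are numbered from 1 and the one drawn last, \<open>w n\<close>, stands first.
  Passing to \<open>Suc n\<close> therefore prepends a letter, and \<open>cat j w x\<close> is the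
  \<open>j\<close>-th component of the path in the natural coupling.\<close>

definition cat :: "nat \<Rightarrow> (nat \<Rightarrow> 'e) \<Rightarrow> (nat \<Rightarrow> 'e) \<Rightarrow> nat \<Rightarrow> 'e" where
  "cat n w x = (\<lambda>i. if i < n then w (n - i) else x (i - n))"

lemma cat_0[simp]: "cat 0 w x = x"
  by (simp add: cat_def)

lemma cat_Suc: "cat (Suc n) w x = case_nat (w (Suc n)) (cat n w x)"
  by (auto simp: cat_def fun_eq_iff split: nat.split)

lemma cat_upd[simp]: "cat n (w(Suc n := a)) x = cat n w x"
  by (auto simp: cat_def fun_eq_iff)

lemma word_path_eq: "j \<in> {1..n} \<Longrightarrow> word_path n w x j = cat j w x"
  by (auto simp: word_path_def cat_def)

lemma seq_dist_cat: "seq_dist (cat n w x) (cat n w y) = seq_dist x y / 2 ^ n"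
  by (induction n) (auto simp: cat_Suc seq_dist_case_nat)

lemma measurable_case_nat[measurable (raw)]:
  fixes h :: "'a \<Rightarrow> nat \<Rightarrow> 'e::polish_space"
  assumes "g \<in> M \<rightarrow>\<^sub>M borel" "h \<in> M \<rightarrow>\<^sub>M borel"
  shows "(\<lambda>z. case_nat (g z) (h z)) \<in> M \<rightarrow>\<^sub>M borel"
proof (rule measurable_coordinatewise_then_product)
  fix i
  have "(\<lambda>z. h z k) \<in> M \<rightarrow>\<^sub>M borel" for k
    using measurable_compose[OF assms(2) borel_measurable_continuous_onI[OF continuous_on_product_coordinates]] .
  then show "(\<lambda>z. case_nat (g z) (h z) i) \<in> M \<rightarrow>\<^sub>M borel"
    using assms(1) by (cases i) auto
qed

section \<open>Weighted averages\<close>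

text \<open>The part of one density that exceeds the other has mass at most 1 - e^-c and feels at
  most the oscillation \<open>D\<close> of the integrand; changing the integrand from
  \<open>b\<close> to \<open>a\<close> costs \<open>\<delta>\<close>.\<close>

lemma weighted_average_diff:
  fixes u v a b :: "'a \<Rightarrow> real"
  assumes u: "integrable M u" "(\<integral>w. u w \<partial>M) = 1" "\<And>w. 0 \<le> u w"
    and v: "integrable M v" "(\<integral>w. v w \<partial>M) = 1" "\<And>w. 0 \<le> v w"
    and uv: "AE w in M. u w \<le> exp c * v w" "AE w in M. v w \<le> exp c * u w" "0 \<le> c"
    and ab[measurable]: "a \<in> borel_measurable M" "b \<in> borel_measurable M"
    and bd: "\<And>w. \<bar>a w\<bar> \<le> B" "\<And>w. \<bar>b w\<bar> \<le> B"
    and \<delta>: "\<And>w. \<bar>a w - b w\<bar> \<le> \<delta>" and D: "\<And>w w'. \<bar>b w - b w'\<bar> \<le> D"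
  shows "\<bar>(\<integral>w. u w * a w \<partial>M) - (\<integral>w. v w * b w \<partial>M)\<bar> \<le> \<delta> + (1 - exp (- c)) * D"
proof -
  \<comment> \<open>Subtracting the infimum does not change the difference of two averages and makes
    the integrand nonnegative, so that it can multiply the one-sided comparison of the
    weights.\<close>
  define \<beta> where "\<beta> = (INF w. b w)"
  have below: "bdd_below (range b)" 
  proof (rule bdd_belowI[of _ "- B"])
    fix z assume "z \<in> range b"
    then show "- B \<le> z" using bd(2) by (auto simp: abs_le_iff) (metis minus_le_iff)
  qed
  have \<beta>: "0 \<le> b w - \<beta>" for w using cINF_lower[OF below, of w] by (simp add: \<beta>_def)
  have \<beta>': "b w - \<beta> \<le> D" for w
  proof -
    have "b w - D \<le> \<beta>" unfolding \<beta>_def using D[of w] by (intro cINF_greatest) (auto simp: abs_le_iff algebra_simps)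
    then show ?thesis by simp
  qed
  have D0: "0 \<le> D" using D[of undefined undefined] by simp
  have [measurable]: "u \<in> borel_measurable M" "v \<in> borel_measurable M" using u v by auto
  have int: "integrable M (\<lambda>w. k w * h w)" if "integrable M k" "h \<in> borel_measurable M" "\<And>w. \<bar>h w\<bar> \<le> B'"
    for k h :: "'a \<Rightarrow> real" and B'
  proof (rule Bochner_Integration.integrable_bound[of M "\<lambda>w. B' * k w"])
    show "AE w in M. norm (k w * h w) \<le> norm (B' * k w)"
    proof (rule AE_I2)
      fix w
      have "\<bar>k w\<bar> * \<bar>h w\<bar> \<le> \<bar>k w\<bar> * \<bar>B'\<bar>" using that(3)[of w] by (intro mult_left_mono) auto
      then show "norm (k w * h w) \<le> norm (B' * k w)" by (simp add: abs_mult mult.commute)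
    qed
  qed (use that in auto)
  have b\<beta>: "\<bar>b w - \<beta>\<bar> \<le> D" for w using \<beta>[of w] \<beta>'[of w] by simp
  have one: "(\<integral>w. k w * (b w - \<beta>) \<partial>M) - (\<integral>w. l w * (b w - \<beta>) \<partial>M) \<le> (1 - exp (- c)) * D"
    if k: "integrable M k" "(\<integral>w. k w \<partial>M) = 1" "\<And>w. 0 \<le> k w" and l: "integrable M l"
      and kl: "AE w in M. k w \<le> exp c * l w" for k l :: "'a \<Rightarrow> real"
  proof -
    have [measurable]: "k \<in> borel_measurable M" "l \<in> borel_measurable M" using k l by auto
    have i: "integrable M (\<lambda>w. k w * (b w - \<beta>))" "integrable M (\<lambda>w. l w * (b w - \<beta>))"
      by (rule int[OF k(1) _ b\<beta>], measurable) (rule int[OF l(1) _ b\<beta>], measurable)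
    have "(\<integral>w. k w * (b w - \<beta>) \<partial>M) - (\<integral>w. l w * (b w - \<beta>) \<partial>M) = (\<integral>w. (k w - l w) * (b w - \<beta>) \<partial>M)"
      using Bochner_Integration.integral_diff[OF i] by (simp only: left_diff_distrib)
    also have "\<dots> \<le> (\<integral>w. (1 - exp (- c)) * D * k w \<partial>M)"
    proof (rule integral_mono_AE)
      show "integrable M (\<lambda>w. (k w - l w) * (b w - \<beta>))"
        by (intro int[OF _ _ b\<beta>] Bochner_Integration.integrable_diff k l) measurable
      show "integrable M (\<lambda>w. (1 - exp (- c)) * D * k w)" using k by simp
      show "AE w in M. (k w - l w) * (b w - \<beta>) \<le> (1 - exp (- c)) * D * k w"
        using kl
      proof eventually_elim
        case (elim w)
        have "exp (- c) * k w \<le> exp (- c) * (exp c * l w)" using elim by (intro mult_left_mono) auto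
        moreover have "exp (- c) * (exp c * l w) = l w" by (simp add: exp_minus)
        ultimately have "k w - l w \<le> (1 - exp (- c)) * k w" unfolding left_diff_distrib by linarith
        then have "(k w - l w) * (b w - \<beta>) \<le> (1 - exp (- c)) * k w * (b w - \<beta>)"
          by (intro mult_right_mono \<beta>)
        also have "\<dots> \<le> (1 - exp (- c)) * k w * D" using k(3) uv(3) by (intro mult_left_mono \<beta>') auto
        finally show ?case by (simp add: algebra_simps)
      qed
    qed
    finally show ?thesis using k by simp
  qed
  have split: "(\<integral>w. k w * (b w - \<beta>) \<partial>M) = (\<integral>w. k w * b w \<partial>M) - \<beta>" if "integrable M k" "(\<integral>w. k w \<partial>M) = 1" for k
    using int[OF that(1) ab(2) bd(2)] that by (simp add: right_diff_distrib)
  have "\<bar>(\<integral>w. u w * b w \<partial>M) - (\<integral>w. v w * b w \<partial>M)\<bar> \<le> (1 - exp (- c)) * D"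
    using one[OF u v(1) uv(1)] one[OF v u(1) uv(2)] by (simp add: split u v abs_le_iff)
  moreover have "\<bar>(\<integral>w. u w * a w \<partial>M) - (\<integral>w. u w * b w \<partial>M)\<bar> \<le> \<delta>"
  proof -
    have "\<bar>(\<integral>w. u w * a w \<partial>M) - (\<integral>w. u w * b w \<partial>M)\<bar> = \<bar>\<integral>w. u w * (a w - b w) \<partial>M\<bar>"
      using Bochner_Integration.integral_diff[OF int[OF u(1) ab(1) bd(1)] int[OF u(1) ab(2) bd(2)]]
      by (simp only: right_diff_distrib)
    also have "\<dots> \<le> (\<integral>w. \<bar>u w * (a w - b w)\<bar> \<partial>M)" by (rule integral_abs_bound)
    also have "\<dots> \<le> (\<integral>w. \<delta> * u w \<partial>M)"
      using u \<delta> by (intro integral_mono integrable_abs int[OF u(1) _ \<delta>])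
        (auto simp: abs_mult mult.commute[of \<delta>] intro!: mult_left_mono)
    also have "\<dots> = \<delta>" using u by simp
    finally show ?thesis .
  qed
  ultimately show ?thesis by linarith
qed

section \<open>The transfer operator of the shift\<close>

definition bounded_by :: "real \<Rightarrow> ('a::topological_space \<Rightarrow> real) \<Rightarrow> bool" where
  "bounded_by B \<phi> \<longleftrightarrow> \<phi> \<in> borel_measurable borel \<and> (\<forall>x. \<bar>\<phi> x\<bar> \<le> B)"

lemma bounded_byD: "bounded_by B \<phi> \<Longrightarrow> \<phi> \<in> borel_measurable borel" "bounded_by B \<phi> \<Longrightarrow> \<bar>\<phi> x\<bar> \<le> B"
  by (auto simp: bounded_by_def)

lemma bounded_by_nonneg: "bounded_by B \<phi> \<Longrightarrow> 0 \<le> B"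
  using bounded_byD(2)[of B \<phi> undefined] by simp

text \<open>The logarithmic form of the modulus enters through \<open>omega_decay\<close> alone:
  \<open>n\<close> prepended letters shrink the distance by the factor 2^n, and the modulus turns
  this into n^-\<epsilon>.\<close>

locale shift_potential =
  fixes \<mu> :: "'e::polish_space measure" and \<omega> :: "real \<Rightarrow> real" and f :: "(nat \<Rightarrow> 'e) \<Rightarrow> real"
    and C F0 Hf K\<omega> \<epsilon> :: real
  assumes mu: "\<mu> \<in> borel_probs"
    and omega_cont: "continuous_on {0..1} \<omega>"
    and omega_0: "\<omega> 0 = 0"
    and omega_mono: "0 \<le> r \<Longrightarrow> r \<le> s \<Longrightarrow> s \<le> 1 \<Longrightarrow> \<omega> r \<le> \<omega> s"
    and eps: "0 < \<epsilon>"
    and omega_decay: "0 \<le> r \<Longrightarrow> r \<le> 1 \<Longrightarrow> 1 \<le> n \<Longrightarrow> \<omega> (r / 2 ^ n) \<le> K\<omega> * real n powr - \<epsilon>"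
    and f_holder: "\<bar>f x - f y\<bar> \<le> Hf * \<omega> (seq_dist x y)"
    and f_bound: "\<bar>f x\<bar> \<le> F0"
    and C_pos: "0 < C"
    and flat: "1 \<le> n \<Longrightarrow> AE z in natural_coupling \<mu> n x y.
        \<bar>birkhoff_sum f n (fst z) - birkhoff_sum f n (snd z)\<bar> \<le> C * \<omega> (seq_dist x y)"
begin

abbreviation "\<Omega> \<equiv> \<omega> 1"

lemma omega_nonneg: "0 \<le> \<omega> (seq_dist x y)"
  using omega_mono[of 0 "seq_dist x y"] omega_0 seq_dist_nonneg[of x y] seq_dist_le_1[of x y] by simp

lemma omega_le: "\<omega> (seq_dist x y) \<le> \<Omega>"
  using omega_mono[of "seq_dist x y" 1] seq_dist_nonneg[of x y] seq_dist_le_1[of x y] by simp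

lemma Omega_nonneg: "0 \<le> \<Omega>"
  using omega_mono[of 0 1] omega_0 by simp

lemma omega_cat_le: "\<omega> (seq_dist (cat n w x) (cat n w y)) \<le> \<omega> (seq_dist x y)"
proof -
  have "seq_dist x y / 2 ^ n \<le> seq_dist x y / 1"
    using seq_dist_nonneg[of x y] by (intro divide_left_mono) auto
  then show ?thesis
    unfolding seq_dist_cat using seq_dist_nonneg[of x y] seq_dist_le_1[of x y] by (intro omega_mono) auto
qed

lemma omega_cat_decay: "1 \<le> n \<Longrightarrow> \<omega> (seq_dist (cat n w x) (cat n w y)) \<le> K\<omega> * real n powr - \<epsilon>"
  unfolding seq_dist_cat using seq_dist_nonneg[of x y] seq_dist_le_1[of x y] by (rule omega_decay)

lemma K\<omega>_nonneg: "0 \<le> K\<omega>"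
  using order_trans[OF omega_nonneg omega_cat_decay[of 1 undefined undefined undefined]] by simp

lemma C_omega_nonneg: "0 \<le> C * \<omega> (seq_dist x y)"
  by (rule mult_nonneg_nonneg[OF less_imp_le[OF C_pos] omega_nonneg])

lemma holder_measurable:
  assumes "\<And>x y. \<bar>g x - g y\<bar> \<le> H * \<omega> (seq_dist x y)"
  shows "g \<in> borel_measurable borel"
proof (rule borel_measurable_continuous_onI)
  show "continuous_on UNIV g"
    by (rule holder_continuous[OF assms _ _ _ omega_cont omega_0])
      (auto simp: seq_dist_nonneg seq_dist_le_1 intro: continuous_on_seq_dist)
qed

lemma f_measurable[measurable]: "f \<in> borel_measurable borel"
  by (rule holder_measurable[OF f_holder])

lemma sets_mu[measurable_cong, simp]: "sets \<mu> = sets borel"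
  using mu by (simp add: space_prob_algebra)

lemma space_mu[simp]: "space \<mu> = UNIV"
  using sets_eq_imp_space_eq[OF sets_mu] by simp

sublocale mu: prob_space \<mu>
  using mu by (simp add: space_prob_algebra)

sublocale prod: product_prob_space "\<lambda>_::nat. \<mu>" UNIV
  by unfold_locales

abbreviation Mw :: "nat \<Rightarrow> (nat \<Rightarrow> 'e) measure" where
  "Mw n \<equiv> Pi\<^sub>M {Suc 0..n} (\<lambda>_. \<mu>)"

sublocale Mw: prob_space "Mw n" for n
  by (rule prob_space_PiM) (rule mu.prob_space_axioms)

lemma measurable_cat[measurable (raw)]:
  assumes W: "g \<in> N \<rightarrow>\<^sub>M Mw n" and h: "h \<in> N \<rightarrow>\<^sub>M borel"
  shows "(\<lambda>z. cat n (g z) (h z)) \<in> N \<rightarrow>\<^sub>M borel"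
proof (rule measurable_coordinatewise_then_product)
  fix i
  show "(\<lambda>z. cat n (g z) (h z) i) \<in> N \<rightarrow>\<^sub>M borel"
  proof (cases "i < n")
    case True
    then have "(\<lambda>w. w (n - i)) \<in> Mw n \<rightarrow>\<^sub>M \<mu>" by (intro measurable_component_singleton) auto
    from measurable_compose[OF W this] show ?thesis using True
      by (simp add: cat_def measurable_cong_sets[OF refl sets_mu])
  next
    case False
    then show ?thesis
      using measurable_compose[OF h borel_measurable_continuous_onI[OF continuous_on_product_coordinates]]
      by (simp add: cat_def)
  qed
qed

section \<open>Birkhoff sums over words and the iterated operator\<close>

definition S :: "nat \<Rightarrow> (nat \<Rightarrow> 'e) \<Rightarrow> (nat \<Rightarrow> 'e) \<Rightarrow> real" where
  "S n w x = (\<Sum>j=1..n. f (cat j w x))"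

lemma S_0[simp]: "S 0 w x = 0"
  by (simp add: S_def)

lemma S_eq: "S n w x = birkhoff_sum f n (word_path n w x)"
  unfolding S_def birkhoff_sum_def by (intro sum.cong) (auto simp: word_path_eq)

lemma S_upd: "S (Suc n) (w(Suc n := a)) x = S n w x + f (case_nat a (cat n w x))"
proof -
  have "cat j (w(Suc n := a)) x = cat j w x" if "j \<le> n" for j
    using that by (auto simp: cat_def fun_eq_iff)
  then show ?thesis by (auto simp: S_def cat_Suc intro!: sum.cong)
qed

lemma S_bound: "\<bar>S n w x\<bar> \<le> real n * F0"
proof -
  have "\<bar>S n w x\<bar> \<le> (\<Sum>j=1..n. F0)"
    unfolding S_def using f_bound by (intro order_trans[OF sum_abs] sum_mono) auto
  then show ?thesis by simp
qed

lemma measurable_S[measurable (raw)]: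
  assumes W: "g \<in> N \<rightarrow>\<^sub>M Mw n" and h: "h \<in> N \<rightarrow>\<^sub>M borel"
  shows "(\<lambda>z. S n (g z) (h z)) \<in> borel_measurable N"
  unfolding S_def
proof (intro borel_measurable_sum measurable_compose[OF _ f_measurable])
  fix j assume j: "j \<in> {1..n}"
  \<comment> \<open>\<open>Mw j\<close> lives on functions extensional outside its index set, so a
    longer word is first cut down to the \<open>j\<close> letters that are read.\<close>
  have "(\<lambda>w. restrict w {Suc 0..j}) \<in> Mw n \<rightarrow>\<^sub>M Mw j"
    using j by (intro measurable_restrict_subset) auto
  from measurable_cat[OF measurable_compose[OF W this] h]
  have "(\<lambda>z. cat j (restrict (g z) {Suc 0..j}) (h z)) \<in> N \<rightarrow>\<^sub>M borel" .
  moreover have "cat j (restrict w {Suc 0..j}) x = cat j w x" for w x :: "nat \<Rightarrow> 'e"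
    by (auto simp: cat_def fun_eq_iff)
  ultimately show "(\<lambda>z. cat j (g z) (h z)) \<in> N \<rightarrow>\<^sub>M borel" by simp
qed

text \<open>The natural coupling is the image of the word measure under a pair of path maps, so the
  almost sure bound pulls back to words. Flatness starts at length 1; for \<open>n = 0\<close> both
  sums are empty.\<close>

lemma flat_S: "AE w in Mw n. \<bar>S n w x - S n w y\<bar> \<le> C * \<omega> (seq_dist x y)"
proof (cases "n = 0")
  case True
  then show ?thesis by (simp add: C_omega_nonneg)
next
  case False
  then have n: "1 \<le> n" by simp
  have wp[measurable]: "(\<lambda>w. word_path n w x) \<in> Mw n \<rightarrow>\<^sub>M path_space n" for x :: "nat \<Rightarrow> 'e"
    unfolding path_space_def word_path_def
  proof (rule measurable_restrict)
    fix j assume j: "j \<in> {1..n}"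
    have "(\<lambda>w. restrict w {Suc 0..j}) \<in> Mw n \<rightarrow>\<^sub>M Mw j"
      using j by (intro measurable_restrict_subset) auto
    from measurable_cat[OF this measurable_const, of x]
    have "(\<lambda>z. cat j (restrict z {Suc 0..j}) x) \<in> Mw n \<rightarrow>\<^sub>M borel" by simp
    moreover have "cat j (restrict w {Suc 0..j}) x = (\<lambda>i. if i < j then w (j - i) else x (i - j))" for w
      by (auto simp: cat_def fun_eq_iff)
    ultimately show "(\<lambda>w i. if i < j then w (j - i) else x (i - j)) \<in> borel_measurable (Mw n)" by simp
  qed
  have bsm[measurable]: "birkhoff_sum f n \<in> borel_measurable (path_space n)"
    unfolding birkhoff_sum_def path_space_def
    by (intro borel_measurable_sum measurable_compose[OF _ f_measurable] measurable_component_singleton) auto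
  show ?thesis
    using flat[OF n, of x y] unfolding natural_coupling_def S_eq One_nat_def
    by (subst (asm) AE_distr_iff) auto
qed

text \<open>The transfer operator written as an integral over the alphabet;
  \<open>transfer_op_eq_L\<close> identifies it with \<open>transfer_op\<close> for the shift
  kernel.\<close>

definition L :: "((nat \<Rightarrow> 'e) \<Rightarrow> real) \<Rightarrow> (nat \<Rightarrow> 'e) \<Rightarrow> real" where
  "L \<phi> x = (\<integral>a. exp (f (case_nat a x)) * \<phi> (case_nat a x) \<partial>\<mu>)"

lemma bounded_by_L:
  assumes \<phi>: "bounded_by B \<phi>"
  shows "bounded_by (exp F0 * B) (L \<phi>)"
  unfolding bounded_by_def
proof (intro conjI allI)
  note [measurable] = bounded_byD(1)[OF \<phi>]
  show "L \<phi> \<in> borel_measurable borel" unfolding L_def[abs_def]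
    by (rule mu.borel_measurable_lebesgue_integral) measurable
  fix x
  have b: "\<bar>exp (f y) * \<phi> y\<bar> \<le> exp F0 * B" for y
    using f_bound[of y] bounded_byD(2)[OF \<phi>, of y] by (auto simp: abs_mult intro!: mult_mono)
  have "\<bar>L \<phi> x\<bar> \<le> (\<integral>a. \<bar>exp (f (case_nat a x)) * \<phi> (case_nat a x)\<bar> \<partial>\<mu>)"
    unfolding L_def by (rule integral_abs_bound)
  also have "\<dots> \<le> (\<integral>a. exp F0 * B \<partial>\<mu>)"
    using b bounded_by_nonneg[OF \<phi>] by (intro integral_mono mu.integrable_const_bound[where B = "exp F0 * B"]) auto
  finally show "\<bar>L \<phi> x\<bar> \<le> exp F0 * B" using mu.prob_space by simp
qed

lemma bounded_by_Ln:
  "bounded_by B \<phi> \<Longrightarrow> bounded_by (exp (real n * F0) * B) ((L ^^ n) \<phi>)"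
proof (induction n)
  case (Suc n)
  from bounded_by_L[OF Suc.IH[OF Suc.prems]] show ?case
    by (simp add: algebra_simps exp_add)
qed simp

lemma integrable_weight:
  assumes \<phi>: "bounded_by B \<phi>"
  shows "integrable (Mw n) (\<lambda>w. exp (S n w x) * \<phi> (cat n w x))"
proof (rule Mw.integrable_const_bound)
  note [measurable] = bounded_byD(1)[OF \<phi>]
  show "(\<lambda>w. exp (S n w x) * \<phi> (cat n w x)) \<in> borel_measurable (Mw n)" by measurable
  show "AE w in Mw n. norm (exp (S n w x) * \<phi> (cat n w x)) \<le> exp (real n * F0) * B"
    using S_bound[of n _ x] bounded_byD(2)[OF \<phi>]
    by (auto simp: abs_mult abs_le_iff intro!: mult_mono AE_I2)
qed

text \<open>The letter that stands first in the word belongs to the innermost application of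
  \<open>L\<close>. Hence the induction unfolds \<open>(L ^^ n) (L \<phi>)\<close>, and Fubini
  splits off the letter \<open>Suc n\<close>.\<close>

lemma Ln_eq:
  assumes \<phi>: "bounded_by B \<phi>"
  shows "(L ^^ n) \<phi> x = (\<integral>w. exp (S n w x) * \<phi> (cat n w x) \<partial>Mw n)"
  using \<phi>
proof (induction n arbitrary: \<phi> B)
  case 0
  show ?case using Mw.prob_space[of 0] by simp
next
  case (Suc n)
  have "(L ^^ Suc n) \<phi> x = (L ^^ n) (L \<phi>) x" by (simp add: funpow_swap1)
  also have "\<dots> = (\<integral>w. exp (S n w x) * L \<phi> (cat n w x) \<partial>Mw n)"
    by (rule Suc.IH[OF bounded_by_L[OF Suc.prems]])
  also have "\<dots> = (\<integral>w. \<integral>a. exp (S (Suc n) (w(Suc n := a)) x) * \<phi> (cat (Suc n) (w(Suc n := a)) x) \<partial>\<mu> \<partial>Mw n)"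
    by (simp add: L_def S_upd cat_Suc exp_add mult.assoc)
  also have "\<dots> = (\<integral>w. exp (S (Suc n) w x) * \<phi> (cat (Suc n) w x) \<partial>Pi\<^sub>M (insert (Suc n) {Suc 0..n}) (\<lambda>_. \<mu>))"
    using integrable_weight[OF Suc.prems, of "Suc n" x]
    by (intro prod.product_integral_insert[symmetric]) (auto simp: atLeastAtMostSuc_conv)
  also have "insert (Suc n) {Suc 0..n} = {Suc 0..Suc n}" by auto
  finally show ?case .
qed

section \<open>The iterates of the constant function\<close>

definition g :: "nat \<Rightarrow> (nat \<Rightarrow> 'e) \<Rightarrow> real" where
  "g n = (L ^^ n) (\<lambda>_. 1)"

lemma bounded_by_1: "bounded_by 1 (\<lambda>_. 1)"
  by (simp add: bounded_by_def)

lemma g_eq: "g n x = (\<integral>w. exp (S n w x) \<partial>Mw n)"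
  unfolding g_def Ln_eq[OF bounded_by_1] by simp

lemma bounded_by_g: "bounded_by (exp (real n * F0)) (g n)"
  unfolding g_def using bounded_by_Ln[OF bounded_by_1] by simp

lemma integrable_S: "integrable (Mw n) (\<lambda>w. exp (S n w x))"
  using integrable_weight[OF bounded_by_1, of n x] by simp

lemma g_lower: "exp (- (real n * F0)) \<le> g n x"
proof -
  have "exp (- (real n * F0)) = (\<integral>w. exp (- (real n * F0)) \<partial>Mw n)" using Mw.prob_space by simp
  also have "\<dots> \<le> g n x"
    unfolding g_eq
  proof (intro integral_mono integrable_S)
    show "exp (- (real n * F0)) \<le> exp (S n w x)" for w using S_bound[of n w x] by simp
  qed simp
  finally show ?thesis .
qed

lemma g_pos: "0 < g n x"
  using g_lower[of n x] less_le_trans[OF exp_gt_zero] by blast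

text \<open>Flatness integrated over words: the logarithm of \<open>g n\<close> is Hoelder with a
  constant independent of \<open>n\<close>.\<close>

lemma g_ratio: "g n x \<le> exp (C * \<omega> (seq_dist x y)) * g n y"
proof -
  have "g n x \<le> (\<integral>w. exp (C * \<omega> (seq_dist x y)) * exp (S n w y) \<partial>Mw n)"
    unfolding g_eq
  proof (intro integral_mono_AE integrable_S integrable_mult_right)
    show "AE w in Mw n. exp (S n w x) \<le> exp (C * \<omega> (seq_dist x y)) * exp (S n w y)"
      using flat_S[of n x y] by eventually_elim (auto simp flip: exp_add)
  qed
  then show ?thesis by (simp add: g_eq)
qed

section \<open>Normalized averages\<close>

text \<open>Dividing by the iterate of the constant 1 normalizes the operator before any
  eigenfunction is known.\<close>

definition A :: "nat \<Rightarrow> ((nat \<Rightarrow> 'e) \<Rightarrow> real) \<Rightarrow> (nat \<Rightarrow> 'e) \<Rightarrow> real" where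
  "A n \<phi> x = (L ^^ n) \<phi> x / g n x"

lemma A_0[simp]: "A 0 \<phi> = \<phi>"
  by (simp add: A_def g_def fun_eq_iff)

text \<open>The density, on words of length \<open>N\<close>, of the averaging kernel that takes
  \<open>A n \<phi>\<close> to \<open>A (n + N) \<phi>\<close>. It depends on \<open>n\<close>
  because the normalization changes with time.\<close>

definition U :: "nat \<Rightarrow> nat \<Rightarrow> (nat \<Rightarrow> 'e) \<Rightarrow> (nat \<Rightarrow> 'e) \<Rightarrow> real" where
  "U n N x w = exp (S N w x) * g n (cat N w x) / g (n + N) x"

lemma U_nonneg: "0 \<le> U n N x w"
  using g_pos[of n "cat N w x"] g_pos[of "n + N" x] by (simp add: U_def less_imp_le)

lemma integrable_U: "integrable (Mw N) (U n N x)"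
  unfolding U_def[abs_def] using integrable_weight[OF bounded_by_g, of N x n] by simp

text \<open>The outer \<open>N\<close> applications of \<open>L\<close> are expanded over words, and
  \<open>g n\<close> at the end of the word is multiplied in and divided out.\<close>

lemma A_add:
  assumes \<phi>: "bounded_by B \<phi>"
  shows "A (n + N) \<phi> x = (\<integral>w. U n N x w * A n \<phi> (cat N w x) \<partial>Mw N)"
proof -
  have "(L ^^ (n + N)) \<phi> x = (L ^^ N) ((L ^^ n) \<phi>) x"
    unfolding add.commute[of n N] funpow_add comp_apply ..
  also have "\<dots> = (\<integral>w. exp (S N w x) * (L ^^ n) \<phi> (cat N w x) \<partial>Mw N)"
    by (rule Ln_eq[OF bounded_by_Ln[OF \<phi>]])
  finally have "A (n + N) \<phi> x = (\<integral>w. exp (S N w x) * (L ^^ n) \<phi> (cat N w x) \<partial>Mw N) / g (n + N) x"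
    by (simp add: A_def)
  also have "\<dots> = (\<integral>w. exp (S N w x) * (L ^^ n) \<phi> (cat N w x) / g (n + N) x \<partial>Mw N)"
    by simp
  also have "\<dots> = (\<integral>w. U n N x w * A n \<phi> (cat N w x) \<partial>Mw N)"
  proof (intro Bochner_Integration.integral_cong refl)
    fix w
    have cancel: "a * b / c * (d / b) = a * d / c" if "b \<noteq> 0" for a b c d :: real using that by simp
    have "g n (cat N w x) \<noteq> 0" using g_pos[of n "cat N w x"] by simp
    from cancel[OF this] show "exp (S N w x) * (L ^^ n) \<phi> (cat N w x) / g (n + N) x = U n N x w * A n \<phi> (cat N w x)"
      by (simp only: U_def A_def)
  qed
  finally show ?thesis .
qed

lemma A_one: "A n (\<lambda>_. 1) x = 1"
  using g_pos[of n x] by (simp add: A_def flip: g_def)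

lemma integral_U: "(\<integral>w. U n N x w \<partial>Mw N) = 1"
  using A_add[OF bounded_by_1, of n N x] by (simp add: A_one)

lemma bounded_by_A:
  assumes \<phi>: "bounded_by B \<phi>"
  shows "bounded_by B (A n \<phi>)"
  unfolding bounded_by_def
proof (intro conjI allI)
  have [measurable]: "(L ^^ n) \<phi> \<in> borel_measurable borel" "g n \<in> borel_measurable borel"
    using bounded_byD(1) bounded_by_Ln[OF \<phi>] bounded_by_g by blast+
  show "A n \<phi> \<in> borel_measurable borel" unfolding A_def[abs_def] by measurable
  fix x
  have "\<bar>(L ^^ n) \<phi> x\<bar> \<le> (\<integral>w. \<bar>exp (S n w x) * \<phi> (cat n w x)\<bar> \<partial>Mw n)"
    unfolding Ln_eq[OF \<phi>] by (rule integral_abs_bound)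
  also have "\<dots> \<le> (\<integral>w. B * exp (S n w x) \<partial>Mw n)"
    using bounded_byD(2)[OF \<phi>]
    by (intro integral_mono integrable_abs integrable_weight[OF \<phi>] integrable_mult_right integrable_S)
      (auto simp: abs_mult mult.commute intro!: mult_right_mono)
  also have "\<dots> = B * g n x" by (simp add: g_eq)
  finally show "\<bar>A n \<phi> x\<bar> \<le> B" using g_pos[of n x] by (simp add: A_def pos_divide_le_eq abs_divide)
qed

text \<open>The 3 counts the factors of \<open>U\<close>: the weight of the word, \<open>g n\<close>
  at its end and \<open>g (n + N)\<close> in the denominator each contribute
  \<open>exp (C * \<omega> (seq_dist x y))\<close>.\<close>

lemma U_ratio: "AE w in Mw N. U n N x w \<le> exp (3 * C * \<omega> (seq_dist x y)) * U n N y w"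
  using flat_S[of N x y]
proof eventually_elim
  case (elim w)
  let ?c = "C * \<omega> (seq_dist x y)"
  have 1: "exp (S N w x) \<le> exp ?c * exp (S N w y)" using elim by (simp flip: exp_add)
  have "exp (C * \<omega> (seq_dist (cat N w x) (cat N w y))) \<le> exp ?c"
    using omega_cat_le C_pos by simp
  then have 2: "g n (cat N w x) \<le> exp ?c * g n (cat N w y)"
    using g_ratio[of n "cat N w x" "cat N w y"] g_pos[of n "cat N w y"]
    by (meson less_imp_le mult_right_mono order_trans)
  have "g (n + N) y \<le> exp ?c * g (n + N) x"
    using g_ratio[of "n + N" y x] by (simp add: seq_dist_def dist_commute)
  then have 3: "1 / g (n + N) x \<le> exp ?c / g (n + N) y"
    using g_pos[of "n + N" x] g_pos[of "n + N" y] by (simp add: field_simps)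
  have "U n N x w = exp (S N w x) * g n (cat N w x) * (1 / g (n + N) x)" by (simp add: U_def)
  also have "\<dots> \<le> (exp ?c * exp (S N w y)) * (exp ?c * g n (cat N w y)) * (exp ?c / g (n + N) y)"
    using 1 2 3 g_pos[of n "cat N w x"] g_pos[of "n + N" x]
    by (intro mult_mono) (auto intro!: mult_nonneg_nonneg less_imp_le[OF g_pos])
  also have "\<dots> = exp (3 * C * \<omega> (seq_dist x y)) * U n N y w"
  proof -
    have "exp (3 * C * \<omega> (seq_dist x y)) = exp ?c * exp ?c * exp ?c" by (simp flip: exp_add)
    then show ?thesis by (simp add: U_def)
  qed
  finally show ?case .
qed

lemma seq_dist_commute: "seq_dist x y = seq_dist y (x :: nat \<Rightarrow> 'e)"
  by (simp add: seq_dist_def dist_commute)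

text \<open>Moving the base point moves the points of evaluation, which costs
  \<open>\<delta>\<close>, and changes the weights, which by \<open>U_ratio\<close> costs only a
  fraction of the oscillation.\<close>

lemma A_diff:
  assumes \<phi>: "bounded_by B \<phi>"
    and \<delta>: "\<And>w. \<bar>A n \<phi> (cat N w x) - A n \<phi> (cat N w y)\<bar> \<le> \<delta>"
    and D: "\<And>u v. \<bar>A n \<phi> u - A n \<phi> v\<bar> \<le> D"
  shows "\<bar>A (n + N) \<phi> x - A (n + N) \<phi> y\<bar> \<le> \<delta> + (1 - exp (- (3 * C * \<omega> (seq_dist x y)))) * D"
proof -
  note [measurable] = bounded_byD(1)[OF bounded_by_A[OF \<phi>], of n]
  show ?thesis
    unfolding A_add[OF \<phi>]
    by (rule weighted_average_diff[where B = B])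
      (use C_omega_nonneg U_ratio[where x = y and y = x] in \<open>auto intro: integrable_U integral_U U_nonneg U_ratio \<delta> D
        bounded_byD(2)[OF bounded_by_A[OF \<phi>]] simp: seq_dist_commute[of y x]\<close>)
qed

text \<open>Maximum principle: a later average is an average of the earlier one.\<close>

lemma A_between:
  assumes \<phi>: "bounded_by B \<phi>" and c: "\<And>u. A n \<phi> u \<le> c"
  shows "A (n + N) \<phi> x \<le> c"
proof -
  note [measurable] = bounded_byD(1)[OF bounded_by_A[OF \<phi>], of n]
  have "A (n + N) \<phi> x \<le> (\<integral>w. c * U n N x w \<partial>Mw N)"
    unfolding A_add[OF \<phi>]
  proof (rule integral_mono)
    show "integrable (Mw N) (\<lambda>w. U n N x w * A n \<phi> (cat N w x))"
    proof (rule Bochner_Integration.integrable_bound[of _ "\<lambda>w. B * U n N x w"])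
      have "\<bar>U n N x w * A n \<phi> (cat N w x)\<bar> \<le> \<bar>B * U n N x w\<bar>" for w
        using bounded_byD(2)[OF bounded_by_A[OF \<phi>], of n "cat N w x"] U_nonneg[of n N x w]
          mult_left_mono[of "\<bar>A n \<phi> (cat N w x)\<bar>" B "U n N x w"] bounded_by_nonneg[OF \<phi>]
        by (simp add: abs_mult mult.commute)
      then show "AE w in Mw N. norm (U n N x w * A n \<phi> (cat N w x)) \<le> norm (B * U n N x w)" by simp
    qed (use integrable_U[of N n x] in \<open>auto intro: borel_measurable_integrable\<close>)
    show "U n N x w * A n \<phi> (cat N w x) \<le> c * U n N x w" for w
      using mult_left_mono[OF c U_nonneg] by (simp add: mult.commute[of c])
  qed (use integrable_U in auto)
  also have "\<dots> = c" by (simp add: integral_U)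
  finally show ?thesis .
qed

lemma A_minus: "bounded_by B \<phi> \<Longrightarrow> A n (\<lambda>x. - \<phi> x) x = - A n \<phi> x"
  using Ln_eq[of B \<phi> n x] Ln_eq[of B "\<lambda>x. - \<phi> x" n x] by (simp add: A_def bounded_by_def)

text \<open>Once \<open>A n \<phi>\<close> is nearly constant, all later averages stay near that
  constant; decay of the oscillation thus implies convergence.\<close>

lemma A_close:
  assumes \<phi>: "bounded_by B \<phi>" and D: "\<And>u v. \<bar>A n \<phi> u - A n \<phi> v\<bar> \<le> D"
  shows "\<bar>A (n + N) \<phi> x - A n \<phi> y\<bar> \<le> D"
proof -
  have "A (n + N) \<phi> x \<le> A n \<phi> y + D"
    by (rule A_between[OF \<phi>]) (use D in \<open>auto simp: abs_le_iff algebra_simps\<close>)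
  moreover have "A (n + N) (\<lambda>x. - \<phi> x) x \<le> - A n \<phi> y + D"
    by (rule A_between[of B]) (use D \<phi> in \<open>auto simp: A_minus[OF \<phi>] abs_le_iff algebra_simps bounded_by_def\<close>)
  ultimately show ?thesis by (auto simp: A_minus[OF \<phi>] abs_le_iff)
qed

section \<open>Decay of the oscillation\<close>

definition holder :: "real \<Rightarrow> ((nat \<Rightarrow> 'e) \<Rightarrow> real) \<Rightarrow> bool" where
  "holder H \<phi> \<longleftrightarrow> 0 \<le> H \<and> (\<forall>x y. \<bar>\<phi> x - \<phi> y\<bar> \<le> H * \<omega> (seq_dist x y))"

text \<open>The Hoelder constant does not accumulate with \<open>N\<close>, because
  \<open>A (n + N) \<phi>\<close> is compared with \<open>A n \<phi>\<close> in one stroke. The 6 is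
  the 3 of \<open>U_ratio\<close> times the 2 in the oscillation bound \<open>2 * B\<close>.\<close>

lemma holder_A:
  assumes \<phi>: "bounded_by B \<phi>" and H: "holder H (A n \<phi>)"
  shows "holder (H + 6 * C * B) (A (n + N) \<phi>)"
  unfolding holder_def
proof (intro conjI allI)
  show "0 \<le> H + 6 * C * B" using H C_pos bounded_by_nonneg[OF \<phi>] by (simp add: holder_def)
  fix x y
  have D: "\<bar>A n \<phi> u - A n \<phi> v\<bar> \<le> 2 * B" for u v
    using bounded_byD(2)[OF bounded_by_A[OF \<phi>], of n u] bounded_byD(2)[OF bounded_by_A[OF \<phi>], of n v] by linarith
  have "\<bar>A n \<phi> (cat N w x) - A n \<phi> (cat N w y)\<bar> \<le> H * \<omega> (seq_dist x y)" for w
  proof -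
    have "\<bar>A n \<phi> (cat N w x) - A n \<phi> (cat N w y)\<bar> \<le> H * \<omega> (seq_dist (cat N w x) (cat N w y))"
      using H by (simp add: holder_def)
    also have "\<dots> \<le> H * \<omega> (seq_dist x y)"
      using H omega_cat_le by (intro mult_left_mono) (auto simp: holder_def)
    finally show ?thesis .
  qed
  from A_diff[OF \<phi> this D]
  have "\<bar>A (n + N) \<phi> x - A (n + N) \<phi> y\<bar> \<le> H * \<omega> (seq_dist x y) + (1 - exp (- (3 * C * \<omega> (seq_dist x y)))) * (2 * B)" .
  also have "\<dots> \<le> H * \<omega> (seq_dist x y) + (3 * C * \<omega> (seq_dist x y)) * (2 * B)"
    using exp_ge_add_one_self[of "- (3 * C * \<omega> (seq_dist x y))"] bounded_by_nonneg[OF \<phi>]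
    by (intro add_left_mono mult_right_mono) auto
  finally show "\<bar>A (n + N) \<phi> x - A (n + N) \<phi> y\<bar> \<le> (H + 6 * C * B) * \<omega> (seq_dist x y)"
    by (simp add: algebra_simps)
qed

text \<open>The recursive inequality applied to the oscillation, with one constant for all
  \<open>\<phi>\<close>. The offset \<open>n0\<close> admits functions that become Hoelder only
  after some steps of averaging, such as discontinuous cylinder functions.\<close>

lemma uniform_contraction:
  obtains K where "0 < K" "\<And>\<phi> B H n0 k x y. bounded_by B \<phi> \<Longrightarrow> holder H (A n0 \<phi>) \<Longrightarrow> 1 \<le> k \<Longrightarrow>
    \<bar>A (n0 + k) \<phi> x - A (n0 + k) \<phi> y\<bar> \<le> K * (B + H) * real k powr - \<epsilon>"
proof -
  define p where "p = exp (- (3 * C * \<Omega>))"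
  have p: "0 < p" "p \<le> 1" using C_pos Omega_nonneg by (auto simp: p_def)
  obtain K where K: "0 < K" "\<forall>a M. 0 \<le> M \<and> (\<forall>n. a n \<le> M) \<and>
       (\<forall>n. \<forall>N\<ge>1. a (n + N) \<le> M * real N powr - \<epsilon> + (1 - p) * a n) \<longrightarrow>
       (\<forall>n\<ge>1. a n \<le> K * M * real n powr - \<epsilon>)"
    using power_decay_recursion[OF eps p] by blast
  \<comment> \<open>Large enough for \<open>c * (B + H)\<close> to dominate both the oscillation
    \<open>2 * B\<close> and the Hoelder constant of \<open>holder_A\<close> times
    \<open>K\<omega>\<close>.\<close>
  define c where "c = 2 + (1 + 6 * C) * K\<omega>"
  have c: "0 < c" using C_pos K\<omega>_nonneg by (auto simp: c_def intro!: add_pos_nonneg)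
  show ?thesis
  proof (rule that)
    show "0 < K * c" using K c by simp
    fix \<phi> B H n0 k x y
    assume \<phi>: "bounded_by B \<phi>" and H: "holder H (A n0 \<phi>)" and k: "1 \<le> (k::nat)"
    have B0: "0 \<le> B" using bounded_by_nonneg[OF \<phi>] .
    have H0: "0 \<le> H" using H by (simp add: holder_def)
    define a where "a k = (SUP z. \<bar>A (n0 + k) \<phi> (fst z) - A (n0 + k) \<phi> (snd z)\<bar>)" for k
    have le2B: "\<bar>A n \<phi> u - A n \<phi> v\<bar> \<le> 2 * B" for n u v
      using bounded_byD(2)[OF bounded_by_A[OF \<phi>], of n u] bounded_byD(2)[OF bounded_by_A[OF \<phi>], of n v] by linarith
    have upper: "\<bar>A (n0 + k) \<phi> u - A (n0 + k) \<phi> v\<bar> \<le> a k" for k u v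
    proof -
      have "bdd_above (range (\<lambda>z. \<bar>A (n0 + k) \<phi> (fst z) - A (n0 + k) \<phi> (snd z)\<bar>))"
        by (auto intro!: bdd_aboveI[of _ "2 * B"] simp: le2B)
      from cSUP_upper[OF UNIV_I[of "(u, v)"] this] show ?thesis by (simp add: a_def)
    qed
    have least: "a k \<le> b" if "\<And>u v. \<bar>A (n0 + k) \<phi> u - A (n0 + k) \<phi> v\<bar> \<le> b" for k b
      unfolding a_def by (rule cSUP_least) (auto simp: that)
    define M where "M = c * (B + H)"
    have M0: "0 \<le> M" using B0 H0 c by (simp add: M_def)
    have c2: "2 \<le> c" "(1 + 6 * C) * K\<omega> \<le> c" using C_pos K\<omega>_nonneg by (simp_all add: c_def)
    have "2 * B \<le> 2 * (B + H)" using H0 by simp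
    also have "\<dots> \<le> M" unfolding M_def using c2 B0 H0 by (intro mult_right_mono) auto
    finally have M1: "2 * B \<le> M" .
    have M2: "(H + 6 * C * B) * K\<omega> \<le> M"
    proof -
      have "(1 + 6 * C) * (B + H) = H + 6 * C * B + (B + 6 * (C * H))" by algebra
      moreover have "0 \<le> C * H" using C_pos H0 by simp
      ultimately have "H + 6 * C * B \<le> (1 + 6 * C) * (B + H)" using B0 by linarith
      then have "(H + 6 * C * B) * K\<omega> \<le> (1 + 6 * C) * (B + H) * K\<omega>" using K\<omega>_nonneg by (rule mult_right_mono)
      also have "\<dots> = (1 + 6 * C) * K\<omega> * (B + H)" by algebra
      also have "\<dots> \<le> M" unfolding M_def using c2 B0 H0 by (intro mult_right_mono) auto
      finally show ?thesis .
    qed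
    have rec: "a (n + N) \<le> M * real N powr - \<epsilon> + (1 - p) * a n" if N: "1 \<le> N" for n N
    proof (rule least)
      fix u v
      have a0: "0 \<le> a n" using upper[of n undefined undefined] by simp
      have h: "holder (H + 6 * C * B) (A (n0 + n) \<phi>)" by (rule holder_A[OF \<phi> H])
      \<comment> \<open>A common word of length \<open>N\<close> brings the two points together, and
        the Hoelder constant is the same for all \<open>n\<close>.\<close>
      have "\<bar>A (n0 + n) \<phi> (cat N w u) - A (n0 + n) \<phi> (cat N w v)\<bar> \<le> M * real N powr - \<epsilon>" for w
      proof -
        have "\<bar>A (n0 + n) \<phi> (cat N w u) - A (n0 + n) \<phi> (cat N w v)\<bar> \<le>
            (H + 6 * C * B) * \<omega> (seq_dist (cat N w u) (cat N w v))"
          using h by (simp add: holder_def)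
        also have "\<dots> \<le> (H + 6 * C * B) * (K\<omega> * real N powr - \<epsilon>)"
          using h N by (intro mult_left_mono omega_cat_decay) (auto simp: holder_def)
        also have "\<dots> = ((H + 6 * C * B) * K\<omega>) * real N powr - \<epsilon>" by simp
        also have "\<dots> \<le> M * real N powr - \<epsilon>" using M2 by (rule mult_right_mono) simp
        finally show ?thesis .
      qed
      from A_diff[OF \<phi> this upper]
      have "\<bar>A (n0 + n + N) \<phi> u - A (n0 + n + N) \<phi> v\<bar>
          \<le> M * real N powr - \<epsilon> + (1 - exp (- (3 * C * \<omega> (seq_dist u v)))) * a n" .
      also have "\<dots> \<le> M * real N powr - \<epsilon> + (1 - p) * a n"
        using a0 C_pos omega_le[of u v] by (intro add_left_mono mult_right_mono) (auto simp: p_def)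
      finally show "\<bar>A (n0 + (n + N)) \<phi> u - A (n0 + (n + N)) \<phi> v\<bar> \<le> M * real N powr - \<epsilon> + (1 - p) * a n"
        by (simp add: add.assoc)
    qed
    have aM: "a n \<le> M" for n by (rule least) (rule order_trans[OF le2B M1])
    have "0 \<le> M \<and> (\<forall>n. a n \<le> M) \<and>
       (\<forall>n. \<forall>N\<ge>1. a (n + N) \<le> M * real N powr - \<epsilon> + (1 - p) * a n)"
      by (intro conjI allI impI M0 aM rec)
    with K(2) have "\<forall>n\<ge>1. a n \<le> K * M * real n powr - \<epsilon>" by blast
    with k have ak: "a k \<le> K * M * real k powr - \<epsilon>" by blast
    have "K * c * (B + H) = K * M" by (simp add: M_def)
    with order_trans[OF upper ak] show "\<bar>A (n0 + k) \<phi> x - A (n0 + k) \<phi> y\<bar> \<le> K * c * (B + H) * real k powr - \<epsilon>"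
      by metis
  qed
qed

section \<open>The limit functional\<close>

definition x0 :: "nat \<Rightarrow> 'e" where "x0 = undefined"

definition lim_A :: "((nat \<Rightarrow> 'e) \<Rightarrow> real) \<Rightarrow> real" where
  "lim_A \<phi> = lim (\<lambda>n. A n \<phi> x0)"

text \<open>Convergence is recorded at the reference point \<open>x0\<close>; \<open>A_rate\<close>
  carries it to all points with the same limit. It is kept apart from \<open>lim_A\<close>, whose
  value says nothing about a divergent sequence.\<close>

definition A_conv :: "((nat \<Rightarrow> 'e) \<Rightarrow> real) \<Rightarrow> real \<Rightarrow> bool" where
  "A_conv \<phi> l \<longleftrightarrow> (\<lambda>n. A n \<phi> x0) \<longlonglongrightarrow> l"

lemma lim_A_eq: "A_conv \<phi> l \<Longrightarrow> lim_A \<phi> = l"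
  by (simp add: lim_A_def A_conv_def limI)

lemma tendsto_power_neg: "(\<lambda>k. c * real k powr - \<epsilon>) \<longlonglongrightarrow> 0"
proof -
  have "(\<lambda>k. real k powr - \<epsilon>) \<longlonglongrightarrow> 0"
    using eps by (intro tendsto_neg_powr filterlim_real_sequentially) auto
  from tendsto_mult_right_zero[OF this] show ?thesis .
qed

lemma Cauchy_power_rate:
  fixes a :: "nat \<Rightarrow> real"
  assumes "\<And>m n. 1 \<le> m \<Longrightarrow> \<bar>a (m + n) - a m\<bar> \<le> c * real m powr - \<epsilon>"
  shows "Cauchy a"
proof (rule CauchyI')
  fix e :: real assume "0 < e"
  have "eventually (\<lambda>k. c * real k powr - \<epsilon> < e) sequentially"
    by (rule order_tendstoD(2)[OF tendsto_power_neg \<open>0 < e\<close>])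
  then obtain k where k: "\<And>m. k \<le> m \<Longrightarrow> c * real m powr - \<epsilon> < e"
    unfolding eventually_sequentially by blast
  show "\<exists>M. \<forall>m\<ge>M. \<forall>n>m. dist (a m) (a n) < e"
  proof (intro exI allI impI)
    fix m n assume m: "Suc k \<le> m" "m < n"
    have "\<bar>a (m + (n - m)) - a m\<bar> \<le> c * real m powr - \<epsilon>" by (rule assms) (use m in simp)
    also have "\<dots> < e" by (rule k) (use m in simp)
    finally show "dist (a m) (a n) < e" using m by (simp add: dist_real_def abs_minus_commute)
  qed
qed

lemma uniform_closeness:
  obtains K where "0 < K" "\<And>\<phi> B H n0 k N x y. bounded_by B \<phi> \<Longrightarrow> holder H (A n0 \<phi>) \<Longrightarrow> 1 \<le> k \<Longrightarrow>
    \<bar>A (n0 + k + N) \<phi> x - A (n0 + k) \<phi> y\<bar> \<le> K * (B + H) * real k powr - \<epsilon>"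
proof (rule uniform_contraction)
  fix K assume K: "0 < K" "\<And>\<phi> B H n0 k x y. bounded_by B \<phi> \<Longrightarrow> holder H (A n0 \<phi>) \<Longrightarrow> 1 \<le> k \<Longrightarrow>
    \<bar>A (n0 + k) \<phi> x - A (n0 + k) \<phi> y\<bar> \<le> K * (B + H) * real k powr - \<epsilon>"
  show thesis
    by (rule that[OF K(1)]) (rule A_close[OF _ K(2)])
qed

lemma A_conv_holder:
  assumes \<phi>: "bounded_by B \<phi>" "holder H (A n0 \<phi>)"
  shows "A_conv \<phi> (lim_A \<phi>)"
proof (rule uniform_closeness)
  fix K assume "\<And>\<phi> B H n0 k N x y. bounded_by B \<phi> \<Longrightarrow> holder H (A n0 \<phi>) \<Longrightarrow> 1 \<le> k \<Longrightarrow>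
    \<bar>A (n0 + k + N) \<phi> x - A (n0 + k) \<phi> y\<bar> \<le> K * (B + H) * real k powr - \<epsilon>"
  note close = this[OF \<phi>]
  have "Cauchy (\<lambda>k. A (n0 + k) \<phi> x0)"
    by (rule Cauchy_power_rate[where c = "K * (B + H)"]) (use close in \<open>simp add: add.assoc\<close>)
  then obtain l where "(\<lambda>k. A (n0 + k) \<phi> x0) \<longlonglongrightarrow> l"
    using Cauchy_convergent convergent_def by blast
  then have "(\<lambda>k. A (k + n0) \<phi> x0) \<longlonglongrightarrow> l" by (simp only: add.commute)
  then have l: "A_conv \<phi> l" unfolding A_conv_def by (rule LIMSEQ_offset)
  show ?thesis using l unfolding lim_A_eq[OF l] .
qed

text \<open>\<open>N\<close> tends to infinity in \<open>uniform_closeness\<close>. The two base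
  points there are independent, so the limit taken along \<open>x0\<close> serves every
  \<open>x\<close>.\<close>

lemma A_rate:
  obtains K where "0 < K"
    "\<And>\<phi> B H n0 k x. bounded_by B \<phi> \<Longrightarrow> holder H (A n0 \<phi>) \<Longrightarrow> 1 \<le> k \<Longrightarrow>
      \<bar>A (n0 + k) \<phi> x - lim_A \<phi>\<bar> \<le> K * (B + H) * real k powr - \<epsilon>"
proof (rule uniform_closeness)
  fix K assume K: "0 < K" and close: "\<And>\<phi> B H n0 k N x y. bounded_by B \<phi> \<Longrightarrow> holder H (A n0 \<phi>) \<Longrightarrow> 1 \<le> k \<Longrightarrow>
    \<bar>A (n0 + k + N) \<phi> x - A (n0 + k) \<phi> y\<bar> \<le> K * (B + H) * real k powr - \<epsilon>"
  show thesis
  proof (rule that[OF K])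
    fix \<phi> B H n0 and k :: nat and x assume \<phi>: "bounded_by B \<phi>" "holder H (A n0 \<phi>)" and k: "1 \<le> k"
    have "(\<lambda>N. A (N + (n0 + k)) \<phi> x0) \<longlonglongrightarrow> lim_A \<phi>"
      using A_conv_holder[OF \<phi>] unfolding A_conv_def by (rule LIMSEQ_ignore_initial_segment)
    from tendsto_rabs[OF tendsto_diff[OF this tendsto_const]]
    have lim: "(\<lambda>N. \<bar>A (N + (n0 + k)) \<phi> x0 - A (n0 + k) \<phi> x\<bar>) \<longlonglongrightarrow> \<bar>lim_A \<phi> - A (n0 + k) \<phi> x\<bar>" .
    have le: "\<bar>A (N + (n0 + k)) \<phi> x0 - A (n0 + k) \<phi> x\<bar> \<le> K * (B + H) * real k powr - \<epsilon>" for N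
      using close[OF \<phi> k, of N x0 x] unfolding add.commute[of N "n0 + k"] .
    have "\<bar>lim_A \<phi> - A (n0 + k) \<phi> x\<bar> \<le> K * (B + H) * real k powr - \<epsilon>"
      by (rule LIMSEQ_le_const2[OF lim]) (intro exI[of _ 0] allI impI le)
    then show "\<bar>A (n0 + k) \<phi> x - lim_A \<phi>\<bar> \<le> K * (B + H) * real k powr - \<epsilon>" by (simp add: abs_minus_commute)
  qed
qed

text \<open>Functions of the first \<open>n\<close> coordinates need not be continuous, but after \<open>n\<close> steps their
  averages are: only the weights then depend on the base point.\<close>
lemma holder_A_cylinder:
  assumes \<phi>: "bounded_by B \<phi>" and cyl: "\<And>w x y. \<phi> (cat n w x) = \<phi> (cat n w y)"
  shows "holder (6 * C * B) (A n \<phi>)"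
  unfolding holder_def
proof (intro conjI allI)
  show "0 \<le> 6 * C * B" using C_pos bounded_by_nonneg[OF \<phi>] by simp
  fix x y :: "nat \<Rightarrow> 'e"
  let ?t = "3 * C * \<omega> (seq_dist x y)"
  \<comment> \<open>The comparison starts at time 0: the word of length \<open>n\<close> determines
    the value of \<open>\<phi>\<close>, and only the weights change.\<close>
  have \<delta>: "\<bar>A 0 \<phi> (cat n w x) - A 0 \<phi> (cat n w y)\<bar> \<le> 0" for w
    using cyl[of w x y] by simp
  have D: "\<bar>A 0 \<phi> u - A 0 \<phi> v\<bar> \<le> 2 * B" for u v
    using bounded_byD(2)[OF \<phi>, of u] bounded_byD(2)[OF \<phi>, of v] unfolding A_0 by linarith
  have "\<bar>A n \<phi> x - A n \<phi> y\<bar> \<le> (1 - exp (- ?t)) * (2 * B)"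
    using A_diff[OF \<phi> \<delta> D] by simp
  also have "\<dots> \<le> ?t * (2 * B)"
  proof (rule mult_right_mono)
    show "1 - exp (- ?t) \<le> ?t" using exp_ge_add_one_self[of "- ?t"] by linarith
  qed (use bounded_by_nonneg[OF \<phi>] in simp)
  also have "\<dots> = 6 * C * B * \<omega> (seq_dist x y)" by simp
  finally show "\<bar>A n \<phi> x - A n \<phi> y\<bar> \<le> 6 * C * B * \<omega> (seq_dist x y)" .
qed

lemma A_conv_cylinder:
  assumes "bounded_by B \<phi>" "\<And>w x y. \<phi> (cat n w x) = \<phi> (cat n w y)"
  shows "A_conv \<phi> (lim_A \<phi>)"
  using A_conv_holder[OF assms(1) holder_A_cylinder[OF assms]] .

text \<open>A Harnack inequality: the word fixes the value of \<open>\<phi>\<close>, so changing the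
  base point changes only the weights, by a bounded factor. It bounds the limit functional by an
  average at the finite time \<open>n\<close>.\<close>

lemma A_cylinder_le:
  assumes \<phi>: "bounded_by B \<phi>" "\<And>x. 0 \<le> \<phi> x" and cyl: "\<And>w x y. \<phi> (cat n w x) = \<phi> (cat n w y)"
  shows "A n \<phi> x \<le> exp (3 * C * \<Omega>) * A n \<phi> y"
proof -
  have A: "A n \<phi> x = (\<integral>w. U 0 n x w * \<phi> (cat n w x) \<partial>Mw n)" for x
    using A_add[OF \<phi>(1), of 0 n x] by simp
  have int: "integrable (Mw n) (\<lambda>w. U 0 n x w * \<phi> (cat n w x))" for x
  proof -
    have "integrable (Mw n) (\<lambda>w. exp (S n w x) * \<phi> (cat n w x) / g n x)"
      using integrable_weight[OF \<phi>(1)] by simp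
    then show ?thesis by (simp add: U_def g_def)
  qed
  have "A n \<phi> x \<le> (\<integral>w. exp (3 * C * \<Omega>) * (U 0 n y w * \<phi> (cat n w y)) \<partial>Mw n)"
    unfolding A
  proof (intro integral_mono_AE int integrable_mult_right)
    show "AE w in Mw n. U 0 n x w * \<phi> (cat n w x) \<le> exp (3 * C * \<Omega>) * (U 0 n y w * \<phi> (cat n w y))"
      using U_ratio[where n = 0 and N = n and x = x and y = y]
    proof eventually_elim
      case (elim w)
      have "exp (3 * C * \<omega> (seq_dist x y)) * U 0 n y w \<le> exp (3 * C * \<Omega>) * U 0 n y w"
        using C_pos omega_le[of x y] by (intro mult_right_mono U_nonneg) simp
      then have "U 0 n x w * \<phi> (cat n w x) \<le> exp (3 * C * \<Omega>) * U 0 n y w * \<phi> (cat n w x)"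
        using elim by (intro mult_right_mono \<phi>) simp
      then show ?case using cyl[of w x y] by (simp add: mult.assoc)
    qed
  qed
  then show ?thesis by (simp add: A)
qed

lemma A_conv_add:
  assumes "bounded_by B \<phi>" "bounded_by B' \<psi>" "A_conv \<phi> l" "A_conv \<psi> l'"
  shows "A_conv (\<lambda>x. \<phi> x + \<psi> x) (l + l')"
proof -
  have b: "bounded_by (B + B') (\<lambda>x. \<phi> x + \<psi> x)"
    using assms(1,2) by (auto simp: bounded_by_def intro!: order_trans[OF abs_triangle_ineq] add_mono)
  have "A n (\<lambda>x. \<phi> x + \<psi> x) x0 = A n \<phi> x0 + A n \<psi> x0" for n
    using integrable_weight[OF assms(1)] integrable_weight[OF assms(2)]
    by (simp add: A_def Ln_eq[OF b] Ln_eq[OF assms(1)] Ln_eq[OF assms(2)] distrib_left add_divide_distrib)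
  then show ?thesis using assms(3,4) by (simp add: A_conv_def tendsto_add)
qed

lemma A_cmult:
  assumes "bounded_by B \<phi>"
  shows "A n (\<lambda>x. c * \<phi> x) y = c * A n \<phi> y"
proof -
  have b: "bounded_by (\<bar>c\<bar> * B) (\<lambda>x. c * \<phi> x)"
    using assms by (auto simp: bounded_by_def abs_mult mult_left_mono)
  show ?thesis by (simp add: A_def Ln_eq[OF b] Ln_eq[OF assms] mult.left_commute)
qed

lemma A_conv_cmult: "bounded_by B \<phi> \<Longrightarrow> A_conv \<phi> l \<Longrightarrow> A_conv (\<lambda>x. c * \<phi> x) (c * l)"
  by (simp add: A_conv_def A_cmult tendsto_mult_left)

end

section \<open>The conformal measure\<close>

definition trunc_seq :: "(nat \<Rightarrow> 'e) \<Rightarrow> nat \<Rightarrow> (nat \<Rightarrow> 'e) \<Rightarrow> nat \<Rightarrow> 'e" where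
  "trunc_seq z n x = (\<lambda>i. if i < n then x i else z i)"

text \<open>Exhibits both a sequence and its truncation as one common word in front of two tails, so
  that the estimates for \<open>cat\<close> apply to their distance.\<close>

lemma cat_reverse: "cat n (\<lambda>j. x (n - j)) (\<lambda>i. y (i + n)) = (\<lambda>i. if i < n then x i else y i)"
  by (auto simp: cat_def fun_eq_iff)

lemma trunc_seq_trunc_seq: "m \<le> n \<Longrightarrow> trunc_seq z m (trunc_seq z n x) = trunc_seq z m x"
  by (auto simp: trunc_seq_def fun_eq_iff)

lemma measurable_trunc_seq[measurable]:
  "trunc_seq z n \<in> borel \<rightarrow>\<^sub>M (borel :: (nat \<Rightarrow> 'e::polish_space) measure)"
proof (rule measurable_coordinatewise_then_product)
  fix i
  show "(\<lambda>x. trunc_seq z n x i) \<in> borel \<rightarrow>\<^sub>M borel"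
    using borel_measurable_continuous_onI[OF continuous_on_product_coordinates[of i]]
    by (auto simp: trunc_seq_def)
qed

text \<open>Layer-cake approximation: the number of levels j/m below \<open>t\<close> is the integer
  part of \<open>t * m\<close>.\<close>

lemma sum_layers:
  assumes "0 \<le> t" "t \<le> 1" "0 < m"
  shows "\<bar>t - (\<Sum>j=1..m. of_bool (real j / real m \<le> t)) / real m\<bar> \<le> 1 / real m"
proof -
  define k where "k = nat \<lfloor>t * real m\<rfloor>"
  have tm: "0 \<le> t * real m" "t * real m \<le> real m"
    using assms mult_right_mono[of t 1 "real m"] by simp_all
  have k: "real k \<le> t * real m" "t * real m < real k + 1"
    using tm(1) by (simp_all add: k_def)
  then have km: "k \<le> m" using tm(2) by linarith
  have iff: "real j / real m \<le> t \<longleftrightarrow> j \<le> k" for j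
  proof -
    have "real j / real m \<le> t \<longleftrightarrow> real j \<le> t * real m" using assms(3) by (simp add: pos_divide_le_eq)
    also have "\<dots> \<longleftrightarrow> j \<le> k" using k by linarith
    finally show ?thesis .
  qed
  have "(\<Sum>j=1..m. of_bool (real j / real m \<le> t) :: real) = (\<Sum>j=1..k. 1)"
    unfolding iff using km by (intro sum.mono_neutral_cong_right) auto
  then have sum: "(\<Sum>j=1..m. of_bool (real j / real m \<le> t) :: real) = real k" by simp
  have "t - real k / real m = (t * real m - real k) / real m" using assms(3) by (simp add: diff_divide_distrib)
  moreover have "0 \<le> (t * real m - real k) / real m" "(t * real m - real k) / real m \<le> 1 / real m"
    using k by (auto intro!: divide_right_mono)
  ultimately show ?thesis unfolding sum by simp
qed

context shift_potential
begin

lemma lim_A_nonneg: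
  assumes "bounded_by B \<phi>" "\<And>x. 0 \<le> \<phi> x" "A_conv \<phi> l"
  shows "0 \<le> l"
proof -
  have "0 \<le> A n \<phi> x0" for n
  proof -
    have "A (0 + n) (\<lambda>x. - \<phi> x) x0 \<le> 0"
      by (rule A_between[of B]) (use assms(1,2) in \<open>auto simp: bounded_by_def\<close>)
    then show ?thesis using A_minus[OF assms(1), of n x0] by simp
  qed
  then show ?thesis using LIMSEQ_le_const[OF assms(3)[unfolded A_conv_def]] by blast
qed

lemma A_conv_one: "A_conv (\<lambda>_. 1) 1"
  by (simp add: A_conv_def A_one)

lemma A_conv_unique: "A_conv \<phi> l \<Longrightarrow> A_conv \<phi> l' \<Longrightarrow> l = l'"
  unfolding A_conv_def by (rule LIMSEQ_unique)

lemma bounded_by_indicator: "X \<in> sets borel \<Longrightarrow> bounded_by 1 (indicator X)"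
  by (auto simp: bounded_by_def split: split_indicator)

section \<open>Cylinder sets and finite-dimensional marginals\<close>

definition slab :: "nat set \<Rightarrow> (nat \<Rightarrow> 'e) set \<Rightarrow> (nat \<Rightarrow> 'e) set" where
  "slab J X = {x. restrict x J \<in> X}"

lemma slab_measurable:
  assumes "X \<in> sets (Pi\<^sub>M J (\<lambda>_. borel))"
  shows "slab J X \<in> sets borel"
proof -
  have "(\<lambda>x. restrict x J) \<in> Pi\<^sub>M UNIV (\<lambda>_. borel :: 'e measure) \<rightarrow>\<^sub>M Pi\<^sub>M J (\<lambda>_. borel)"
    by (rule measurable_restrict_subset) simp
  from measurable_sets[OF this assms] show ?thesis
    by (simp add: slab_def vimage_def space_PiM sets_PiM_equal_borel)
qed

lemma slab_cat:
  assumes "J \<subseteq> {..<n}"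
  shows "indicator (slab J X) (cat n w x) = (indicator (slab J X) (cat n w y) :: real)"
proof -
  have "restrict (cat n w x) J = restrict (cat n w y) J"
    using assms by (auto simp: cat_def fun_eq_iff restrict_def)
  then show ?thesis by (simp add: slab_def indicator_def)
qed

lemma A_conv_slab:
  assumes "finite J" "X \<in> sets (Pi\<^sub>M J (\<lambda>_. borel))"
  shows "A_conv (indicator (slab J X)) (lim_A (indicator (slab J X)))"
proof -
  obtain n where "J \<subseteq> {..<n}" using assms(1) finite_nat_iff_bounded by blast
  then show ?thesis
    by (intro A_conv_cylinder[OF bounded_by_indicator[OF slab_measurable[OF assms(2)]]] slab_cat)
qed

text \<open>\<open>measure_of\<close> takes the prescribed values only once they are known to be
  countably additive; \<open>slab_continuity\<close> prepares this.\<close>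

definition marginal :: "nat set \<Rightarrow> (nat \<Rightarrow> 'e) measure" where
  "marginal J = measure_of (space (Pi\<^sub>M J (\<lambda>_. borel))) (sets (Pi\<^sub>M J (\<lambda>_. borel)))
     (\<lambda>X. ennreal (lim_A (indicator (slab J X))))"

text \<open>All the sets depend on the same finitely many coordinates. By the Harnack inequality and
  the maximum principle their limit weights are at most a constant times their weights at one fixed
  time \<open>n\<close>, which do come from a measure.\<close>

lemma slab_continuity:
  assumes J: "finite J" and X: "range X \<subseteq> sets (Pi\<^sub>M J (\<lambda>_. borel))" "decseq X" "(\<Inter>i. X i) = {}"
  shows "(\<lambda>i. lim_A (indicator (slab J (X i)))) \<longlonglongrightarrow> 0"
proof -
  obtain n where n: "J \<subseteq> {..<n}" using J finite_nat_iff_bounded by blast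
  define \<phi> :: "nat \<Rightarrow> (nat \<Rightarrow> 'e) \<Rightarrow> real" where "\<phi> i = indicator (slab J (X i))" for i
  have Xi: "X i \<in> sets (Pi\<^sub>M J (\<lambda>_. borel))" for i using X(1) by auto
  have b: "bounded_by 1 (\<phi> i)" for i unfolding \<phi>_def by (rule bounded_by_indicator[OF slab_measurable[OF Xi]])
  have conv: "A_conv (\<phi> i) (lim_A (\<phi> i))" for i unfolding \<phi>_def by (rule A_conv_slab[OF J Xi])
  have nn: "0 \<le> \<phi> i x" for i x by (simp add: \<phi>_def)
  have cyl: "\<phi> i (cat n w x) = \<phi> i (cat n w y)" for i w x y unfolding \<phi>_def by (rule slab_cat[OF n])
  have lo: "0 \<le> lim_A (\<phi> i)" for i by (rule lim_A_nonneg[OF b nn conv])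
  have up: "lim_A (\<phi> i) \<le> exp (3 * C * \<Omega>) * A n (\<phi> i) x0" for i
  proof -
    have "(\<lambda>N. A (N + n) (\<phi> i) x0) \<longlonglongrightarrow> lim_A (\<phi> i)"
      using conv[of i] unfolding A_conv_def by (rule LIMSEQ_ignore_initial_segment)
    note lim = this
    have "A (N + n) (\<phi> i) x0 \<le> exp (3 * C * \<Omega>) * A n (\<phi> i) x0" for N
      unfolding add.commute[of N n]
      by (rule A_between[OF b A_cylinder_le[OF b nn cyl]])
    then show ?thesis using LIMSEQ_le_const2[OF lim] by blast
  qed
  \<comment> \<open>At the fixed time \<open>n\<close> the average is an integral over words, so
    continuity from above is dominated convergence.\<close>
  have "(\<lambda>i. \<integral>w. exp (S n w x0) * \<phi> i (cat n w x0) \<partial>Mw n) \<longlonglongrightarrow> (\<integral>w. 0 \<partial>Mw n)"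
  proof (rule integral_dominated_convergence)
    show "integrable (Mw n) (\<lambda>w. exp (S n w x0))" by (rule integrable_S)
    show "(\<lambda>w. exp (S n w x0) * \<phi> i (cat n w x0)) \<in> borel_measurable (Mw n)" for i
      using integrable_weight[OF b] by (rule borel_measurable_integrable)
    show "AE w in Mw n. norm (exp (S n w x0) * \<phi> i (cat n w x0)) \<le> exp (S n w x0)" for i
      using bounded_byD(2)[OF b] by (auto simp: abs_mult)
    show "AE w in Mw n. (\<lambda>i. exp (S n w x0) * \<phi> i (cat n w x0)) \<longlonglongrightarrow> 0"
    proof (rule AE_I2, rule tendsto_eventually)
      fix w
      obtain k where k: "restrict (cat n w x0) J \<notin> X k" using X(3) by blast
      show "eventually (\<lambda>i. exp (S n w x0) * \<phi> i (cat n w x0) = 0) sequentially"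
        using eventually_ge_at_top[of k]
      proof eventually_elim
        case (elim i)
        then have "X i \<subseteq> X k" using X(2) by (simp add: decseq_def)
        then have "cat n w x0 \<notin> slab J (X i)" using k by (auto simp: slab_def)
        then show ?case by (simp add: \<phi>_def)
      qed
    qed
  qed auto
  then have "(\<lambda>i. A n (\<phi> i) x0) \<longlonglongrightarrow> 0"
    unfolding A_def using tendsto_divide_zero by (simp add: Ln_eq[OF b])
  note lim = tendsto_mult_right_zero[OF this, of "exp (3 * C * \<Omega>)"]
  have "(\<lambda>i. lim_A (\<phi> i)) \<longlonglongrightarrow> 0"
  proof (rule tendsto_sandwich[OF _ _ tendsto_const])
    show "(\<lambda>i. exp (3 * C * \<Omega>) * A n (\<phi> i) x0) \<longlonglongrightarrow> 0" by (rule lim)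
    show "\<forall>\<^sub>F i in sequentially. 0 \<le> lim_A (\<phi> i)" by (rule always_eventually) (rule allI, rule lo)
    show "\<forall>\<^sub>F i in sequentially. lim_A (\<phi> i) \<le> exp (3 * C * \<Omega>) * A n (\<phi> i) x0"
      by (rule always_eventually) (rule allI, rule up)
  qed
  then show ?thesis by (simp add: \<phi>_def)
qed

lemma emeasure_marginal:
  assumes J: "finite J" and X: "X \<in> sets (Pi\<^sub>M J (\<lambda>_. borel))"
  shows "emeasure (marginal J) X = ennreal (lim_A (indicator (slab J X)))"
  unfolding marginal_def
proof (rule emeasure_measure_of_sigma[OF _ _ _ X])
  let ?M = "sets (Pi\<^sub>M J (\<lambda>_. borel :: 'e measure))"
  show "sigma_algebra (space (Pi\<^sub>M J (\<lambda>_. borel))) ?M" by (rule sets.sigma_algebra_axioms)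
  have zero: "lim_A (indicator (slab J {})) = 0"
  proof -
    have e: "indicator (slab J {}) = (\<lambda>_. 0 :: real)" by (auto simp: slab_def fun_eq_iff)
    show ?thesis unfolding e by (rule lim_A_eq) (use A_conv_cmult[OF bounded_by_1 A_conv_one, of 0] in simp)
  qed
  show pos: "positive ?M (\<lambda>X. ennreal (lim_A (indicator (slab J X))))"
    by (simp add: positive_def zero)
  have nn: "0 \<le> lim_A (indicator (slab J X))" if "X \<in> ?M" for X
    by (rule lim_A_nonneg[OF bounded_by_indicator[OF slab_measurable[OF that]] _ A_conv_slab[OF J that]]) simp
  have add: "additive ?M (\<lambda>X. ennreal (lim_A (indicator (slab J X))))"
    unfolding additive_def
  proof (intro ballI impI)
    fix X Y assume XY: "X \<in> ?M" "Y \<in> ?M" "X \<inter> Y = {}"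
    have "A_conv (\<lambda>x. indicator (slab J X) x + indicator (slab J Y) x)
        (lim_A (indicator (slab J X)) + lim_A (indicator (slab J Y)))"
      by (intro A_conv_add[OF bounded_by_indicator bounded_by_indicator] A_conv_slab slab_measurable J XY)
    moreover have "(\<lambda>x. indicator (slab J X) x + indicator (slab J Y) x :: real) = indicator (slab J (X \<union> Y))"
      using XY(3) by (auto simp: fun_eq_iff slab_def indicator_def)
    ultimately have "lim_A (indicator (slab J (X \<union> Y))) = lim_A (indicator (slab J X)) + lim_A (indicator (slab J Y))"
      using lim_A_eq by simp
    then show "ennreal (lim_A (indicator (slab J (X \<union> Y)))) =
        ennreal (lim_A (indicator (slab J X))) + ennreal (lim_A (indicator (slab J Y)))"
      using nn XY by (simp add: ennreal_plus)
  qed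
  show "countably_additive ?M (\<lambda>X. ennreal (lim_A (indicator (slab J X))))"
  proof (rule sets.empty_continuous_imp_countably_additive[OF pos add])
    fix X :: "nat \<Rightarrow> (nat \<Rightarrow> 'e) set"
    assume X: "range X \<subseteq> ?M" "decseq X" "(\<Inter>i. X i) = {}"
    show "(\<lambda>i. ennreal (lim_A (indicator (slab J (X i))))) \<longlonglongrightarrow> 0"
      using tendsto_ennrealI[OF slab_continuity[OF J X]] by simp
  qed simp
qed

lemma sets_marginal[simp]: "sets (marginal J) = sets (Pi\<^sub>M J (\<lambda>_. borel))"
  unfolding marginal_def by (rule sets.sets_measure_of_eq)

lemma space_marginal[simp]: "space (marginal J) = space (Pi\<^sub>M J (\<lambda>_. borel))"
  by (rule sets_eq_imp_space_eq) simp

text \<open>Consistency holds because, as a set of sequences, the cylinder over \<open>H\<close>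
  based on the preimage of \<open>X\<close> is the cylinder over \<open>J\<close> based on
  \<open>X\<close>.\<close>

lemma projective_marginal: "polish_projective UNIV marginal"
  unfolding polish_projective_def
proof (rule projective_family.intro)
  fix J H :: "nat set" assume JH: "J \<subseteq> H" "finite H" "H \<subseteq> UNIV"
  have J: "finite J" using JH finite_subset by auto
  have r: "(\<lambda>f. restrict f J) \<in> marginal H \<rightarrow>\<^sub>M Pi\<^sub>M J (\<lambda>_. borel :: 'e measure)"
    using measurable_restrict_subset[OF JH(1)] by (simp add: measurable_cong_sets[OF sets_marginal refl])
  show "marginal J = distr (marginal H) (Pi\<^sub>M J (\<lambda>_. borel)) (\<lambda>f. restrict f J)"
  proof (rule measure_eqI)
    fix X assume "X \<in> sets (marginal J)"
    then have X: "X \<in> sets (Pi\<^sub>M J (\<lambda>_. borel))" by simp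
    let ?Y = "(\<lambda>f. restrict f J) -` X \<inter> space (marginal H)"
    have Y: "?Y \<in> sets (Pi\<^sub>M H (\<lambda>_. borel))" using measurable_sets[OF r X] by simp
    have "restrict (restrict x H) J = restrict x J" for x :: "nat \<Rightarrow> 'e"
      using JH(1) by (auto simp: restrict_def fun_eq_iff)
    then have "slab H ?Y = slab J X" by (auto simp: slab_def space_PiM)
    then show "emeasure (marginal J) X = emeasure (distr (marginal H) (Pi\<^sub>M J (\<lambda>_. borel)) (\<lambda>f. restrict f J)) X"
      by (simp only: emeasure_distr[OF r X] emeasure_marginal[OF J X] emeasure_marginal[OF JH(2) Y])
  qed simp
next
  fix J :: "nat set" assume J: "finite J" "J \<subseteq> UNIV"
  have "slab J (space (Pi\<^sub>M J (\<lambda>_. borel))) = UNIV" by (auto simp: slab_def space_PiM)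
  then have "emeasure (marginal J) (space (marginal J)) = ennreal (lim_A (\<lambda>_. 1))"
    by (simp add: emeasure_marginal[OF J(1)] indicator_def[abs_def])
  also have "\<dots> = 1" using lim_A_eq[OF A_conv_one] by simp
  finally show "prob_space (marginal J)" by (rule prob_spaceI)
qed

sublocale pm: polish_projective UNIV marginal
  by (rule projective_marginal)

section \<open>The measure on sequences and the functions it represents\<close>

definition nu :: "(nat \<Rightarrow> 'e) measure" where
  "nu = pm.lim"

lemma sets_nu[measurable_cong, simp]: "sets nu = sets borel"
  unfolding nu_def by (simp add: sets_PiM_equal_borel)

lemma space_nu[simp]: "space nu = UNIV"
  using sets_eq_imp_space_eq[OF sets_nu] by simp

sublocale nu: prob_space nu
  unfolding nu_def by (rule pm.P.prob_space_axioms)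

lemma nu_in: "nu \<in> borel_probs"
  by (simp add: space_prob_algebra nu.prob_space_axioms)

lemma emeasure_nu:
  assumes "finite J" "X \<in> sets (Pi\<^sub>M J (\<lambda>_. borel))"
  shows "emeasure nu (slab J X) = ennreal (lim_A (indicator (slab J X)))"
proof -
  have "prod_emb UNIV (\<lambda>_. borel) J X = slab J X"
    by (auto simp: prod_emb_def slab_def space_PiM)
  then show ?thesis
    using pm.emeasure_lim_emb[of J X] assms by (simp add: nu_def emeasure_marginal)
qed

text \<open>The functions for which the limit of the averages is the integral against
  \<open>nu\<close>. By construction both agree on cylinder sets; linear combinations and uniform
  limits extend this to Hoelder functions.\<close>

definition represented :: "((nat \<Rightarrow> 'e) \<Rightarrow> real) \<Rightarrow> bool" where
  "represented \<phi> \<longleftrightarrow> (\<exists>B. bounded_by B \<phi>) \<and> A_conv \<phi> (\<integral>x. \<phi> x \<partial>nu)"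

lemma integrable_nu: "bounded_by B \<phi> \<Longrightarrow> integrable nu \<phi>"
  by (rule nu.integrable_const_bound[where B = B])
    (auto simp: bounded_by_def measurable_cong_sets[OF sets_nu refl])

lemma represented_add:
  assumes "represented \<phi>" "represented \<psi>"
  shows "represented (\<lambda>x. \<phi> x + \<psi> x)"
proof -
  obtain B B' where b: "bounded_by B \<phi>" "bounded_by B' \<psi>" using assms by (auto simp: represented_def)
  have "bounded_by (B + B') (\<lambda>x. \<phi> x + \<psi> x)"
    using b by (auto simp: bounded_by_def intro!: order_trans[OF abs_triangle_ineq] add_mono)
  moreover have "A_conv (\<lambda>x. \<phi> x + \<psi> x) (\<integral>x. \<phi> x + \<psi> x \<partial>nu)"
    using A_conv_add[OF b] assms integrable_nu[OF b(1)] integrable_nu[OF b(2)] by (simp add: represented_def)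
  ultimately show ?thesis by (auto simp: represented_def)
qed

lemma represented_cmult:
  assumes "represented \<phi>"
  shows "represented (\<lambda>x. c * \<phi> x)"
proof -
  obtain B where b: "bounded_by B \<phi>" using assms by (auto simp: represented_def)
  have "bounded_by (\<bar>c\<bar> * B) (\<lambda>x. c * \<phi> x)"
    using b by (auto simp: bounded_by_def abs_mult mult_left_mono)
  moreover have "A_conv (\<lambda>x. c * \<phi> x) (\<integral>x. c * \<phi> x \<partial>nu)"
    using A_conv_cmult[OF b] assms by (simp add: represented_def)
  ultimately show ?thesis by (auto simp: represented_def)
qed

lemma represented_one: "represented (\<lambda>_. 1)"
  using bounded_by_1 A_conv_one nu.prob_space by (auto simp: represented_def)

lemma represented_sum:
  "finite I \<Longrightarrow> (\<And>i. i \<in> I \<Longrightarrow> represented (\<phi> i)) \<Longrightarrow> represented (\<lambda>x. \<Sum>i\<in>I. \<phi> i x)"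
proof (induction I rule: finite_induct)
  case empty
  then show ?case using represented_cmult[OF represented_one, of 0] by simp
next
  case (insert i I)
  then show ?case by (simp add: represented_add)
qed

text \<open>The averages \<open>A n\<close> and the integral against \<open>nu\<close> are both
  1-Lipschitz in the sup norm. Two approximation errors and one from convergence, each at most
  \<open>r / 4\<close>, stay below \<open>r\<close>.\<close>

lemma represented_approx:
  assumes \<phi>: "bounded_by B \<phi>"
    and ap: "\<And>e. 0 < e \<Longrightarrow> \<exists>\<psi>. represented \<psi> \<and> (\<forall>x. \<bar>\<phi> x - \<psi> x\<bar> \<le> e)"
  shows "represented \<phi>"
proof -
  have "(\<lambda>n. A n \<phi> x0) \<longlonglongrightarrow> (\<integral>x. \<phi> x \<partial>nu)"
  proof (rule LIMSEQ_I)
    fix r :: real assume r: "0 < r"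
    obtain \<psi> where \<psi>: "represented \<psi>" "\<And>x. \<bar>\<phi> x - \<psi> x\<bar> \<le> r / 4" using ap[of "r/4"] r by auto
    obtain B' where B': "bounded_by B' \<psi>" using \<psi>(1) by (auto simp: represented_def)
    have d: "bounded_by (r/4) (\<lambda>x. \<phi> x - \<psi> x)"
      using \<psi>(2) \<phi> B' by (auto simp: bounded_by_def)
    have i: "\<bar>(\<integral>x. \<phi> x \<partial>nu) - (\<integral>x. \<psi> x \<partial>nu)\<bar> \<le> r / 4"
    proof -
      have "\<bar>(\<integral>x. \<phi> x \<partial>nu) - (\<integral>x. \<psi> x \<partial>nu)\<bar> = \<bar>\<integral>x. \<phi> x - \<psi> x \<partial>nu\<bar>"
        using integrable_nu[OF \<phi>] integrable_nu[OF B'] by simp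
      also have "\<dots> \<le> (\<integral>x. \<bar>\<phi> x - \<psi> x\<bar> \<partial>nu)" by (rule integral_abs_bound)
      also have "\<dots> \<le> (\<integral>x. r / 4 \<partial>nu)"
        using \<psi>(2) integrable_nu[OF d] by (intro integral_mono integrable_abs) auto
      finally show ?thesis using nu.prob_space by simp
    qed
    have a: "\<bar>A n \<phi> x0 - A n \<psi> x0\<bar> \<le> r / 4" for n
    proof -
      have "A n (\<lambda>x. \<phi> x - \<psi> x) x0 = A n \<phi> x0 - A n \<psi> x0"
        using integrable_weight[OF \<phi>] integrable_weight[OF B']
        by (simp add: A_def Ln_eq[OF d] Ln_eq[OF \<phi>] Ln_eq[OF B'] right_diff_distrib diff_divide_distrib)
      then show ?thesis using bounded_byD(2)[OF bounded_by_A[OF d], of n x0] by simp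
    qed
    have "(\<lambda>n. A n \<psi> x0) \<longlonglongrightarrow> (\<integral>x. \<psi> x \<partial>nu)" using \<psi>(1) by (simp add: represented_def A_conv_def)
    from LIMSEQ_D[OF this, of "r/4"] r obtain n0 where n0: "\<And>n. n0 \<le> n \<Longrightarrow> \<bar>A n \<psi> x0 - (\<integral>x. \<psi> x \<partial>nu)\<bar> < r / 4"
      by auto
    have "\<bar>A n \<phi> x0 - (\<integral>x. \<phi> x \<partial>nu)\<bar> < r" if "n0 \<le> n" for n
      using i a[of n] n0[OF that] r by arith
    then show "\<exists>no. \<forall>n\<ge>no. norm (A n \<phi> x0 - (\<integral>x. \<phi> x \<partial>nu)) < r" by auto
  qed
  then show ?thesis using \<phi> by (auto simp: represented_def A_conv_def)
qed

text \<open>A set that ignores truncation is a cylinder over the first \<open>n\<close> coordinates;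
  its base is found by filling up with \<open>x0\<close>.\<close>

lemma represented_indicator:
  assumes X: "X \<in> sets borel" and cyl: "\<And>x. trunc_seq x0 n x \<in> X \<longleftrightarrow> x \<in> X"
  shows "represented (indicator X)"
proof -
  define Y where "Y = {y \<in> space (Pi\<^sub>M {..<n} (\<lambda>_. borel :: 'e measure)). (\<lambda>i. if i < n then y i else x0 i) \<in> X}"
  have "(\<lambda>y i. if i < n then y i else x0 i) \<in> Pi\<^sub>M {..<n} (\<lambda>_. borel) \<rightarrow>\<^sub>M borel"
  proof (rule measurable_coordinatewise_then_product)
    fix i
    show "(\<lambda>y. if i < n then y i else x0 i) \<in> Pi\<^sub>M {..<n} (\<lambda>_. borel) \<rightarrow>\<^sub>M borel"
      by (cases "i < n") (auto intro!: measurable_component_singleton[of i "{..<n}" "\<lambda>_. borel"])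
  qed
  from measurable_sets[OF this X] have Y: "Y \<in> sets (Pi\<^sub>M {..<n} (\<lambda>_. borel))"
    by (simp add: Y_def vimage_def Int_def conj_commute)
  have "(\<lambda>i. if i < n then restrict x {..<n} i else x0 i) = trunc_seq x0 n x" for x
    by (auto simp: trunc_seq_def)
  then have "slab {..<n} Y = X" by (auto simp: slab_def Y_def space_PiM cyl)
  then have *: "emeasure nu X = ennreal (lim_A (indicator X))" "A_conv (indicator X) (lim_A (indicator X))"
    using emeasure_nu[OF _ Y] A_conv_slab[OF _ Y] by auto
  have "0 \<le> lim_A (indicator X)" by (rule lim_A_nonneg[OF bounded_by_indicator[OF X] _ *(2)]) simp
  then have "measure nu X = lim_A (indicator X)" using *(1) by (simp add: measure_def)
  then show ?thesis using *(2) bounded_by_indicator[OF X] X by (auto simp: represented_def)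
qed

text \<open>Rescaled to [0, 1], the function is a uniform limit of averages of indicators of its
  superlevel sets, which are cylinders again.\<close>

lemma represented_cylinder:
  assumes \<phi>: "bounded_by B \<phi>" and cyl: "\<And>x. \<phi> (trunc_seq x0 n x) = \<phi> x"
  shows "represented \<phi>"
proof -
  note [measurable] = bounded_byD(1)[OF \<phi>]
  \<comment> \<open>The added 1 keeps the divisor \<open>2 * B'\<close> positive when
    \<open>B\<close> is 0.\<close>
  define B' where "B' = B + 1"
  have B': "0 < B'" using bounded_by_nonneg[OF \<phi>] by (simp add: B'_def)
  define \<psi> where "\<psi> x = (\<phi> x + B') / (2 * B')" for x
  have \<psi>: "0 \<le> \<psi> x" "\<psi> x \<le> 1" for x
    using bounded_byD(2)[OF \<phi>, of x] B' by (auto simp: \<psi>_def B'_def abs_le_iff divide_simps)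
  have m[measurable]: "\<psi> \<in> borel_measurable borel" unfolding \<psi>_def[abs_def] by measurable
  have "represented \<psi>"
  proof (rule represented_approx)
    show "bounded_by 1 \<psi>" using \<psi> m by (auto simp: bounded_by_def abs_le_iff intro: order_trans[of _ 0])
    fix e :: real assume "0 < e"
    then obtain k where k: "1 / real (Suc k) < e" using nat_approx_posE by metis
    let ?m = "Suc k"
    let ?s = "\<lambda>x. (1 / real ?m) * (\<Sum>j=1..?m. indicator {x. real j / real ?m \<le> \<psi> x} x)"
    have "represented ?s"
    proof (intro represented_cmult represented_sum represented_indicator[where n = n])
      fix j
      show "{x. real j / real ?m \<le> \<psi> x} \<in> sets borel" by measurable
      show "trunc_seq x0 n x \<in> {x. real j / real ?m \<le> \<psi> x} \<longleftrightarrow> x \<in> {x. real j / real ?m \<le> \<psi> x}" for x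
        by (simp add: \<psi>_def cyl)
    qed simp
    moreover have "\<bar>\<psi> x - ?s x\<bar> \<le> e" for x
    proof -
      have "?s x = (\<Sum>j=1..?m. of_bool (real j / real ?m \<le> \<psi> x)) / real ?m"
        by (simp add: indicator_def)
      then show ?thesis using sum_layers[OF \<psi>, of ?m x] k by simp
    qed
    ultimately show "\<exists>s. represented s \<and> (\<forall>x. \<bar>\<psi> x - s x\<bar> \<le> e)" by blast
  qed
  then have "represented (\<lambda>x. 2 * B' * \<psi> x + - B' * 1)"
    by (intro represented_add represented_cmult represented_one)
  moreover have "(\<lambda>x. 2 * B' * \<psi> x + - B' * 1) = \<phi>" using B' by (auto simp: \<psi>_def)
  ultimately show ?thesis by simp
qed

lemma represented_uniform:
  assumes \<phi>: "bounded_by B \<phi>" and ap: "\<And>e. 0 < e \<Longrightarrow> \<exists>n. \<forall>x. \<bar>\<phi> (trunc_seq x0 n x) - \<phi> x\<bar> \<le> e"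
  shows "represented \<phi>"
proof (rule represented_approx[OF \<phi>])
  fix e :: real assume "0 < e"
  then obtain n where n: "\<And>x. \<bar>\<phi> (trunc_seq x0 n x) - \<phi> x\<bar> \<le> e" using ap by blast
  have "represented (\<lambda>x. \<phi> (trunc_seq x0 n x))"
  proof (rule represented_cylinder[where n = n and B = B])
    show "bounded_by B (\<lambda>x. \<phi> (trunc_seq x0 n x))"
      using bounded_byD(2)[OF \<phi>] measurable_compose[OF measurable_trunc_seq bounded_byD(1)[OF \<phi>]]
      by (simp add: bounded_by_def)
  qed (simp add: trunc_seq_trunc_seq)
  moreover have "\<forall>x. \<bar>\<phi> x - \<phi> (trunc_seq x0 n x)\<bar> \<le> e"
    using n by (subst abs_minus_commute) blast
  ultimately show "\<exists>\<psi>. represented \<psi> \<and> (\<forall>x. \<bar>\<phi> x - \<psi> x\<bar> \<le> e)"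
    by (intro exI[of _ "\<lambda>x. \<phi> (trunc_seq x0 n x)"] conjI)
qed

lemma omega_trunc: "1 \<le> n \<Longrightarrow> \<omega> (seq_dist (trunc_seq x0 n x) x) \<le> K\<omega> * real n powr - \<epsilon>"
proof -
  assume n: "1 \<le> n"
  have "trunc_seq x0 n x = cat n (\<lambda>j. x (n - j)) (\<lambda>i. x0 (i + n))" by (simp add: trunc_seq_def cat_reverse)
  moreover have "x = cat n (\<lambda>j. x (n - j)) (\<lambda>i. x (i + n))" by (simp add: cat_reverse)
  ultimately have "seq_dist (trunc_seq x0 n x) x = seq_dist (cat n (\<lambda>j. x (n - j)) (\<lambda>i. x0 (i + n))) (cat n (\<lambda>j. x (n - j)) (\<lambda>i. x (i + n)))"
    by simp
  then show ?thesis using omega_cat_decay[OF n] by simp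
qed

text \<open>Truncation after \<open>n\<close> coordinates moves a point by at most 2^-n, so a
  Hoelder function is a uniform limit of cylinder functions.\<close>

lemma represented_holder:
  assumes \<phi>: "bounded_by B \<phi>" and H: "holder H \<phi>"
  shows "represented \<phi>"
proof (rule represented_uniform[OF \<phi>])
  fix e :: real assume "0 < e"
  have "eventually (\<lambda>n. H * K\<omega> * real n powr - \<epsilon> < e) sequentially"
    by (rule order_tendstoD(2)[OF tendsto_power_neg \<open>0 < e\<close>])
  with eventually_ge_at_top[of "1::nat"]
  have "eventually (\<lambda>n. 1 \<le> n \<and> H * K\<omega> * real n powr - \<epsilon> < e) sequentially" by eventually_elim simp
  then obtain n where n: "1 \<le> n" "H * K\<omega> * real n powr - \<epsilon> < e"
    by (auto simp: eventually_sequentially)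
  have "\<bar>\<phi> (trunc_seq x0 n x) - \<phi> x\<bar> \<le> e" for x
  proof -
    have "\<bar>\<phi> (trunc_seq x0 n x) - \<phi> x\<bar> \<le> H * \<omega> (seq_dist (trunc_seq x0 n x) x)" using H by (simp add: holder_def)
    also have "\<dots> \<le> H * (K\<omega> * real n powr - \<epsilon>)" using H n by (intro mult_left_mono omega_trunc) (auto simp: holder_def)
    finally show ?thesis using n(2) by simp
  qed
  then show "\<exists>n. \<forall>x. \<bar>\<phi> (trunc_seq x0 n x) - \<phi> x\<bar> \<le> e" by blast
qed

lemma holder_of_ratio:
  assumes \<phi>: "bounded_by B \<phi>" "\<And>x. 0 \<le> \<phi> x"
    and r: "\<And>x y. \<phi> x \<le> exp (C * \<omega> (seq_dist x y)) * \<phi> y"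
  shows "holder (C * B) \<phi>"
proof -
  have one: "\<phi> x - \<phi> y \<le> C * B * \<omega> (seq_dist x y)" for x y
  proof -
    let ?t = "C * \<omega> (seq_dist x y)"
    have "exp (- ?t) * \<phi> x \<le> exp (- ?t) * (exp ?t * \<phi> y)" by (rule mult_left_mono[OF r]) simp
    also have "\<dots> = \<phi> y" by (simp add: exp_minus)
    finally have "\<phi> x - \<phi> y \<le> (1 - exp (- ?t)) * \<phi> x" unfolding left_diff_distrib by simp
    also have "\<dots> \<le> ?t * \<phi> x"
    proof (rule mult_right_mono)
      show "1 - exp (- ?t) \<le> ?t" using exp_ge_add_one_self[of "- ?t"] by linarith
    qed (rule \<phi>(2))
    also have "\<dots> \<le> ?t * B"
    proof (rule mult_left_mono)
      show "\<phi> x \<le> B" using bounded_byD(2)[OF \<phi>(1), of x] by simp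
    qed (rule C_omega_nonneg)
    finally show ?thesis by (simp add: mult_ac)
  qed
  show ?thesis
    unfolding holder_def
  proof (intro conjI allI)
    show "0 \<le> C * B" using C_pos bounded_by_nonneg[OF \<phi>(1)] by simp
    show "\<bar>\<phi> x - \<phi> y\<bar> \<le> C * B * \<omega> (seq_dist x y)" for x y
      using one[of x y] one[of y x] seq_dist_commute[of x y] by simp
  qed
qed

lemma holder_g: "holder (C * exp (real n * F0)) (g n)"
  by (rule holder_of_ratio[OF bounded_by_g less_imp_le[OF g_pos] g_ratio])

lemma g_Suc: "g (Suc n) = L (g n)"
  by (simp add: g_def)

lemma Ln_g: "(L ^^ n) (g m) = g (n + m)"
  by (simp add: g_def funpow_add)

section \<open>The eigenvalue and conformality\<close>

text \<open>A conformal probability measure forces this value: its eigenvalue is the integral of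
  \<open>L\<close> applied to 1, which is \<open>g 1\<close>.\<close>

definition lam :: real where
  "lam = lim_A (g 1)"

lemma A_conv_g1: "A_conv (g 1) lam"
proof -
  have "holder (C * exp (real 1 * F0)) (A 0 (g 1))" unfolding A_0 by (rule holder_g)
  from A_conv_holder[OF bounded_by_g this] show ?thesis by (simp only: lam_def)
qed

text \<open>In the limit over \<open>n\<close> this product formula becomes the eigenvalue equation
  for the limit functional.\<close>

lemma A_L: "A n (L \<phi>) x = A (Suc n) \<phi> x * A n (g 1) x"
proof -
  have "(L ^^ n) (L \<phi>) = (L ^^ Suc n) \<phi>" by (simp add: funpow_swap1)
  moreover have "(L ^^ n) (g 1) = g (Suc n)" using Ln_g[of n 1] by simp
  ultimately show ?thesis using g_pos[of "Suc n" x] by (simp add: A_def del: funpow.simps)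
qed

lemma A_conv_L:
  assumes "A_conv \<phi> l"
  shows "A_conv (L \<phi>) (lam * l)"
proof -
  have "(\<lambda>n. A (Suc n) \<phi> x0) \<longlonglongrightarrow> l" using assms unfolding A_conv_def by (rule LIMSEQ_Suc)
  from tendsto_mult[OF this A_conv_g1[unfolded A_conv_def]] show ?thesis
    unfolding A_conv_def A_L by (simp add: mult.commute)
qed

text \<open>The lower bound \<open>exp (- F0)\<close> for \<open>g 1\<close> survives averaging, by
  the maximum principle for the negative function.\<close>

lemma lam_pos: "0 < lam"
proof -
  have "exp (- F0) \<le> A n (g 1) x0" for n
  proof -
    have "A (0 + n) (\<lambda>x. - g 1 x) x0 \<le> - exp (- F0)"
    proof (rule A_between)
      show "bounded_by (exp F0) (\<lambda>x. - g 1 x)" using bounded_by_g[of 1] by (simp add: bounded_by_def)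
      show "A 0 (\<lambda>x. - g 1 x) u \<le> - exp (- F0)" for u using g_lower[of 1 u] by simp
    qed
    then show ?thesis using A_minus[OF bounded_by_g[of 1], of n x0] by simp
  qed
  then have "exp (- F0) \<le> lam" using LIMSEQ_le_const[OF A_conv_g1[unfolded A_conv_def]] by blast
  then show ?thesis using less_le_trans[OF exp_gt_zero] by blast
qed

lemma A_conv_g: "A_conv (g n) (lam ^ n)"
proof (induction n)
  case 0
  show ?case using A_conv_one by (simp add: g_def)
next
  case (Suc n)
  from A_conv_L[OF this] show ?case by (simp add: g_Suc)
qed

lemma shift_kernel_measurable: "transition_kernel (shift_kernel \<mu>)"
  unfolding shift_kernel_def
proof (rule measurable_distr_prob_space2)
  show "(\<lambda>x::nat \<Rightarrow> 'e. \<mu>) \<in> borel \<rightarrow>\<^sub>M prob_algebra borel" using mu by simp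
  show "(\<lambda>(x, a). case_nat a x) \<in> borel \<Otimes>\<^sub>M borel \<rightarrow>\<^sub>M (borel :: (nat \<Rightarrow> 'e) measure)"
    unfolding split_beta' by measurable
qed

lemma transfer_op_shift:
  assumes [measurable]: "k \<in> borel_measurable borel" "\<phi> \<in> borel_measurable borel"
  shows "transfer_op (shift_kernel \<mu>) k \<phi> x = (\<integral>a. exp (k (case_nat a x)) * \<phi> (case_nat a x) \<partial>\<mu>)"
  unfolding transfer_op_def shift_kernel_def by (rule integral_distr) measurable

lemma transfer_op_eq_L: "\<phi> \<in> borel_measurable borel \<Longrightarrow> transfer_op (shift_kernel \<mu>) f \<phi> = L \<phi>"
  by (auto simp: transfer_op_shift L_def fun_eq_iff)

lemma nn_integral_dual_shift:
  assumes [measurable]: "k \<in> borel_measurable borel" "G \<in> borel_measurable borel" and s: "sets \<eta> = sets borel"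
  shows "(\<integral>\<^sup>+y. G y \<partial>dual_op (shift_kernel \<mu>) k \<eta>) =
    (\<integral>\<^sup>+x. \<integral>\<^sup>+a. ennreal (exp (k (case_nat a x))) * G (case_nat a x) \<partial>\<mu> \<partial>\<eta>)"
  unfolding nn_integral_dual_op[OF shift_kernel_measurable assms(1) s assms(2)]
  by (intro nn_integral_cong) (simp add: shift_kernel_def nn_integral_distr)

lemma L_bounded_abs: "bounded_by B \<phi> \<Longrightarrow> \<bar>L \<phi> x\<bar> \<le> exp F0 * B"
  using bounded_byD(2)[OF bounded_by_L] .

lemma integrable_L:
  assumes \<phi>: "bounded_by B \<phi>"
  shows "integrable \<mu> (\<lambda>a. exp (f (case_nat a x)) * \<phi> (case_nat a x))"
proof (rule mu.integrable_const_bound)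
  note [measurable] = bounded_byD(1)[OF \<phi>]
  show "(\<lambda>a. exp (f (case_nat a x)) * \<phi> (case_nat a x)) \<in> borel_measurable \<mu>" by measurable
  have "\<bar>exp (f y) * \<phi> y\<bar> \<le> exp F0 * B" for y
    using f_bound[of y] bounded_byD(2)[OF \<phi>, of y] by (auto simp: abs_mult intro!: mult_mono)
  then show "AE a in \<mu>. norm (exp (f (case_nat a x)) * \<phi> (case_nat a x)) \<le> exp F0 * B" by simp
qed

text \<open>\<open>L (indicator X)\<close> need be neither a cylinder function, since
  \<open>f\<close> sees all coordinates, nor continuous. Truncation beyond the coordinates that
  determine \<open>X\<close> changes only the factor \<open>exp f\<close>, and that uniformly
  little.\<close>

lemma represented_L_indicator:
  assumes X: "X \<in> sets borel" and cyl: "\<And>x. trunc_seq x0 n x \<in> X \<longleftrightarrow> x \<in> X"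
  shows "represented (L (indicator X))"
proof (rule represented_uniform[OF bounded_by_L[OF bounded_by_indicator[OF X]]])
  fix e :: real assume "0 < e"
  define c where "c = exp F0 * (\<bar>Hf\<bar> * K\<omega>)"
  have "eventually (\<lambda>k. c * real k powr - \<epsilon> < e) sequentially"
    by (rule order_tendstoD(2)[OF tendsto_power_neg \<open>0 < e\<close>])
  with eventually_ge_at_top[of "max 1 n"]
  have "eventually (\<lambda>k. 1 \<le> k \<and> n \<le> k \<and> c * real k powr - \<epsilon> < e) sequentially" by eventually_elim simp
  then obtain k where k: "1 \<le> k" "n \<le> k" "c * real k powr - \<epsilon> < e"
    unfolding eventually_sequentially by blast
  have "\<bar>L (indicator X) (trunc_seq x0 k x) - L (indicator X) x\<bar> \<le> e" for x
  proof -
    let ?y = "trunc_seq x0 k x"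
    have ind: "indicator X (case_nat a ?y) = (indicator X (case_nat a x) :: real)" for a
    proof -
      have "trunc_seq x0 n (case_nat a ?y) = trunc_seq x0 n (case_nat a x)"
        using k(2) by (auto simp: trunc_seq_def fun_eq_iff split: nat.split)
      then have "case_nat a ?y \<in> X \<longleftrightarrow> case_nat a x \<in> X" using cyl by metis
      then show ?thesis by (simp add: indicator_def)
    qed
    have ineq: "\<bar>exp (f (case_nat a ?y)) * indicator X (case_nat a ?y) - exp (f (case_nat a x)) * indicator X (case_nat a x)\<bar>
        \<le> c * real k powr - \<epsilon>" for a
    proof -
      have "\<bar>exp (f (case_nat a ?y)) - exp (f (case_nat a x))\<bar> \<le> exp F0 * \<bar>f (case_nat a ?y) - f (case_nat a x)\<bar>"
      proof -
        have ex: "exp u - exp v \<le> exp F0 * \<bar>u - v\<bar>" if "u \<le> F0" for u v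
        proof -
          have "exp u * (1 + (v - u)) \<le> exp u * exp (v - u)" by (rule mult_left_mono[OF exp_ge_add_one_self]) simp
          also have "\<dots> = exp v" by (simp flip: exp_add)
          finally have "exp u - exp v \<le> exp u * (u - v)" unfolding distrib_left right_diff_distrib by simp
          also have "\<dots> \<le> exp u * \<bar>u - v\<bar>" by (intro mult_left_mono) auto
          also have "\<dots> \<le> exp F0 * \<bar>u - v\<bar>" using that by (intro mult_right_mono) auto
          finally show ?thesis .
        qed
        show ?thesis
          using ex[of "f (case_nat a ?y)" "f (case_nat a x)"] ex[of "f (case_nat a x)" "f (case_nat a ?y)"]
            f_bound[of "case_nat a ?y"] f_bound[of "case_nat a x"] by (simp add: abs_le_iff abs_minus_commute)
      qed
      also have "\<dots> \<le> exp F0 * (\<bar>Hf\<bar> * (K\<omega> * real k powr - \<epsilon>))"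
      proof (rule mult_left_mono)
        have "\<bar>f (case_nat a ?y) - f (case_nat a x)\<bar> \<le> Hf * \<omega> (seq_dist (case_nat a ?y) (case_nat a x))" by (rule f_holder)
        also have "\<dots> \<le> \<bar>Hf\<bar> * \<omega> (seq_dist (case_nat a ?y) (case_nat a x))"
          by (rule mult_right_mono[OF abs_ge_self omega_nonneg])
        also have "\<dots> \<le> \<bar>Hf\<bar> * \<omega> (seq_dist ?y x)"
          unfolding seq_dist_case_nat using seq_dist_nonneg[of ?y x] seq_dist_le_1[of ?y x]
          by (intro mult_left_mono omega_mono) auto
        also have "\<dots> \<le> \<bar>Hf\<bar> * (K\<omega> * real k powr - \<epsilon>)"
          by (rule mult_left_mono[OF omega_trunc[OF k(1)]]) simp
        finally show "\<bar>f (case_nat a ?y) - f (case_nat a x)\<bar> \<le> \<bar>Hf\<bar> * (K\<omega> * real k powr - \<epsilon>)" .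
      qed simp
      also have "\<dots> = c * real k powr - \<epsilon>" by (simp add: c_def)
      finally have *: "\<bar>exp (f (case_nat a ?y)) - exp (f (case_nat a x))\<bar> \<le> c * real k powr - \<epsilon>" .
      have "0 \<le> c * real k powr - \<epsilon>" using order_trans[OF abs_ge_zero *] .
      with * show ?thesis unfolding ind by (simp add: indicator_def)
    qed
    have b: "bounded_by 1 (indicator X)" by (rule bounded_by_indicator[OF X])
    have "\<bar>L (indicator X) ?y - L (indicator X) x\<bar> = \<bar>\<integral>a. exp (f (case_nat a ?y)) * indicator X (case_nat a ?y)
        - exp (f (case_nat a x)) * indicator X (case_nat a x) \<partial>\<mu>\<bar>"
      unfolding L_def using integrable_L[OF b, of ?y] integrable_L[OF b, of x] by simp
    also have "\<dots> \<le> (\<integral>a. \<bar>exp (f (case_nat a ?y)) * indicator X (case_nat a ?y)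
        - exp (f (case_nat a x)) * indicator X (case_nat a x)\<bar> \<partial>\<mu>)" by (rule integral_abs_bound)
    also have "\<dots> \<le> (\<integral>a. c * real k powr - \<epsilon> \<partial>\<mu>)"
      using integrable_L[OF b, of ?y] integrable_L[OF b, of x] ineq
      by (intro integral_mono integrable_abs Bochner_Integration.integrable_diff) auto
    also have "\<dots> = c * real k powr - \<epsilon>" using mu.prob_space by simp
    finally show ?thesis using k(3) by simp
  qed
  then show "\<exists>n. \<forall>x. \<bar>L (indicator X) (trunc_seq x0 n x) - L (indicator X) x\<bar> \<le> e" by blast
qed

text \<open>Both measures are finite, so it suffices to compare them on cylinders with rectangular
  base. There the averages of \<open>L (indicator X)\<close> have two limits, the integral against
  \<open>nu\<close> and the value from \<open>A_conv_L\<close>, which must coincide.\<close>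

lemma conformal_nu: "conformal_measure (shift_kernel \<mu>) f lam nu"
  unfolding conformal_measure_def
proof (intro conjI nu_in)
  let ?D = "dual_op (shift_kernel \<mu>) f nu"
  have sD: "sets ?D = sets borel" by (rule sets_dual_op[OF shift_kernel_measurable sets_nu])
  have val: "emeasure ?D X = ennreal (\<integral>x. L (indicator X) x \<partial>nu)" if X[measurable]: "X \<in> sets borel" for X
  proof -
    have b: "bounded_by 1 (indicator X)" by (rule bounded_by_indicator[OF X])
    have nn: "0 \<le> L (indicator X) x" for x unfolding L_def by simp
    have "emeasure ?D X = (\<integral>\<^sup>+y. indicator X y \<partial>?D)" using X by (simp add: sD)
    also have "\<dots> = (\<integral>\<^sup>+x. \<integral>\<^sup>+a. ennreal (exp (f (case_nat a x))) * indicator X (case_nat a x) \<partial>\<mu> \<partial>nu)"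
      by (rule nn_integral_dual_shift) auto
    also have "\<dots> = (\<integral>\<^sup>+x. ennreal (L (indicator X) x) \<partial>nu)"
    proof (rule nn_integral_cong)
      fix x
      have "(\<integral>\<^sup>+a. ennreal (exp (f (case_nat a x)) * indicator X (case_nat a x)) \<partial>\<mu>) = ennreal (L (indicator X) x)"
        unfolding L_def by (rule nn_integral_eq_integral[OF integrable_L[OF b]]) simp
      then show "(\<integral>\<^sup>+a. ennreal (exp (f (case_nat a x))) * indicator X (case_nat a x) \<partial>\<mu>) = ennreal (L (indicator X) x)"
        by (simp add: ennreal_mult' ennreal_indicator)
    qed
    also have "\<dots> = ennreal (\<integral>x. L (indicator X) x \<partial>nu)"
      by (rule nn_integral_eq_integral[OF integrable_nu[OF bounded_by_L[OF b]]]) (simp add: nn)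
    finally show ?thesis .
  qed
  have fin: "finite_measure ?D"
  proof
    have sp: "space ?D = UNIV" using sets_eq_imp_space_eq[OF sD] by simp
    show "emeasure ?D (space ?D) \<noteq> \<infinity>" unfolding sp by (subst val) auto
  qed
  show "?D = scale_measure (ennreal lam) nu"
  proof (rule measure_eqI_PiM_infinite[OF _ _ _ fin])
    show "sets ?D = sets (Pi\<^sub>M UNIV (\<lambda>_. borel))" by (simp add: sD sets_PiM_equal_borel)
    show "sets (scale_measure (ennreal lam) nu) = sets (Pi\<^sub>M UNIV (\<lambda>_. borel))" by (simp add: sets_PiM_equal_borel)
    fix Y :: "nat \<Rightarrow> 'e set" and J :: "nat set"
    assume J: "finite J" "J \<subseteq> UNIV" and Y: "\<And>i. i \<in> J \<Longrightarrow> Y i \<in> sets borel"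
    let ?X = "prod_emb UNIV (\<lambda>_. borel) J (Pi\<^sub>E J Y)"
    have "?X \<in> sets (Pi\<^sub>M UNIV (\<lambda>_. borel))" using J Y by (intro sets_PiM_I) auto
    then have X: "?X \<in> sets borel" by (simp add: sets_PiM_equal_borel)
    obtain n where n: "J \<subseteq> {..<n}" using J finite_nat_iff_bounded by blast
    have X_iff: "x \<in> ?X \<longleftrightarrow> (\<forall>i\<in>J. x i \<in> Y i)" for x
      by (auto simp: prod_emb_def PiE_iff)
    have cyl: "trunc_seq x0 n x \<in> ?X \<longleftrightarrow> x \<in> ?X" for x
      unfolding X_iff using n by (auto simp: trunc_seq_def)
    have rep: "represented (indicator ?X)" by (rule represented_indicator[OF X cyl])
    have "A_conv (L (indicator ?X)) (\<integral>x. L (indicator ?X) x \<partial>nu)"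
      using represented_L_indicator[OF X cyl] by (simp add: represented_def)
    moreover have "A_conv (L (indicator ?X)) (lam * (\<integral>x. indicator ?X x \<partial>nu))"
      using rep by (intro A_conv_L) (simp add: represented_def)
    ultimately have "(\<integral>x. L (indicator ?X) x \<partial>nu) = lam * (\<integral>x. indicator ?X x \<partial>nu)" by (rule A_conv_unique)
    then show "emeasure ?D ?X = emeasure (scale_measure (ennreal lam) nu) ?X"
      using X lam_pos by (simp add: val[OF X] nu.emeasure_eq_measure ennreal_mult')
  qed
qed

section \<open>The eigenfunction\<close>

text \<open>Scaled to have mean 1 for \<open>nu\<close>. Comparing a value with this mean and using
  bounded ratios confines \<open>G n\<close> between \<open>1 / \<Delta>\<close> and
  \<open>\<Delta>\<close>, uniformly in \<open>n\<close>.\<close>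

definition G :: "nat \<Rightarrow> (nat \<Rightarrow> 'e) \<Rightarrow> real" where
  "G n x = g n x / lam ^ n"

abbreviation "\<Delta> \<equiv> exp (C * \<Omega>)"

lemma integral_G: "(\<integral>x. G n x \<partial>nu) = 1"
proof -
  have "A_conv (g n) (\<integral>x. g n x \<partial>nu)"
    using represented_holder[OF bounded_by_g holder_g] by (simp add: represented_def)
  then have "(\<integral>x. g n x \<partial>nu) = lam ^ n" using A_conv_g A_conv_unique by blast
  then show ?thesis using lam_pos by (simp add: G_def)
qed

lemma G_ratio: "G n x \<le> exp (C * \<omega> (seq_dist x y)) * G n y"
  using divide_right_mono[OF g_ratio[of n x y], of "lam ^ n"] lam_pos by (simp add: G_def)

lemma G_ratio': "G n x \<le> \<Delta> * G n y"
proof -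
  have "0 \<le> G n y" using g_pos[of n y] lam_pos by (simp add: G_def)
  then have "exp (C * \<omega> (seq_dist x y)) * G n y \<le> \<Delta> * G n y"
    using C_pos omega_le by (intro mult_right_mono) auto
  then show ?thesis using G_ratio[of n x y] by linarith
qed

lemma integrable_G: "integrable nu (G n)"
  unfolding G_def[abs_def] using integrable_nu[OF bounded_by_g] by simp

lemma G_upper: "G n x \<le> \<Delta>"
proof -
  have "G n x = (\<integral>y. G n x \<partial>nu)" using nu.prob_space by simp
  also have "\<dots> \<le> (\<integral>y. \<Delta> * G n y \<partial>nu)"
    by (intro integral_mono integrable_mult_right integrable_G G_ratio') simp
  finally show ?thesis by (simp add: integral_G)
qed

lemma G_lower: "1 / \<Delta> \<le> G n x"
proof -
  have "1 = (\<integral>y. G n y \<partial>nu)" by (simp add: integral_G)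
  also have "\<dots> \<le> (\<integral>y. \<Delta> * G n x \<partial>nu)"
    by (intro integral_mono integrable_G G_ratio') simp
  also have "\<dots> = \<Delta> * G n x" using nu.prob_space by simp
  finally show ?thesis by (simp add: pos_divide_le_eq mult.commute)
qed

lemma G_pos: "0 < G n x"
  using g_pos lam_pos by (simp add: G_def)

lemma bounded_by_G: "bounded_by \<Delta> (G n)"
proof -
  have "G n \<in> borel_measurable borel" unfolding G_def[abs_def] using bounded_byD(1)[OF bounded_by_g, of n] by measurable
  then show ?thesis using G_upper G_pos[of n] by (auto simp: bounded_by_def less_imp_le)
qed

lemma holder_G: "holder (C * \<Delta>) (G n)"
  by (rule holder_of_ratio[OF bounded_by_G less_imp_le[OF G_pos] G_ratio])

text \<open>Expresses the ratio of two members of the sequence \<open>G\<close> as an average, so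
  that the rate of convergence of averages becomes a Cauchy estimate.\<close>

lemma A_G: "A m (G n) x = G (m + n) x / G m x"
proof -
  have e: "G n = (\<lambda>x. (1 / lam ^ n) * g n x)" by (simp add: G_def fun_eq_iff)
  have "A m (G n) x = (1 / lam ^ n) * A m (g n) x" unfolding e by (rule A_cmult[OF bounded_by_g])
  also have "A m (g n) x = g (m + n) x / g m x" by (simp add: A_def Ln_g)
  finally have "A m (G n) x = g (m + n) x / (lam ^ n * g m x)" by simp
  also have "\<dots> = G (m + n) x / G m x" using lam_pos by (simp add: G_def power_add)
  finally show ?thesis .
qed

text \<open>The limit functional takes the value 1 at every \<open>G n\<close>, and the sup and
  Hoelder bounds of \<open>G n\<close> do not depend on \<open>n\<close>; hence one rate serves all
  \<open>n\<close>.\<close>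

lemma G_close:
  obtains K where "0 < K" "\<And>m n x. 1 \<le> m \<Longrightarrow> \<bar>G (m + n) x - G m x\<bar> \<le> K * real m powr - \<epsilon>"
proof (rule A_rate)
  fix K assume K: "0 < K" and rate: "\<And>\<phi> B H n0 k x. bounded_by B \<phi> \<Longrightarrow> holder H (A n0 \<phi>) \<Longrightarrow> 1 \<le> k \<Longrightarrow>
      \<bar>A (n0 + k) \<phi> x - lim_A \<phi>\<bar> \<le> K * (B + H) * real k powr - \<epsilon>"
  show thesis
  proof (rule that)
    let ?K = "\<Delta> * (K * (\<Delta> + C * \<Delta>))"
    have "0 < \<Delta> + C * \<Delta>" using C_pos by (simp add: add_pos_pos)
    then show "0 < ?K" using K by simp
    fix m n x assume m: "1 \<le> (m::nat)"
    have l: "lim_A (G n) = 1"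
      using represented_holder[OF bounded_by_G holder_G, of n] integral_G[of n]
      by (intro lim_A_eq) (simp add: represented_def)
    have "\<bar>A (0 + m) (G n) x - lim_A (G n)\<bar> \<le> K * (\<Delta> + C * \<Delta>) * real m powr - \<epsilon>"
      by (rule rate[OF bounded_by_G _ m]) (simp add: holder_G)
    then have *: "\<bar>G (m + n) x / G m x - 1\<bar> \<le> K * (\<Delta> + C * \<Delta>) * real m powr - \<epsilon>"
      by (simp add: l A_G)
    have "G (m + n) x - G m x = G m x * (G (m + n) x / G m x - 1)"
      using G_pos[of m x] by (simp add: right_diff_distrib)
    then have "\<bar>G (m + n) x - G m x\<bar> = G m x * \<bar>G (m + n) x / G m x - 1\<bar>"
      using G_pos[of m x] by (simp add: abs_mult)
    also have "\<dots> \<le> \<Delta> * (K * (\<Delta> + C * \<Delta>) * real m powr - \<epsilon>)"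
      using G_pos[of m x] by (intro mult_mono G_upper *) auto
    finally show "\<bar>G (m + n) x - G m x\<bar> \<le> ?K * real m powr - \<epsilon>" by (simp only: mult.assoc)
  qed
qed

definition h :: "(nat \<Rightarrow> 'e) \<Rightarrow> real" where
  "h x = lim (\<lambda>n. G n x)"

lemma G_tendsto_h: "(\<lambda>n. G n x) \<longlonglongrightarrow> h x"
proof (rule G_close)
  fix K assume close: "\<And>m n x. 1 \<le> m \<Longrightarrow> \<bar>G (m + n) x - G m x\<bar> \<le> K * real m powr - \<epsilon>"
  have "Cauchy (\<lambda>n. G n x)" by (rule Cauchy_power_rate[where c = K]) (rule close)
  then have "convergent (\<lambda>n. G n x)" by (rule Cauchy_convergent)
  then show ?thesis unfolding h_def by (simp add: convergent_LIMSEQ_iff)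
qed

lemma h_close:
  obtains K where "0 < K" "\<And>m x. 1 \<le> m \<Longrightarrow> \<bar>h x - G m x\<bar> \<le> K * real m powr - \<epsilon>"
proof (rule G_close)
  fix K assume K: "0 < K" and close: "\<And>m n x. 1 \<le> m \<Longrightarrow> \<bar>G (m + n) x - G m x\<bar> \<le> K * real m powr - \<epsilon>"
  show thesis
  proof (rule that[OF K])
    fix m x assume m: "1 \<le> (m::nat)"
    have "(\<lambda>n. G (n + m) x) \<longlonglongrightarrow> h x" by (rule LIMSEQ_ignore_initial_segment[OF G_tendsto_h])
    from tendsto_rabs[OF tendsto_diff[OF this tendsto_const]]
    have lim: "(\<lambda>n. \<bar>G (n + m) x - G m x\<bar>) \<longlonglongrightarrow> \<bar>h x - G m x\<bar>" .
    have le: "\<bar>G (n + m) x - G m x\<bar> \<le> K * real m powr - \<epsilon>" for n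
      using close[OF m, of n x] unfolding add.commute[of n m] .
    show "\<bar>h x - G m x\<bar> \<le> K * real m powr - \<epsilon>"
      by (rule LIMSEQ_le_const2[OF lim]) (intro exI[of _ 0] allI impI le)
  qed
qed

lemma h_upper: "h x \<le> \<Delta>"
  by (rule LIMSEQ_le_const2[OF G_tendsto_h]) (intro exI[of _ 0] allI impI G_upper)

lemma h_lower: "1 / \<Delta> \<le> h x"
  by (rule LIMSEQ_le_const[OF G_tendsto_h]) (intro exI[of _ 0] allI impI G_lower)

lemma h_pos: "0 < h x"
  using h_lower[of x] less_le_trans[of 0 "1 / \<Delta>"] by simp

lemma holder_h: "holder (C * \<Delta>) h"
  unfolding holder_def
proof (intro conjI allI)
  show "0 \<le> C * \<Delta>" using C_pos by simp
  fix x y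
  have lim: "(\<lambda>n. \<bar>G n x - G n y\<bar>) \<longlonglongrightarrow> \<bar>h x - h y\<bar>"
    by (rule tendsto_rabs[OF tendsto_diff[OF G_tendsto_h G_tendsto_h]])
  have le: "\<bar>G n x - G n y\<bar> \<le> C * \<Delta> * \<omega> (seq_dist x y)" for n
    using holder_G[of n] by (simp add: holder_def)
  show "\<bar>h x - h y\<bar> \<le> C * \<Delta> * \<omega> (seq_dist x y)"
    by (rule LIMSEQ_le_const2[OF lim]) (intro exI[of _ 0] allI impI le)
qed

lemma bounded_by_h: "bounded_by \<Delta> h"
proof -
  have "h \<in> borel_measurable borel"
    by (rule holder_measurable[where H = "C * \<Delta>"]) (use holder_h in \<open>simp add: holder_def\<close>)
  then show ?thesis using h_upper h_pos by (auto simp: bounded_by_def less_imp_le)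
qed

lemma h_measurable[measurable]: "h \<in> borel_measurable borel"
  using bounded_by_h by (rule bounded_byD)

lemma bounded_by_h_diff:
  "(\<And>x. \<bar>h x - G m x\<bar> \<le> e) \<Longrightarrow> bounded_by e (\<lambda>x. h x - G m x)"
  using bounded_byD(1)[OF bounded_by_G, of m] by (auto simp: bounded_by_def)

text \<open>\<open>L\<close> maps \<open>G m\<close> to \<open>lam\<close> times
  \<open>G (Suc m)\<close> and is continuous in the sup norm, in which \<open>G m\<close> tends to
  \<open>h\<close>.\<close>

lemma L_h: "L h x = lam * h x"
proof (rule h_close)
  fix K assume K: "\<And>m x. 1 \<le> m \<Longrightarrow> \<bar>h x - G m x\<bar> \<le> K * real m powr - \<epsilon>"
  have LG: "L (G m) x = lam * G (Suc m) x" for m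
  proof -
    have "L (G m) x = L (g m) x / lam ^ m" by (simp add: L_def G_def)
    then show ?thesis using lam_pos by (simp add: G_def g_Suc)
  qed
  have "(\<lambda>m. L h x - L (G m) x) \<longlonglongrightarrow> 0"
  proof (rule Lim_null_comparison)
    show "(\<lambda>m. exp F0 * K * real m powr - \<epsilon>) \<longlonglongrightarrow> 0" by (rule tendsto_power_neg)
    show "eventually (\<lambda>m. norm (L h x - L (G m) x) \<le> exp F0 * K * real m powr - \<epsilon>) sequentially"
      using eventually_ge_at_top[of 1]
    proof eventually_elim
      case (elim m)
      have b: "bounded_by (K * real m powr - \<epsilon>) (\<lambda>x. h x - G m x)" by (rule bounded_by_h_diff[OF K[OF elim]])
      have "L (\<lambda>x. h x - G m x) x = L h x - L (G m) x"
        unfolding L_def right_diff_distrib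
        by (rule Bochner_Integration.integral_diff[OF integrable_L[OF bounded_by_h] integrable_L[OF bounded_by_G]])
      then show ?case using L_bounded_abs[OF b, of x] by simp
    qed
  qed
  from tendsto_diff[OF tendsto_const[of "L h x"] this] have "(\<lambda>m. L (G m) x) \<longlonglongrightarrow> L h x" by simp
  moreover have "(\<lambda>m. L (G m) x) \<longlonglongrightarrow> lam * h x"
    unfolding LG by (rule tendsto_mult_left[OF LIMSEQ_Suc[OF G_tendsto_h]])
  ultimately show ?thesis by (rule LIMSEQ_unique)
qed

lemma integral_h: "(\<integral>x. h x \<partial>nu) = 1"
proof -
  have "(\<lambda>n. \<integral>x. G n x \<partial>nu) \<longlonglongrightarrow> (\<integral>x. h x \<partial>nu)"
  proof (rule integral_dominated_convergence[where w = "\<lambda>_. \<Delta>"])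
    show "AE x in nu. norm (G n x) \<le> \<Delta>" for n using bounded_byD(2)[OF bounded_by_G] by simp
    show "G n \<in> borel_measurable nu" for n
      using bounded_byD(1)[OF bounded_by_G] by (simp add: measurable_cong_sets[OF sets_nu refl])
  qed (auto simp: G_tendsto_h)
  then show ?thesis by (simp add: integral_G LIMSEQ_const_iff)
qed

end

section \<open>The normalized potential and decay of correlations\<close>

context shift_potential
begin

definition fbar :: "(nat \<Rightarrow> 'e) \<Rightarrow> real" where
  "fbar x = f x + ln (h x) - ln (h (seq_shift x)) - ln lam"

definition Lbar :: "((nat \<Rightarrow> 'e) \<Rightarrow> real) \<Rightarrow> (nat \<Rightarrow> 'e) \<Rightarrow> real" where
  "Lbar = transfer_op (shift_kernel \<mu>) fbar"

definition mu_f :: "(nat \<Rightarrow> 'e) measure" where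
  "mu_f = density nu (\<lambda>x. ennreal (h x))"

lemma seq_shift_case_nat[simp]: "seq_shift (case_nat a x) = x"
  by (simp add: seq_shift_def)

lemma measurable_seq_shift[measurable]: "seq_shift \<in> borel \<rightarrow>\<^sub>M (borel :: (nat \<Rightarrow> 'e) measure)"
  by (rule measurable_coordinatewise_then_product)
    (simp add: seq_shift_def borel_measurable_continuous_onI)

lemma measurable_seq_shift_pow[measurable]: "(seq_shift ^^ n) \<in> borel \<rightarrow>\<^sub>M (borel :: (nat \<Rightarrow> 'e) measure)"
  by (induction n) (auto intro: measurable_comp[OF _ measurable_seq_shift] simp: id_def[symmetric])

lemma fbar_measurable[measurable]: "fbar \<in> borel_measurable borel"
  unfolding fbar_def[abs_def] by measurable

text \<open>\<open>seq_shift\<close> undoes the prepending, so the coboundary becomes the quotient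
  of \<open>h\<close> at \<open>case_nat a x\<close> and at \<open>x\<close>.\<close>

lemma exp_fbar: "exp (fbar (case_nat a x)) = exp (f (case_nat a x)) * h (case_nat a x) / (lam * h x)"
  using h_pos[of "case_nat a x"] h_pos[of x] lam_pos
  by (simp add: fbar_def exp_add exp_diff mult.commute)

lemma bounded_fbar: "bounded (range fbar)"
proof (rule boundedI)
  fix y assume "y \<in> range fbar"
  then obtain x where y: "y = fbar x" by auto
  have ln_h: "\<bar>ln (h z)\<bar> \<le> C * \<Omega>" for z
  proof -
    have "ln (h z) \<le> ln \<Delta>" using h_upper h_pos by (subst ln_le_cancel_iff) auto
    moreover have "ln (1 / \<Delta>) \<le> ln (h z)" using h_lower h_pos by (subst ln_le_cancel_iff) auto
    ultimately show ?thesis by (simp add: ln_div)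
  qed
  show "norm y \<le> F0 + C * \<Omega> + C * \<Omega> + \<bar>ln lam\<bar>"
    using f_bound[of x] ln_h[of x] ln_h[of "seq_shift x"] unfolding y fbar_def real_norm_def by arith
qed

lemma bounded_by_h_mult:
  assumes "bounded_by s \<phi>"
  shows "bounded_by (\<Delta> * s) (\<lambda>x. h x * \<phi> x)"
  unfolding bounded_by_def
proof (intro conjI allI)
  note [measurable] = bounded_byD(1)[OF assms]
  show "(\<lambda>x. h x * \<phi> x) \<in> borel_measurable borel" by measurable
  show "\<bar>h x * \<phi> x\<bar> \<le> \<Delta> * s" for x
    unfolding abs_mult using bounded_byD(2)[OF bounded_by_h] bounded_byD(2)[OF assms] by (intro mult_mono) auto
qed

lemma holder_h_mult:
  assumes s: "bounded_by s \<phi>" and H: "holder H \<phi>"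
  shows "holder (\<Delta> * H + C * \<Delta> * s) (\<lambda>x. h x * \<phi> x)"
  unfolding holder_def
proof (intro conjI allI)
  show "0 \<le> \<Delta> * H + C * \<Delta> * s" using H C_pos bounded_by_nonneg[OF s] by (simp add: holder_def)
  fix x y
  have "h x * \<phi> x - h y * \<phi> y = h x * (\<phi> x - \<phi> y) + (h x - h y) * \<phi> y" by algebra
  then have "\<bar>h x * \<phi> x - h y * \<phi> y\<bar> \<le> \<bar>h x\<bar> * \<bar>\<phi> x - \<phi> y\<bar> + \<bar>h x - h y\<bar> * \<bar>\<phi> y\<bar>"
    by (metis abs_mult abs_triangle_ineq)
  also have "\<dots> \<le> \<Delta> * (H * \<omega> (seq_dist x y)) + (C * \<Delta> * \<omega> (seq_dist x y)) * s"
  proof (intro add_mono mult_mono)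
    show "\<bar>h x\<bar> \<le> \<Delta>" using bounded_byD(2)[OF bounded_by_h] .
    show "\<bar>\<phi> x - \<phi> y\<bar> \<le> H * \<omega> (seq_dist x y)" using H by (simp add: holder_def)
    show "\<bar>h x - h y\<bar> \<le> C * \<Delta> * \<omega> (seq_dist x y)" using holder_h by (simp add: holder_def)
    show "\<bar>\<phi> y\<bar> \<le> s" using bounded_byD(2)[OF s] .
    show "0 \<le> C * \<Delta> * \<omega> (seq_dist x y)" by (intro mult_nonneg_nonneg omega_nonneg) (use C_pos in auto)
  qed auto
  also have "\<dots> = (\<Delta> * H + C * \<Delta> * s) * \<omega> (seq_dist x y)" by algebra
  finally show "\<bar>h x * \<phi> x - h y * \<phi> y\<bar> \<le> (\<Delta> * H + C * \<Delta> * s) * \<omega> (seq_dist x y)" .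
qed

lemma Lbar_eq:
  assumes [measurable]: "\<phi> \<in> borel_measurable borel"
  shows "Lbar \<phi> x = L (\<lambda>y. h y * \<phi> y) x / (lam * h x)"
  unfolding Lbar_def transfer_op_shift[OF fbar_measurable assms] L_def exp_fbar
  by (simp add: mult.assoc)

text \<open>The weights are positive and have total mass 1 by \<open>L_h\<close>.\<close>

lemma bounded_by_Lbar:
  assumes \<phi>: "bounded_by s \<phi>"
  shows "bounded_by s (Lbar \<phi>)"
  unfolding bounded_by_def
proof (intro conjI allI)
  have [measurable]: "L (\<lambda>y. h y * \<phi> y) \<in> borel_measurable borel"
    by (rule bounded_byD(1)[OF bounded_by_L[OF bounded_by_h_mult[OF \<phi>]]])
  show "Lbar \<phi> \<in> borel_measurable borel"
    unfolding Lbar_eq[OF bounded_byD(1)[OF \<phi>], abs_def] by measurable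
  fix x
  have "\<bar>L (\<lambda>y. h y * \<phi> y) x\<bar> \<le> (\<integral>a. \<bar>exp (f (case_nat a x)) * (h (case_nat a x) * \<phi> (case_nat a x))\<bar> \<partial>\<mu>)"
    unfolding L_def by (rule integral_abs_bound)
  also have "\<dots> \<le> (\<integral>a. s * (exp (f (case_nat a x)) * h (case_nat a x)) \<partial>\<mu>)"
  proof (intro integral_mono integrable_abs integrable_mult_right
      integrable_L[OF bounded_by_h_mult[OF \<phi>]] integrable_L[OF bounded_by_h])
    fix a
    have "\<bar>\<phi> (case_nat a x)\<bar> * (exp (f (case_nat a x)) * h (case_nat a x)) \<le> s * (exp (f (case_nat a x)) * h (case_nat a x))"
      using h_pos[of "case_nat a x"] by (intro mult_right_mono bounded_byD(2)[OF \<phi>]) auto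
    then show "\<bar>exp (f (case_nat a x)) * (h (case_nat a x) * \<phi> (case_nat a x))\<bar> \<le> s * (exp (f (case_nat a x)) * h (case_nat a x))"
      using h_pos[of "case_nat a x"] by (simp add: abs_mult mult_ac)
  qed
  also have "\<dots> = s * (lam * h x)" using L_h[of x] by (simp add: L_def)
  finally show "\<bar>Lbar \<phi> x\<bar> \<le> s"
    using lam_pos h_pos[of x] by (simp add: Lbar_eq[OF bounded_byD(1)[OF \<phi>]] abs_mult pos_divide_le_eq)
qed

lemma bounded_by_Lbar_pow: "bounded_by s \<phi> \<Longrightarrow> bounded_by s ((Lbar ^^ n) \<phi>)"
  by (induction n) (auto intro: bounded_by_Lbar)

lemma Lbar_pow_eq:
  assumes \<phi>: "bounded_by s \<phi>"
  shows "(Lbar ^^ n) \<phi> x = (L ^^ n) (\<lambda>y. h y * \<phi> y) x / (lam ^ n * h x)"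
proof (induction n arbitrary: x)
  case 0
  show ?case using h_pos[of x] by simp
next
  case (Suc n)
  have "(Lbar ^^ Suc n) \<phi> x = L (\<lambda>y. h y * (Lbar ^^ n) \<phi> y) x / (lam * h x)"
    using Lbar_eq[OF bounded_byD(1)[OF bounded_by_Lbar_pow[OF \<phi>]]] by simp
  also have "(\<lambda>y. h y * (Lbar ^^ n) \<phi> y) = (\<lambda>y. (L ^^ n) (\<lambda>y. h y * \<phi> y) y / lam ^ n)"
  proof
    fix y show "h y * (Lbar ^^ n) \<phi> y = (L ^^ n) (\<lambda>y. h y * \<phi> y) y / lam ^ n"
      unfolding Suc.IH using h_pos[of y] by simp
  qed
  also have "L (\<lambda>y. (L ^^ n) (\<lambda>y. h y * \<phi> y) y / lam ^ n) x = (L ^^ Suc n) (\<lambda>y. h y * \<phi> y) x / lam ^ n"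
    by (simp add: L_def)
  finally show ?case by (simp add: mult_ac)
qed

lemma normalized_fbar: "normalized (shift_kernel \<mu>) fbar"
proof -
  have "Lbar (\<lambda>_. 1) x = 1" for x
    using L_h[of x] lam_pos h_pos[of x] by (simp add: Lbar_eq)
  then show ?thesis by (simp add: normalized_def Lbar_def fun_eq_iff)
qed

section \<open>The stationary measure and the decay of the normalized iterates\<close>

lemma sets_mu_f[measurable_cong, simp]: "sets mu_f = sets borel"
  by (simp add: mu_f_def)

lemma nn_integral_mu_f:
  assumes [measurable]: "\<psi> \<in> borel_measurable borel"
  shows "(\<integral>\<^sup>+x. \<psi> x \<partial>mu_f) = (\<integral>\<^sup>+x. ennreal (h x) * \<psi> x \<partial>nu)"
  unfolding mu_f_def by (rule nn_integral_density) measurable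

lemma integral_mu_f:
  assumes [measurable]: "\<psi> \<in> borel_measurable borel"
  shows "(\<integral>x. \<psi> x \<partial>mu_f) = (\<integral>x. h x * \<psi> x \<partial>nu)"
  unfolding mu_f_def by (subst integral_density) (auto simp: h_pos less_imp_le)

lemma mu_f_in: "mu_f \<in> borel_probs"
proof -
  have "emeasure mu_f (space mu_f) = (\<integral>\<^sup>+x. 1 \<partial>mu_f)" by simp
  also have "\<dots> = (\<integral>\<^sup>+x. ennreal (h x) \<partial>nu)" by (subst nn_integral_mu_f) auto
  also have "\<dots> = ennreal (\<integral>x. h x \<partial>nu)"
    by (rule nn_integral_eq_integral[OF integrable_nu[OF bounded_by_h]]) (simp add: h_pos less_imp_le)
  finally show ?thesis using integral_h by (auto simp: space_prob_algebra intro!: prob_spaceI)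
qed

sublocale muf: prob_space mu_f
  using mu_f_in by (simp add: space_prob_algebra)

text \<open>The density \<open>h x\<close> cancels the denominator in \<open>exp_fbar\<close>. What
  remains is \<open>1 / lam\<close> times the dual of \<open>L\<close> at \<open>nu\<close>, tested
  against \<open>h\<close> times the indicator, and conformality of \<open>nu\<close> removes
  \<open>lam\<close>.\<close>

lemma stationary_mu_f: "stationary (shift_kernel \<mu>) fbar mu_f"
  unfolding stationary_def
proof (intro conjI mu_f_in)
  let ?D = "dual_op (shift_kernel \<mu>) fbar mu_f"
  have sD: "sets ?D = sets borel" by (rule sets_dual_op[OF shift_kernel_measurable sets_mu_f])
  show "?D = mu_f"
  proof (rule measure_eqI)
    fix X assume "X \<in> sets ?D"
    then have X[measurable]: "X \<in> sets borel" by (simp add: sD)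
    have "emeasure ?D X = (\<integral>\<^sup>+y. indicator X y \<partial>?D)" by (simp add: sD)
    also have "\<dots> = (\<integral>\<^sup>+x. \<integral>\<^sup>+a. ennreal (exp (fbar (case_nat a x))) * indicator X (case_nat a x) \<partial>\<mu> \<partial>mu_f)"
      by (rule nn_integral_dual_shift) auto
    also have "\<dots> = (\<integral>\<^sup>+x. ennreal (h x) * (\<integral>\<^sup>+a. ennreal (exp (fbar (case_nat a x))) * indicator X (case_nat a x) \<partial>\<mu>) \<partial>nu)"
      by (rule nn_integral_mu_f) measurable
    also have "\<dots> = (\<integral>\<^sup>+x. ennreal (1 / lam) * (\<integral>\<^sup>+a. ennreal (exp (f (case_nat a x))) * (ennreal (h (case_nat a x)) * indicator X (case_nat a x)) \<partial>\<mu>) \<partial>nu)"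
    proof (rule nn_integral_cong)
      fix x
      have "ennreal (h x) * (ennreal (exp (fbar (case_nat a x))) * indicator X (case_nat a x)) =
          ennreal (1 / lam) * (ennreal (exp (f (case_nat a x))) * (ennreal (h (case_nat a x)) * indicator X (case_nat a x)))" for a
      proof -
        have "h x * exp (fbar (case_nat a x)) = 1 / lam * (exp (f (case_nat a x)) * h (case_nat a x))"
          unfolding exp_fbar using h_pos[of x] by simp
        then have "ennreal (h x) * ennreal (exp (fbar (case_nat a x))) = ennreal (1 / lam) * (ennreal (exp (f (case_nat a x))) * ennreal (h (case_nat a x)))"
          using h_pos lam_pos by (simp add: less_imp_le flip: ennreal_mult)
        then show ?thesis by (simp add: mult.assoc[symmetric])
      qed
      then show "ennreal (h x) * (\<integral>\<^sup>+a. ennreal (exp (fbar (case_nat a x))) * indicator X (case_nat a x) \<partial>\<mu>) =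
        ennreal (1 / lam) * (\<integral>\<^sup>+a. ennreal (exp (f (case_nat a x))) * (ennreal (h (case_nat a x)) * indicator X (case_nat a x)) \<partial>\<mu>)"
        by (simp flip: nn_integral_cmult)
    qed
    also have "\<dots> = ennreal (1 / lam) * (\<integral>\<^sup>+x. (\<integral>\<^sup>+a. ennreal (exp (f (case_nat a x))) * (ennreal (h (case_nat a x)) * indicator X (case_nat a x)) \<partial>\<mu>) \<partial>nu)"
      by (rule nn_integral_cmult) measurable
    also have "(\<integral>\<^sup>+x. (\<integral>\<^sup>+a. ennreal (exp (f (case_nat a x))) * (ennreal (h (case_nat a x)) * indicator X (case_nat a x)) \<partial>\<mu>) \<partial>nu)
        = (\<integral>\<^sup>+y. ennreal (h y) * indicator X y \<partial>dual_op (shift_kernel \<mu>) f nu)"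
      by (rule nn_integral_dual_shift[symmetric]) auto
    also have "dual_op (shift_kernel \<mu>) f nu = scale_measure (ennreal lam) nu"
      using conformal_nu by (simp add: conformal_measure_def)
    also have "(\<integral>\<^sup>+y. ennreal (h y) * indicator X y \<partial>scale_measure (ennreal lam) nu) = ennreal lam * emeasure mu_f X"
      using nn_integral_mu_f[of "indicator X"] by (subst nn_integral_scale_measure) auto
    also have "ennreal (1 / lam) * (ennreal lam * emeasure mu_f X) = emeasure mu_f X"
      using lam_pos by (simp flip: mult.assoc ennreal_mult)
    finally show "emeasure ?D X = emeasure mu_f X" .
  qed (simp add: sD)
qed

text \<open>The iterate is \<open>A n\<close> of \<open>h\<close> times \<open>\<phi>\<close>,
  multiplied by \<open>G n / h\<close>, which is at most \<open>\<Delta> * \<Delta>\<close>. The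
  limit of these averages is the integral of \<open>\<phi>\<close> against \<open>mu_f\<close>, so
  it is 0.\<close>

lemma Lbar_decay:
  obtains K where "0 < K"
    "\<And>\<phi> s H n x. bounded_by s \<phi> \<Longrightarrow> holder H \<phi> \<Longrightarrow> (\<integral>x. \<phi> x \<partial>mu_f) = 0 \<Longrightarrow> 1 \<le> n \<Longrightarrow>
      \<bar>(Lbar ^^ n) \<phi> x\<bar> \<le> K * (s + H) * real n powr - \<epsilon>"
proof (rule A_rate)
  fix K assume K: "0 < K" and rate: "\<And>\<phi> B H n0 k x. bounded_by B \<phi> \<Longrightarrow> holder H (A n0 \<phi>) \<Longrightarrow> 1 \<le> k \<Longrightarrow>
      \<bar>A (n0 + k) \<phi> x - lim_A \<phi>\<bar> \<le> K * (B + H) * real k powr - \<epsilon>"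
  show thesis
  proof (rule that)
    show "0 < K * (\<Delta> * (1 + C)) * (\<Delta> * \<Delta>)" using K C_pos by (simp add: add_pos_pos)
    fix \<phi> s H n x assume \<phi>: "bounded_by s \<phi>" "holder H \<phi>" "(\<integral>x. \<phi> x \<partial>mu_f) = 0" and n: "1 \<le> (n::nat)"
    let ?\<phi> = "\<lambda>x. h x * \<phi> x"
    have H0: "0 \<le> H" using \<phi>(2) by (simp add: holder_def)
    have S0: "0 \<le> s" by (rule bounded_by_nonneg[OF \<phi>(1)])
    have b: "bounded_by (\<Delta> * s) ?\<phi>" by (rule bounded_by_h_mult[OF \<phi>(1)])
    have hh: "holder (\<Delta> * H + C * \<Delta> * s) ?\<phi>" by (rule holder_h_mult[OF \<phi>(1,2)])
    have "(\<integral>x. ?\<phi> x \<partial>nu) = 0" using \<phi>(3) integral_mu_f[OF bounded_byD(1)[OF \<phi>(1)]] by simp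
    then have l: "lim_A ?\<phi> = 0" using represented_holder[OF b hh] by (intro lim_A_eq) (simp add: represented_def)
    have "\<bar>A (0 + n) ?\<phi> x - lim_A ?\<phi>\<bar> \<le> K * (\<Delta> * s + (\<Delta> * H + C * \<Delta> * s)) * real n powr - \<epsilon>"
      by (rule rate[OF b _ n]) (simp add: hh)
    then have *: "\<bar>A n ?\<phi> x\<bar> \<le> K * (\<Delta> * s + (\<Delta> * H + C * \<Delta> * s)) * real n powr - \<epsilon>" by (simp add: l)
    have "\<Delta> * s + (\<Delta> * H + C * \<Delta> * s) \<le> \<Delta> * (1 + C) * (s + H)"
    proof -
      have "\<Delta> * (1 + C) * (s + H) = \<Delta> * s + (\<Delta> * H + C * \<Delta> * s) + C * \<Delta> * H" by algebra
      moreover have "0 \<le> C * \<Delta> * H" using C_pos H0 by simp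
      ultimately show ?thesis by linarith
    qed
    then have "K * (\<Delta> * s + (\<Delta> * H + C * \<Delta> * s)) * real n powr - \<epsilon> \<le> K * (\<Delta> * (1 + C) * (s + H)) * real n powr - \<epsilon>"
      using K by (intro mult_right_mono mult_left_mono) auto
    with * have A: "\<bar>A n ?\<phi> x\<bar> \<le> K * (\<Delta> * (1 + C) * (s + H)) * real n powr - \<epsilon>" by linarith
    have "(Lbar ^^ n) \<phi> x = A n ?\<phi> x * (G n x * (1 / h x))"
      using g_pos[of n x] by (simp add: Lbar_pow_eq[OF \<phi>(1)] A_def G_def)
    then have "\<bar>(Lbar ^^ n) \<phi> x\<bar> = \<bar>A n ?\<phi> x\<bar> * (G n x * (1 / h x))"
      using G_pos[of n x] h_pos[of x] by (simp add: abs_mult)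
    also have "\<dots> \<le> (K * (\<Delta> * (1 + C) * (s + H)) * real n powr - \<epsilon>) * (\<Delta> * \<Delta>)"
    proof (intro mult_mono A G_upper)
      show "1 / h x \<le> \<Delta>" using h_lower[of x] h_pos[of x] by (simp add: field_simps)
    qed (use G_pos[of n x] h_pos[of x] K C_pos S0 H0 in auto)
    finally show "\<bar>(Lbar ^^ n) \<phi> x\<bar> \<le> K * (\<Delta> * (1 + C)) * (\<Delta> * \<Delta>) * (s + H) * real n powr - \<epsilon>"
      by (simp only: mult_ac)
  qed
qed

lemma integrable_mu_f: "bounded_by B \<phi> \<Longrightarrow> integrable mu_f \<phi>"
  by (rule muf.integrable_const_bound[where B = B])
    (auto simp: bounded_by_def measurable_cong_sets[OF sets_mu_f refl])

section \<open>Correlations\<close>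

lemma integral_Lbar:
  assumes \<phi>: "bounded_by B \<phi>"
  shows "(\<integral>x. Lbar \<phi> x \<partial>mu_f) = (\<integral>x. \<phi> x \<partial>mu_f)"
proof -
  have "bounded (range \<phi>)" using bounded_byD(2)[OF \<phi>] by (auto intro!: boundedI[where B = B])
  then have "(\<integral>x. \<phi> x \<partial>dual_op (shift_kernel \<mu>) fbar mu_f) = (\<integral>x. Lbar \<phi> x \<partial>mu_f)"
    unfolding Lbar_def
    by (intro integral_dual_op shift_kernel_measurable bounded_fbar bounded_byD(1)[OF \<phi>] muf.finite_measure) auto
  then show ?thesis using stationary_mu_f by (simp add: stationary_def)
qed

text \<open>After prepending a letter, \<open>\<psi> \<circ> seq_shift\<close> does not depend on
  that letter and leaves the integral.\<close>

lemma Lbar_mult_shift: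
  assumes \<phi>: "bounded_by s \<phi>" and \<psi>: "bounded_by B \<psi>"
  shows "Lbar (\<lambda>x. \<phi> x * \<psi> (seq_shift x)) x = Lbar \<phi> x * \<psi> x"
proof -
  note [measurable] = bounded_byD(1)[OF \<phi>] bounded_byD(1)[OF \<psi>]
  have "(\<lambda>x. \<phi> x * \<psi> (seq_shift x)) \<in> borel_measurable borel" by measurable
  then show ?thesis
    unfolding Lbar_def by (simp add: transfer_op_shift flip: mult.assoc)
qed

lemma bounded_by_shift:
  fixes \<psi> :: "(nat \<Rightarrow> 'e) \<Rightarrow> real"
  shows "bounded_by B \<psi> \<Longrightarrow> bounded_by B (\<lambda>x. \<psi> ((seq_shift ^^ n) x))"
  using measurable_compose[OF measurable_seq_shift_pow[of n], of \<psi> borel] by (simp add: bounded_by_def)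

lemma bounded_by_mult: "bounded_by s \<phi> \<Longrightarrow> bounded_by B \<psi> \<Longrightarrow> bounded_by (s * B) (\<lambda>x. \<phi> x * \<psi> x)"
  by (auto simp: bounded_by_def abs_mult intro!: mult_mono' order_trans[OF abs_ge_zero])

lemma integral_correlation:
  assumes \<phi>: "bounded_by s \<phi>" and \<psi>: "bounded_by B \<psi>"
  shows "(\<integral>x. \<phi> x * \<psi> ((seq_shift ^^ n) x) \<partial>mu_f) = (\<integral>x. (Lbar ^^ n) \<phi> x * \<psi> x \<partial>mu_f)"
  using \<phi>
proof (induction n arbitrary: \<phi>)
  case (Suc n)
  let ?\<psi> = "\<lambda>x. \<psi> ((seq_shift ^^ n) x)"
  have b: "bounded_by B ?\<psi>" by (rule bounded_by_shift[OF \<psi>])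
  have "bounded_by B (\<lambda>x. ?\<psi> ((seq_shift ^^ 1) x))" by (rule bounded_by_shift[OF b])
  then have b': "bounded_by B (\<lambda>x. ?\<psi> (seq_shift x))" by simp
  have "(\<integral>x. \<phi> x * \<psi> ((seq_shift ^^ Suc n) x) \<partial>mu_f) = (\<integral>x. \<phi> x * ?\<psi> (seq_shift x) \<partial>mu_f)"
    by (simp add: funpow_swap1)
  also have "\<dots> = (\<integral>x. Lbar (\<lambda>x. \<phi> x * ?\<psi> (seq_shift x)) x \<partial>mu_f)"
    by (rule integral_Lbar[symmetric, OF bounded_by_mult[OF Suc.prems b']])
  also have "\<dots> = (\<integral>x. Lbar \<phi> x * ?\<psi> x \<partial>mu_f)"
    by (simp only: Lbar_mult_shift[OF Suc.prems b])
  also have "\<dots> = (\<integral>x. (Lbar ^^ n) (Lbar \<phi>) x * \<psi> x \<partial>mu_f)"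
    by (rule Suc.IH[OF bounded_by_Lbar[OF Suc.prems]])
  finally show ?case by (simp add: funpow_swap1)
qed simp

lemma Lbar_pow_one: "(Lbar ^^ n) (\<lambda>_. 1) = (\<lambda>_. 1)"
  using normalized_fbar by (induction n) (auto simp: normalized_def Lbar_def)

text \<open>Invariance under the shift is the correlation identity for the constant function 1,
  which \<open>Lbar\<close> fixes.\<close>

lemma distr_mu_f: "distr mu_f borel (seq_shift ^^ n) = mu_f"
proof (rule measure_eqI)
  fix X assume "X \<in> sets (distr mu_f borel (seq_shift ^^ n))"
  then have X[measurable]: "X \<in> sets borel" by simp
  have m: "(seq_shift ^^ n) \<in> mu_f \<rightarrow>\<^sub>M borel" by measurable
  interpret D: prob_space "distr mu_f borel (seq_shift ^^ n)" by (rule muf.prob_space_distr[OF m])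
  have "measure (distr mu_f borel (seq_shift ^^ n)) X = (\<integral>x. indicator X x \<partial>distr mu_f borel (seq_shift ^^ n))"
    by simp
  also have "\<dots> = (\<integral>x. 1 * indicator X ((seq_shift ^^ n) x) \<partial>mu_f)"
    using m by (subst integral_distr) auto
  also have "\<dots> = (\<integral>x. (Lbar ^^ n) (\<lambda>_. 1) x * indicator X x \<partial>mu_f)"
    by (rule integral_correlation[OF bounded_by_1 bounded_by_indicator[OF X]])
  also have "\<dots> = measure mu_f X" using X by (simp add: Lbar_pow_one)
  finally show "emeasure (distr mu_f borel (seq_shift ^^ n)) X = emeasure mu_f X"
    by (simp add: D.emeasure_eq_measure muf.emeasure_eq_measure)
qed simp

lemma integrable_shift:
  assumes \<psi>: "integrable mu_f (\<psi> :: (nat \<Rightarrow> 'e) \<Rightarrow> real)"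
  shows "integrable mu_f (\<lambda>x. \<psi> ((seq_shift ^^ n) x))" "(\<integral>x. \<psi> ((seq_shift ^^ n) x) \<partial>mu_f) = (\<integral>x. \<psi> x \<partial>mu_f)"
proof -
  have m: "(seq_shift ^^ n) \<in> mu_f \<rightarrow>\<^sub>M borel" by measurable
  have \<psi>m: "\<psi> \<in> borel_measurable borel" using \<psi> by (auto simp: measurable_cong_sets[OF sets_mu_f refl])
  show "integrable mu_f (\<lambda>x. \<psi> ((seq_shift ^^ n) x))"
    by (rule integrable_distr[OF m]) (simp add: distr_mu_f \<psi>)
  show "(\<integral>x. \<psi> ((seq_shift ^^ n) x) \<partial>mu_f) = (\<integral>x. \<psi> x \<partial>mu_f)"
    using integral_distr[OF m \<psi>m] by (simp add: distr_mu_f)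
qed

text \<open>Duality moves the \<open>n\<close> shifts from \<open>\<psi>\<close> to \<open>n\<close>
  iterates on \<open>\<phi>\<close>, where the sup bound \<open>c\<close> is available; so only the
  L^1 norm of \<open>\<psi>\<close> remains.\<close>

lemma correlation_bound:
  assumes \<phi>: "bounded_by s \<phi>" and c: "\<And>x. \<bar>(Lbar ^^ n) \<phi> x\<bar> \<le> c" and \<psi>: "integrable mu_f \<psi>"
  shows "\<bar>\<integral>x. \<phi> x * \<psi> ((seq_shift ^^ n) x) \<partial>mu_f\<bar> \<le> c * (\<integral>x. \<bar>\<psi> x\<bar> \<partial>mu_f)"
proof -
  have [measurable]: "\<psi> \<in> borel_measurable borel" using \<psi> by (auto simp: measurable_cong_sets[OF sets_mu_f refl])
  note [measurable] = bounded_byD(1)[OF \<phi>]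
  have c0: "0 \<le> c" using order_trans[OF abs_ge_zero c] .
  \<comment> \<open>\<open>integral_correlation\<close> is for bounded functions; truncated at
    height \<open>k\<close>, \<open>\<psi>\<close> returns by dominated convergence, with the
    dominating function integrable by invariance.\<close>
  define \<psi>' where "\<psi>' k x = max (- real k) (min (real k) (\<psi> x))" for k x
  have [measurable]: "\<psi>' k \<in> borel_measurable borel" for k unfolding \<psi>'_def[abs_def] by measurable
  have b: "bounded_by (real k) (\<psi>' k)" for k by (auto simp: bounded_by_def \<psi>'_def)
  have le: "\<bar>\<psi>' k x\<bar> \<le> \<bar>\<psi> x\<bar>" for k x by (auto simp: \<psi>'_def)
  have lim: "(\<lambda>k. \<psi>' k x) \<longlonglongrightarrow> \<psi> x" for x
  proof (rule tendsto_eventually)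
    obtain k0 :: nat where "\<bar>\<psi> x\<bar> \<le> real k0" using real_arch_simple by blast
    then have "\<psi>' k x = \<psi> x" if "k0 \<le> k" for k using that by (auto simp: \<psi>'_def)
    then show "eventually (\<lambda>k. \<psi>' k x = \<psi> x) sequentially" unfolding eventually_sequentially by blast
  qed
  have bk: "\<bar>\<integral>x. \<phi> x * \<psi>' k ((seq_shift ^^ n) x) \<partial>mu_f\<bar> \<le> c * (\<integral>x. \<bar>\<psi> x\<bar> \<partial>mu_f)" for k
  proof -
    have "\<bar>\<integral>x. \<phi> x * \<psi>' k ((seq_shift ^^ n) x) \<partial>mu_f\<bar> = \<bar>\<integral>x. (Lbar ^^ n) \<phi> x * \<psi>' k x \<partial>mu_f\<bar>"
      by (simp only: integral_correlation[OF \<phi> b])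
    also have "\<dots> \<le> (\<integral>x. \<bar>(Lbar ^^ n) \<phi> x * \<psi>' k x\<bar> \<partial>mu_f)" by (rule integral_abs_bound)
    also have "\<dots> \<le> (\<integral>x. c * \<bar>\<psi> x\<bar> \<partial>mu_f)"
    proof (intro integral_mono integrable_abs integrable_mult_right \<psi>)
      show "integrable mu_f (\<lambda>x. (Lbar ^^ n) \<phi> x * \<psi>' k x)"
        by (rule integrable_mu_f[OF bounded_by_mult[OF bounded_by_Lbar_pow[OF \<phi>] b]])
      show "\<bar>(Lbar ^^ n) \<phi> x * \<psi>' k x\<bar> \<le> c * \<bar>\<psi> x\<bar>" for x
        unfolding abs_mult using c le c0 by (intro mult_mono) auto
    qed
    finally show ?thesis by simp
  qed
  have "(\<lambda>k. \<integral>x. \<phi> x * \<psi>' k ((seq_shift ^^ n) x) \<partial>mu_f) \<longlonglongrightarrow> (\<integral>x. \<phi> x * \<psi> ((seq_shift ^^ n) x) \<partial>mu_f)"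
  proof (rule integral_dominated_convergence[where w = "\<lambda>x. s * \<bar>\<psi> ((seq_shift ^^ n) x)\<bar>"])
    show "integrable mu_f (\<lambda>x. s * \<bar>\<psi> ((seq_shift ^^ n) x)\<bar>)"
      by (intro integrable_mult_right integrable_abs integrable_shift \<psi>)
    show "AE x in mu_f. (\<lambda>k. \<phi> x * \<psi>' k ((seq_shift ^^ n) x)) \<longlonglongrightarrow> \<phi> x * \<psi> ((seq_shift ^^ n) x)"
      by (intro AE_I2 tendsto_mult_left lim)
    show "AE x in mu_f. norm (\<phi> x * \<psi>' k ((seq_shift ^^ n) x)) \<le> s * \<bar>\<psi> ((seq_shift ^^ n) x)\<bar>" for k
      unfolding real_norm_def abs_mult using bounded_byD(2)[OF \<phi>] bounded_by_nonneg[OF \<phi>] le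
      by (intro AE_I2 mult_mono) auto
  qed measurable
  from tendsto_rabs[OF this] show ?thesis
    by (rule LIMSEQ_le_const2) (use bk in blast)
qed

end

section \<open>Decay for the one-sided shift\<close>

text \<open>As \<open>r \<le> 1 < r0\<close>, the logarithm of \<open>r0 * 2 ^ n / r\<close> is at
  least \<open>n * ln 2\<close>; this is the origin of the constant
  \<open>ln 2 powr - \<epsilon>\<close>.\<close>

lemma omega_log_decay:
  assumes \<epsilon>: "0 < \<epsilon>" and r0: "1 < r0" and r: "0 \<le> r" "r \<le> 1" and n: "1 \<le> n"
  shows "omega_log \<epsilon> r0 (r / 2 ^ n) \<le> ln 2 powr - \<epsilon> * real n powr - \<epsilon>"
proof (cases "r = 0")
  case False
  then have r': "0 < r" using r by simp
  have "ln (r0 / (r / 2 ^ n)) = ln (r0 / r) + real n * ln 2"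
    using r' r0 by (simp add: ln_mult ln_div ln_realpow)
  moreover have "0 \<le> ln (r0 / r)" using r' r r0 by (simp add: divide_simps)
  ultimately have "real n * ln 2 \<le> ln (r0 / (r / 2 ^ n))" by simp
  then have "ln (r0 / (r / 2 ^ n)) powr - \<epsilon> \<le> (real n * ln 2) powr - \<epsilon>"
    using n \<epsilon> by (intro powr_mono2') auto
  then show ?thesis using r' n by (simp add: omega_log_def powr_mult mult.commute)
qed (simp add: omega_log_def)

lemma C_omegaI:
  fixes g :: "'a \<Rightarrow> real"
  assumes "\<And>x. \<bar>g x\<bar> \<le> B" and "\<And>x y. \<bar>g x - g y\<bar> \<le> H * \<omega> (d x y)" and pos: "\<And>x y. x \<noteq> y \<Longrightarrow> 0 < \<omega> (d x y)"
  shows "g \<in> C_omega \<omega> d"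
proof -
  have "hol \<omega> d g \<le> ennreal H"
    unfolding hol_def
  proof (rule SUP_least, clarify)
    fix x y :: 'a assume "x \<noteq> y"
    then show "ennreal (\<bar>g x - g y\<bar> / \<omega> (d x y)) \<le> ennreal H"
      using assms(2)[of x y] pos[of x y] by (intro ennreal_leI) (simp add: pos_divide_le_eq)
  qed
  also have "\<dots> < \<infinity>" by simp
  finally show ?thesis using assms(1) by (auto simp: C_omega_def intro!: boundedI[where B = B])
qed

lemma C_omega_bounds:
  fixes g :: "'a \<Rightarrow> real"
  assumes g: "g \<in> C_omega \<omega> d"
  shows "\<bar>g x\<bar> \<le> enn2real (sup_norm g)"
    and "omega_norm \<omega> d g = ennreal (enn2real (sup_norm g) + enn2real (hol \<omega> d g))"
proof -
  obtain B where B: "\<And>x. \<bar>g x\<bar> \<le> B" using g by (auto simp: C_omega_def bounded_iff)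
  have "sup_norm g \<le> ennreal B" unfolding sup_norm_def by (rule SUP_least) (simp add: B ennreal_leI)
  also have "\<dots> < \<infinity>" by simp
  finally have fin: "sup_norm g = ennreal (enn2real (sup_norm g))" by (simp add: ennreal_enn2real)
  have "ennreal \<bar>g x\<bar> \<le> sup_norm g" unfolding sup_norm_def by (rule SUP_upper) simp
  then show "\<bar>g x\<bar> \<le> enn2real (sup_norm g)" by (subst (asm) fin) (simp add: ennreal_le_iff)
  have "hol \<omega> d g = ennreal (enn2real (hol \<omega> d g))" using g by (simp add: C_omega_def ennreal_enn2real)
  then show "omega_norm \<omega> d g = ennreal (enn2real (sup_norm g) + enn2real (hol \<omega> d g))"
    unfolding omega_norm_def using fin by (simp add: ennreal_plus)
qed

theorem shift_decay:
  fixes \<mu> :: "'e::polish_space measure"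
  assumes mu: "\<mu> \<in> borel_probs" and \<epsilon>: "0 < \<epsilon>" and r0: "1 < r0"
    and mod: "modulus_of_continuity_on {0..1} (omega_log \<epsilon> r0)"
    and f: "f \<in> C_omega (omega_log \<epsilon> r0) seq_dist"
    and flat: "flat_potential (omega_log \<epsilon> r0) seq_dist (natural_coupling \<mu>) f"
  shows "\<exists>h lam \<nu>.
         h \<in> C_omega (omega_log \<epsilon> r0) seq_dist \<and> (\<forall>x. 0 < h x) \<and> 0 < lam \<and>
         transfer_op (shift_kernel \<mu>) f h = (\<lambda>x. lam * h x) \<and>
         conformal_measure (shift_kernel \<mu>) f lam \<nu> \<and>
         (\<integral>x. h x \<partial>\<nu>) = 1 \<and>
         (let \<mu>f = density \<nu> (\<lambda>x. ennreal (h x));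
              fbar = (\<lambda>x. f x + ln (h x) - ln (h (seq_shift x)) - ln lam)
          in normalized (shift_kernel \<mu>) fbar \<and>
             stationary (shift_kernel \<mu>) fbar \<mu>f \<and>
             (\<exists>C>0. \<forall>\<phi>\<in>C_omega (omega_log \<epsilon> r0) seq_dist. (\<integral>x. \<phi> x \<partial>\<mu>f) = 0 \<longrightarrow>
                (\<forall>n\<ge>1. sup_norm ((transfer_op (shift_kernel \<mu>) fbar ^^ n) \<phi>)
                   \<le> ennreal C * omega_norm (omega_log \<epsilon> r0) seq_dist \<phi>
                       / ennreal (real n powr \<epsilon>))) \<and>
             polynomial_decay_of_correlations (omega_log \<epsilon> r0) seq_dist seq_shift \<mu>f \<epsilon>)"
proof -
  let ?\<omega> = "omega_log \<epsilon> r0"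
  have \<omega>_cont: "continuous_on {0..1} ?\<omega>" and \<omega>_mono: "strict_mono_on {0..1} ?\<omega>" and \<omega>_0: "?\<omega> 0 = 0"
    using mod by (auto simp: modulus_of_continuity_on_def)
  have \<omega>_pos: "0 < ?\<omega> (seq_dist x y)" if "x \<noteq> y" for x y :: "nat \<Rightarrow> 'e"
    using strict_mono_onD[OF \<omega>_mono, of 0 "seq_dist x y"] seq_dist_pos[OF that] seq_dist_le_1[of x y] \<omega>_0 by simp
  have \<omega>_refl: "?\<omega> (seq_dist x x) = 0" for x :: "nat \<Rightarrow> 'e" by (simp add: \<omega>_0)
  obtain F0 where F0: "\<And>x. \<bar>f x\<bar> \<le> F0" using f by (auto simp: C_omega_def bounded_iff)
  obtain C where C: "0 < C" "\<And>n x y. 1 \<le> n \<Longrightarrow> AE z in natural_coupling \<mu> n x y.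
        \<bar>birkhoff_sum f n (fst z) - birkhoff_sum f n (snd z)\<bar> \<le> C * ?\<omega> (seq_dist x y)"
    using flat by (auto simp: flat_potential_def split_beta')
  interpret shift_potential \<mu> ?\<omega> f C F0 "enn2real (hol ?\<omega> seq_dist f)" "ln 2 powr - \<epsilon>" \<epsilon>
  proof (unfold_locales, goal_cases)
    case (4 r s)
    then show ?case using strict_mono_on_leD[OF \<omega>_mono, of r s] by simp
  next
    case (6 r n)
    then show ?case by (rule omega_log_decay[OF \<epsilon> r0])
  next
    case (7 x y)
    show ?case by (rule C_omega_holder[OF f \<omega>_pos \<omega>_refl])
  qed (use mu \<omega>_cont \<omega>_0 \<epsilon> F0 C in auto)
  have bounds: "bounded_by (enn2real (sup_norm \<phi>)) \<phi>" "holder (enn2real (hol ?\<omega> seq_dist \<phi>)) \<phi>"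
    if \<phi>: "\<phi> \<in> C_omega ?\<omega> seq_dist" for \<phi> :: "(nat \<Rightarrow> 'e) \<Rightarrow> real"
  proof -
    have H: "\<bar>\<phi> x - \<phi> y\<bar> \<le> enn2real (hol ?\<omega> seq_dist \<phi>) * ?\<omega> (seq_dist x y)" for x y
      by (rule C_omega_holder[OF \<phi> \<omega>_pos \<omega>_refl])
    show "bounded_by (enn2real (sup_norm \<phi>)) \<phi>"
      using holder_measurable[OF H] C_omega_bounds(1)[OF \<phi>] by (simp add: bounded_by_def)
    show "holder (enn2real (hol ?\<omega> seq_dist \<phi>)) \<phi>" using H by (simp add: holder_def)
  qed
  have hC: "h \<in> C_omega ?\<omega> seq_dist"
    by (rule C_omegaI[where B = \<Delta> and H = "C * \<Delta>"])
      (use bounded_byD(2)[OF bounded_by_h] holder_h \<omega>_pos in \<open>auto simp: holder_def\<close>)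
  have eig: "transfer_op (shift_kernel \<mu>) f h = (\<lambda>x. lam * h x)"
    by (simp add: transfer_op_eq_L L_h fun_eq_iff)
  obtain K where K: "0 < K" and decay: "\<And>\<phi> s H n x. bounded_by s \<phi> \<Longrightarrow> holder H \<phi> \<Longrightarrow> (\<integral>x. \<phi> x \<partial>mu_f) = 0 \<Longrightarrow> 1 \<le> n \<Longrightarrow>
      \<bar>(Lbar ^^ n) \<phi> x\<bar> \<le> K * (s + H) * real n powr - \<epsilon>"
    by (rule Lbar_decay) (rule that)
  have dec: "sup_norm ((Lbar ^^ n) \<phi>) \<le> ennreal K * omega_norm ?\<omega> seq_dist \<phi> / ennreal (real n powr \<epsilon>)"
    if \<phi>: "\<phi> \<in> C_omega ?\<omega> seq_dist" "(\<integral>x. \<phi> x \<partial>mu_f) = 0" and n: "1 \<le> n" for \<phi> :: "(nat \<Rightarrow> 'e) \<Rightarrow> real" and n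
  proof -
    let ?N = "enn2real (sup_norm \<phi>) + enn2real (hol ?\<omega> seq_dist \<phi>)"
    have "sup_norm ((Lbar ^^ n) \<phi>) \<le> ennreal (K * ?N * real n powr - \<epsilon>)"
      unfolding sup_norm_def[of "(Lbar ^^ n) \<phi>"]
      by (intro SUP_least ennreal_leI decay[OF bounds[OF \<phi>(1)] \<phi>(2) n])
    also have "K * ?N * real n powr - \<epsilon> = K * ?N / real n powr \<epsilon>" by (simp add: powr_minus divide_inverse)
    also have "ennreal (K * ?N / real n powr \<epsilon>) = ennreal K * ennreal ?N / ennreal (real n powr \<epsilon>)"
      using K n by (subst divide_ennreal[symmetric]) (auto simp: ennreal_mult')
    finally show ?thesis using C_omega_bounds(2)[OF \<phi>(1)] by simp
  qed
  have corr: "polynomial_decay_of_correlations ?\<omega> seq_dist seq_shift mu_f \<epsilon>"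
    unfolding polynomial_decay_of_correlations_def
  proof (intro ballI allI impI)
    fix \<phi> \<psi> :: "(nat \<Rightarrow> 'e) \<Rightarrow> real"
    assume \<phi>: "\<phi> \<in> C_omega ?\<omega> seq_dist" and \<psi>: "integrable mu_f \<psi>"
    let ?S = "enn2real (sup_norm \<phi>)" and ?H = "enn2real (hol ?\<omega> seq_dist \<phi>)"
    define c where "c = (\<integral>x. \<phi> x \<partial>mu_f)"
    \<comment> \<open>Decay is known for functions of mean 0. Centring leaves the Hoelder constant
      unchanged and adds at most \<open>\<bar>c\<bar>\<close> to the sup bound.\<close>
    define \<phi>' where "\<phi>' x = \<phi> x - c" for x
    have b: "bounded_by (?S + \<bar>c\<bar>) \<phi>'"
      using bounds(1)[OF \<phi>] unfolding \<phi>'_def[abs_def]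
      by (auto simp: bounded_by_def intro!: order_trans[OF abs_triangle_ineq4] add_mono)
    have h': "holder ?H \<phi>'" using bounds(2)[OF \<phi>] by (simp add: holder_def \<phi>'_def)
    have z: "(\<integral>x. \<phi>' x \<partial>mu_f) = 0"
      using integrable_mu_f[OF bounds(1)[OF \<phi>]] muf.prob_space by (simp add: \<phi>'_def c_def)
    \<comment> \<open>\<open>M\<close> vanishes for instance when \<open>\<psi>\<close> is 0;
      \<open>M + 1\<close> is the positive constant that is asked for.\<close>
    define M where "M = K * (?S + \<bar>c\<bar> + ?H) * (\<integral>x. \<bar>\<psi> x\<bar> \<partial>mu_f)"
    have M0: "0 \<le> M" using K by (auto simp: M_def intro!: mult_nonneg_nonneg add_nonneg_nonneg)
    have "\<bar>(\<integral>x. \<phi> x * \<psi> ((seq_shift ^^ n) x) \<partial>mu_f) - c * (\<integral>x. \<psi> x \<partial>mu_f)\<bar> \<le> (M + 1) * real n powr - \<epsilon>"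
      if n: "1 \<le> n" for n
    proof -
      note i = integrable_shift[OF \<psi>, of n]
      have i2: "integrable mu_f (\<lambda>x. \<phi> x * \<psi> ((seq_shift ^^ n) x))"
      proof (rule Bochner_Integration.integrable_bound[of _ "\<lambda>x. ?S * \<psi> ((seq_shift ^^ n) x)"])
        show "AE x in mu_f. norm (\<phi> x * \<psi> ((seq_shift ^^ n) x)) \<le> norm (?S * \<psi> ((seq_shift ^^ n) x))"
          using bounded_byD(2)[OF bounds(1)[OF \<phi>]] by (auto simp: abs_mult intro!: mult_right_mono AE_I2)
        have "\<phi> \<in> borel_measurable mu_f"
          using bounded_byD(1)[OF bounds(1)[OF \<phi>]] by (simp add: measurable_cong_sets[OF sets_mu_f refl])
        then show "(\<lambda>x. \<phi> x * \<psi> ((seq_shift ^^ n) x)) \<in> borel_measurable mu_f"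
          using borel_measurable_integrable[OF i(1)] by (rule borel_measurable_times)
      qed (use i(1) in simp)
      have "(\<integral>x. \<phi>' x * \<psi> ((seq_shift ^^ n) x) \<partial>mu_f) =
          (\<integral>x. \<phi> x * \<psi> ((seq_shift ^^ n) x) \<partial>mu_f) - c * (\<integral>x. \<psi> x \<partial>mu_f)"
        using i i2 by (simp add: \<phi>'_def left_diff_distrib)
      moreover have "\<bar>\<integral>x. \<phi>' x * \<psi> ((seq_shift ^^ n) x) \<partial>mu_f\<bar> \<le>
          K * (?S + \<bar>c\<bar> + ?H) * real n powr - \<epsilon> * (\<integral>x. \<bar>\<psi> x\<bar> \<partial>mu_f)"
        by (rule correlation_bound[OF b decay[OF b h' z n] \<psi>])
      moreover have "\<dots> = M * real n powr - \<epsilon>" by (simp add: M_def mult_ac)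
      moreover have "M * real n powr - \<epsilon> \<le> (M + 1) * real n powr - \<epsilon>" by (intro mult_right_mono) auto
      ultimately show ?thesis by linarith
    qed
    then show "\<exists>K>0. \<forall>n\<ge>1. \<bar>(\<integral>x. \<phi> x * \<psi> ((seq_shift ^^ n) x) \<partial>mu_f) - (\<integral>x. \<phi> x \<partial>mu_f) * (\<integral>x. \<psi> x \<partial>mu_f)\<bar>
             \<le> K * real n powr - \<epsilon>"
      using M0 by (intro exI[of _ "M + 1"]) (auto simp: c_def)
  qed
  have fb: "(\<lambda>x. f x + ln (h x) - ln (h (seq_shift x)) - ln lam) = fbar" by (simp add: fbar_def fun_eq_iff)
  show ?thesis
    unfolding Let_def
  proof (rule exI[of _ h], rule exI[of _ lam], rule exI[of _ nu], unfold fb mu_f_def[symmetric] Lbar_def[symmetric], intro conjI)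
    show "\<exists>C>0. \<forall>\<phi>\<in>C_omega ?\<omega> seq_dist. (\<integral>x. \<phi> x \<partial>mu_f) = 0 \<longrightarrow>
        (\<forall>n\<ge>1. sup_norm ((Lbar ^^ n) \<phi>) \<le> ennreal C * omega_norm ?\<omega> seq_dist \<phi> / ennreal (real n powr \<epsilon>))"
      using K dec by blast
  qed (use hC h_pos lam_pos eig conformal_nu integral_h normalized_fbar stationary_mu_f corr in auto)
qed

theorem theorem5p10:
  shows
  "(\<forall>(m :: 'a::polish_space \<Rightarrow> 'a measure) (\<omega> :: real \<Rightarrow> real) (P :: 'a path_coupling)
      (f :: 'a \<Rightarrow> real) (R :: ereal) (F :: nat \<Rightarrow> real \<Rightarrow> real).
      bounded (UNIV :: 'a set) \<and>
      transition_kernel m \<and>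
      modulus_of_continuity_on {0..} \<omega> \<and>
      kernel_coupling m P \<and>
      f \<in> C_omega \<omega> dist \<and>
      flat_potential \<omega> dist P f \<and>
      normalized m f \<and>
      decay_function R F \<and>
      coupling_decay_rate \<omega> dist P f R F
      \<longrightarrow>
      (\<exists>C>0. \<forall>\<mu>\<in>borel_probs. \<forall>\<nu>\<in>borel_probs. \<forall>n.
         wasserstein \<omega> dist ((dual_op m f ^^ n) \<mu>) ((dual_op m f ^^ n) \<nu>)
           \<le> C * wasserstein \<omega> dist \<mu> \<nu>) \<and>
      (\<forall>\<alpha>>0. polynomial_decay_function \<alpha> R F \<longrightarrow>
         decays_polynomially \<omega> dist (dual_op m f) \<alpha>))
   \<and>
   (\<forall>(\<mu> :: 'e::polish_space measure) (\<epsilon> :: real) (r0 :: real) (f :: (nat \<Rightarrow> 'e) \<Rightarrow> real).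
      \<mu> \<in> borel_probs \<and>
      0 < \<epsilon> \<and>
      1 < r0 \<and> modulus_of_continuity_on {0..1} (omega_log \<epsilon> r0) \<and>
      f \<in> C_omega (omega_log \<epsilon> r0) seq_dist \<and>
      flat_potential (omega_log \<epsilon> r0) seq_dist (natural_coupling \<mu>) f
      \<longrightarrow>
      (\<exists>h lam \<nu>.
         h \<in> C_omega (omega_log \<epsilon> r0) seq_dist \<and> (\<forall>x. 0 < h x) \<and> 0 < lam \<and>
         transfer_op (shift_kernel \<mu>) f h = (\<lambda>x. lam * h x) \<and>
         conformal_measure (shift_kernel \<mu>) f lam \<nu> \<and>
         (\<integral>x. h x \<partial>\<nu>) = 1 \<and>
         (let \<mu>f = density \<nu> (\<lambda>x. ennreal (h x));
              fbar = (\<lambda>x. f x + ln (h x) - ln (h (seq_shift x)) - ln lam)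
          in normalized (shift_kernel \<mu>) fbar \<and>
             stationary (shift_kernel \<mu>) fbar \<mu>f \<and>
             (\<exists>C>0. \<forall>\<phi>\<in>C_omega (omega_log \<epsilon> r0) seq_dist. (\<integral>x. \<phi> x \<partial>\<mu>f) = 0 \<longrightarrow>
                (\<forall>n\<ge>1. sup_norm ((transfer_op (shift_kernel \<mu>) fbar ^^ n) \<phi>)
                   \<le> ennreal C * omega_norm (omega_log \<epsilon> r0) seq_dist \<phi>
                       / ennreal (real n powr \<epsilon>))) \<and>
             polynomial_decay_of_correlations (omega_log \<epsilon> r0) seq_dist seq_shift \<mu>f \<epsilon>)))"
proof (intro conjI allI impI; elim conjE)
  fix m :: "'a \<Rightarrow> 'a measure" and \<omega> :: "real \<Rightarrow> real" and P :: "'a path_coupling" and f :: "'a \<Rightarrow> real"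
    and R :: ereal and F :: "nat \<Rightarrow> real \<Rightarrow> real"
  assume *: "bounded (UNIV :: 'a set)" "transition_kernel m" "modulus_of_continuity_on {0..} \<omega>"
    "kernel_coupling m P" "f \<in> C_omega \<omega> dist" "flat_potential \<omega> dist P f" "normalized m f"
    "decay_function R F" "coupling_decay_rate \<omega> dist P f R F"
  show "\<exists>C>0. \<forall>\<mu>\<in>borel_probs. \<forall>\<nu>\<in>borel_probs. \<forall>n.
      wasserstein \<omega> dist ((dual_op m f ^^ n) \<mu>) ((dual_op m f ^^ n) \<nu>) \<le> C * wasserstein \<omega> dist \<mu> \<nu>"
    by (rule wasserstein_decay(1)[OF *])
  show "decays_polynomially \<omega> dist (dual_op m f) \<alpha>"
    if "0 < \<alpha>" "polynomial_decay_function \<alpha> R F" for \<alpha>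
    by (rule wasserstein_decay(2)[OF * that])
qed (rule shift_decay)

end
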